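(* Let $V$, $\omega$, $h$, $\varepsilon$, $\varphi$, $X$, $\hat\Gamma$ and $\hat I$ be as defined in the context, and let $\gamma_0=(r_0,0)\in\hat\Gamma$ be a nonconstant planar critical point of $\hat I$ with $\hat I(\gamma_0)>0$. Let $\lambda_0$, $\theta_0$ and $\bar r_0:[0,\theta_0]\to(0,\infty)$ be as in the context. Then the Morse index of the planar solution $\gamma_0$ in the $z$-direction coincides with the number of negative eigenvalues of the Sturm–Liouville operator $$\mathcal L_z\bar v:=-\frac{d}{d\theta}\left(\frac{\omega^2}{\bar r_0(\theta)^2}\bar v'(\theta)\right)-\bar r_0(\theta)^2V_{zz}(\bar r_0(\theta),0)\,\bar v(\theta)$$ under the Dirichlet boundary condition $\bar v(0)=\bar v(\theta_0)=0$.
   Context: Let $\omega>0$ and $V(r,z)=\frac{\omega^2}{2r^2}+V_0(r,z)$ for $r>0$, $z\in\mathbb{R}$. Assume: (V1) $V$ is $C^2$; (V2) $V(r,z)=V(r,-z)$; (V3) there exist $h_-<h_+$ such that, for every $h\in(h_-,h_+)$, the Hill region $\Omega_h:=\{(r,z)\mid V(r,z)\le h\}$ is compact and simply connected, does not contain the origin, and satisfies $\nabla V\neq0$ on $\partial\Omega_h=\{V=h\}$; moreover there exists $\varepsilon>0$ such that, for $J=\{r\in\mathbb{R}_+\mid(r,0)\in\operatorname{int}\Omega_{h+2\varepsilon}\}$, there is a continuous function $\zeta:J\to(0,\infty)$ with $\partial\Omega_{h+2\varepsilon}\cap\{z>0\}=\{(r,\zeta(r))\mid r\in J\}$. Fix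 $h\in(h_-,h_+)$ and $\varepsilon>0$ as in (V3), small enough that $h+2\varepsilon<h_+$, that $\nabla V(r,z)\ne0$ whenever $V(r,z)\in[h,h+2\varepsilon]$, and that $4/\varepsilon^2>h+\frac{3\varepsilon}{2}$. Let $\varphi:(-\infty,h+2\varepsilon)\to\mathbb{R}$ be a $C^\infty$ function with $\varphi'\ge1$, $\varphi(\tau)=\tau$ for $\tau\le h+\varepsilon$, and $\varphi(\tau)=(\tau-h-2\varepsilon)^{-2}$ for $\tau\in[h+\frac{3\varepsilon}{2},h+2\varepsilon)$. Put $\hat V=\varphi\circ V$ on $\hat\Omega:=\operatorname{int}\Omega_{h+2\varepsilon}=\{V<h+2\varepsilon\}$. Let $X=H^1([0,1],\mathbb{R})\times H^1_0([0,1],\mathbb{R})$ with its standard inner product, $\hat\Gamma=\{\gamma=(r,z)\in X\mid\gamma([0,1])\subset\hat\Omega\}$ (an open subset of $X$), $A(\gamma)=\int_0^1|\gamma'|^2dt$, $B(\gamma)=\int_0^1(h-\hat V(\gamma))\,dt$, and $\hat I=\frac12AB$ on $\hat\Gamma$. For a planar critical point $\gamma_0=(r_0,0)$ with $\hat I(\gamma_0)>0$ (for which $\gamma_0([0,1])\subset\Omega_h$, where $\hat V=V$), set $\lambda_0=\frac{A(\gamma_0)}{2B(\gamma_0)}$, $\theta(t)=\int_0^t\frac{\omega\sqrt{\lambda_0}}{r_0(\tau)^2}\,d\tau$, $\theta_0=\theta(1)$, and let $\bar r_0$ be $r_0$ expressed in the variable $\theta$, i.e. $\bar r_0(\theta(t))=r_0(t)$.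 The Morse index of $\gamma_0$ in the $z$-direction is the maximal dimension of a subspace of $\{(0,v)\mid v\in H^1_0([0,1],\mathbb{R})\}\subset X$ on which the quadratic form $\hat I''(\gamma_0)$ is negative definite. Subscripts on $V$ denote partial derivatives. *)

theory Defs
  imports "HOL-Analysis.Analysis"
begin

section \<open>Frechet derivatives as bounded linear maps\<close>

definition fderiv :: "('a::real_normed_vector \<Rightarrow> 'b::real_normed_vector) \<Rightarrow> 'a \<Rightarrow> 'a \<Rightarrow>\<^sub>L 'b"
  where "fderiv f x = Blinfun (frechet_derivative f (at x))"

text \<open>The two regularity predicates below are meant for open \<open>S\<close>.\<close>

definition C1_on :: "'a::real_normed_vector set \<Rightarrow> ('a \<Rightarrow> 'b::real_normed_vector) \<Rightarrow> bool"
  where "C1_on S f \<longleftrightarrow> (\<forall>x\<in>S. f differentiable at x) \<and> continuous_on S (fderiv f)"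

definition C2_on :: "'a::real_normed_vector set \<Rightarrow> ('a \<Rightarrow> 'b::real_normed_vector) \<Rightarrow> bool"
  where "C2_on S f \<longleftrightarrow> C1_on S f \<and> C1_on S (fderiv f)"

definition Cinf_on :: "real set \<Rightarrow> (real \<Rightarrow> real) \<Rightarrow> bool"
  where "Cinf_on S f \<longleftrightarrow> (\<forall>n. \<forall>x\<in>S. (deriv ^^ n) f differentiable at x)"

definition second_fderiv_form :: "('a::real_normed_vector \<Rightarrow> real) \<Rightarrow> 'a \<Rightarrow> 'a \<Rightarrow> real"
  where "second_fderiv_form f x u = blinfun_apply (blinfun_apply (fderiv (fderiv f) x) u) u"

text \<open>The maximal dimension of a subspace of \<open>Z\<close> on which the form \<open>Q\<close> is negative definite.
  HOL's \<open>dim\<close> is 0 on infinite-dimensional subspaces, hence the case distinction.\<close>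

definition edim :: "'a::real_vector set \<Rightarrow> enat"
  where "edim W = (if \<exists>B. finite B \<and> span B = W then enat (dim W) else \<infinity>)"

definition negative_index :: "'a::real_vector set \<Rightarrow> ('a \<Rightarrow> real) \<Rightarrow> enat"
  where "negative_index Z Q =
    (SUP W \<in> {W. subspace W \<and> W \<subseteq> Z \<and> (\<forall>u\<in>W. u \<noteq> 0 \<longrightarrow> Q u < 0)}. edim W)"

section \<open>The Sobolev spaces on the unit interval\<close>

text \<open>\<open>u\<close> is absolutely continuous on \<open>[0,1]\<close> with derivative \<open>g\<close> in \<open>L\<^sup>2(0,1)\<close>, that is, \<open>u\<close> is the
  continuous representative of an \<open>H\<^sup>1\<close> function with weak derivative \<open>g\<close>.\<close>

definition has_L2_deriv :: "(real \<Rightarrow> real) \<Rightarrow> (real \<Rightarrow> real) \<Rightarrow> bool"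
  where "has_L2_deriv u g \<longleftrightarrow>
    g \<in> borel_measurable borel \<and> set_integrable lborel {0..1} (\<lambda>t. (g t)\<^sup>2) \<and>
    (\<forall>t\<in>{0..1}. u t = u 0 + (LBINT s:{0..t}. g s))"

lemma has_L2_deriv_integrable:
  assumes "has_L2_deriv u g"
  shows "set_integrable lborel {0..1} g"
proof -
  have m[measurable]: "g \<in> borel_measurable borel" and i: "set_integrable lborel {0..1} (\<lambda>t. (g t)\<^sup>2)"
    using assms by (auto simp: has_L2_deriv_def)
  have c: "set_integrable lborel {0..1::real} (\<lambda>t. 1::real)"
    by (simp add: set_integrable_def)
  have "set_integrable lborel {0..1} (\<lambda>t. 1 + (g t)\<^sup>2)"
    by (rule set_integral_add(1)[OF c i])
  then show ?thesis
    unfolding set_integrable_def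
  proof (rule Bochner_Integration.integrable_bound)
    show "AE x in lborel. norm (indicat_real {0..1} x *\<^sub>R g x) \<le> norm (indicat_real {0..1} x *\<^sub>R (1 + (g x)\<^sup>2))"
    proof (rule AE_I2)
      fix x
      have "\<bar>g x\<bar> \<le> 1 + (g x)\<^sup>2"
        using zero_le_power2[of "\<bar>g x\<bar> - 1"] zero_le_power2[of "g x"]
        by (simp add: power2_diff)
      then show "norm (indicat_real {0..1} x *\<^sub>R g x) \<le> norm (indicat_real {0..1} x *\<^sub>R (1 + (g x)\<^sup>2))"
        by (auto simp: indicator_def)
    qed
  qed measurable
qed

lemma L2_mult_integrable:
  fixes f g :: "real \<Rightarrow> real"
  assumes [measurable]: "f \<in> borel_measurable borel" "g \<in> borel_measurable borel"
    and f: "set_integrable lborel {0..1} (\<lambda>t. (f t)\<^sup>2)" and g: "set_integrable lborel {0..1} (\<lambda>t. (g t)\<^sup>2)"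
  shows "set_integrable lborel {0..1} (\<lambda>t. f t * g t)"
proof -
  have "set_integrable lborel {0..1} (\<lambda>t. (f t)\<^sup>2 + (g t)\<^sup>2)"
    by (rule set_integral_add(1)[OF f g])
  then show ?thesis
    unfolding set_integrable_def
  proof (rule Bochner_Integration.integrable_bound)
    show "AE x in lborel. norm (indicat_real {0..1} x *\<^sub>R (f x * g x)) \<le> norm (indicat_real {0..1} x *\<^sub>R ((f x)\<^sup>2 + (g x)\<^sup>2))"
    proof (rule AE_I2)
      fix x
      have "\<bar>f x * g x\<bar> \<le> (f x)\<^sup>2 + (g x)\<^sup>2"
        using zero_le_power2[of "\<bar>f x\<bar> - \<bar>g x\<bar>"] zero_le_power2[of "f x"] zero_le_power2[of "g x"]
          mult_nonneg_nonneg[OF abs_ge_zero abs_ge_zero, of "f x" "g x"]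
        unfolding power2_diff power2_abs abs_mult by linarith
      then show "norm (indicat_real {0..1} x *\<^sub>R (f x * g x)) \<le> norm (indicat_real {0..1} x *\<^sub>R ((f x)\<^sup>2 + (g x)\<^sup>2))"
        by (auto simp: indicator_def)
    qed
  qed measurable
qed

lemma has_L2_deriv_sub:
  assumes "has_L2_deriv u g" "t \<in> {0..1}"
  shows "set_integrable lborel {0..t} g"
  by (rule set_integrable_subset[OF has_L2_deriv_integrable[OF assms(1)]]) (use assms(2) in auto)

lemma has_L2_deriv_zero: "has_L2_deriv (\<lambda>_. 0) (\<lambda>_. 0)"
  by (simp add: has_L2_deriv_def set_integrable_def set_lebesgue_integral_def)

lemma has_L2_deriv_add:
  assumes u: "has_L2_deriv u f" and v: "has_L2_deriv v g"
  shows "has_L2_deriv (\<lambda>t. u t + v t) (\<lambda>t. f t + g t)"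
proof -
  have m[measurable]: "f \<in> borel_measurable borel" "g \<in> borel_measurable borel"
    and i: "set_integrable lborel {0..1} (\<lambda>t. (f t)\<^sup>2)" "set_integrable lborel {0..1} (\<lambda>t. (g t)\<^sup>2)"
    using assms by (auto simp: has_L2_deriv_def)
  have "set_integrable lborel {0..1} (\<lambda>t. ((f t)\<^sup>2 + (g t)\<^sup>2) + 2 * (f t * g t))"
    by (intro set_integral_add(1) i set_integrable_mult_right L2_mult_integrable m)
  then have 1: "set_integrable lborel {0..1} (\<lambda>t. (f t + g t)\<^sup>2)"
    by (simp add: power2_sum algebra_simps)
  have 2: "u t + v t = (u 0 + v 0) + (LBINT s:{0..t}. f s + g s)" if "t \<in> {0..1}" for t
  proof -
    have "u t = u 0 + (LBINT s:{0..t}. f s)" "v t = v 0 + (LBINT s:{0..t}. g s)"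
      using assms that unfolding has_L2_deriv_def by blast+
    then show ?thesis
      using set_integral_add(2)[OF has_L2_deriv_sub[OF u that] has_L2_deriv_sub[OF v that]] by simp
  qed
  show ?thesis unfolding has_L2_deriv_def
    by (intro conjI ballI 1 2) simp_all
qed

lemma has_L2_deriv_scale:
  assumes u: "has_L2_deriv u f"
  shows "has_L2_deriv (\<lambda>t. c * u t) (\<lambda>t. c * f t)"
proof -
  have m[measurable]: "f \<in> borel_measurable borel"
    and i: "set_integrable lborel {0..1} (\<lambda>t. (f t)\<^sup>2)"
    using assms by (auto simp: has_L2_deriv_def)
  have 1: "set_integrable lborel {0..1} (\<lambda>t. (c * f t)\<^sup>2)"
    using i by (simp add: power_mult_distrib)
  have 2: "c * u t = c * u 0 + (LBINT s:{0..t}. c * f s)" if "t \<in> {0..1}" for t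
  proof -
    have "u t = u 0 + (LBINT s:{0..t}. f s)"
      using assms that unfolding has_L2_deriv_def by blast
    then show ?thesis by (simp add: distrib_left)
  qed
  show ?thesis unfolding has_L2_deriv_def
    by (intro conjI ballI 1 2) simp_all
qed

lemma has_L2_deriv_continuous:
  assumes u: "has_L2_deriv u f"
  shows "continuous_on {0..1} u"
proof -
  have "set_integrable lebesgue {0..1} f"
    using has_L2_deriv_integrable[OF u] unfolding set_integrable_def
    by (subst integrable_completion) auto
  then have 1: "f integrable_on {0..1}"
    by (rule set_lebesgue_integral_eq_integral)
  have 2: "u 0 + integral {0..t} f = u t" if "t \<in> {0..1}" for t
  proof -
    have "(LBINT s:{0..t}. f s) = integral {0..t} f"
      using set_borel_integral_eq_integral(2)[OF has_L2_deriv_sub[OF u that]] .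
    with u that show ?thesis unfolding has_L2_deriv_def by metis
  qed
  have "continuous_on {0..1} (\<lambda>t. u 0 + integral {0..t} f)"
    by (intro continuous_intros indefinite_integral_continuous_1 1)
  then show ?thesis
    by (rule continuous_on_eq) (rule 2)
qed

lemma has_L2_deriv_unique:
  assumes u: "has_L2_deriv u f" and v: "has_L2_deriv u g"
  shows "AE t in lborel. t \<in> {0..1} \<longrightarrow> f t = g t"
proof -
  have m[measurable]: "f \<in> borel_measurable borel" "g \<in> borel_measurable borel"
    using assms unfolding has_L2_deriv_def by blast+
  define k where "k = (\<lambda>t. indicat_real {0..1} t *\<^sub>R (f t - g t))"
  have ki: "integrable lborel k"
    using set_integral_diff(1)[OF has_L2_deriv_integrable[OF u] has_L2_deriv_integrable[OF v]]
    by (simp add: k_def set_integrable_def)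
  have 0: "(LBINT s:{0..t}. f s - g s) = 0" if "t \<in> {0..1}" for t
  proof -
    have "u t = u 0 + (LBINT s:{0..t}. f s)" "u t = u 0 + (LBINT s:{0..t}. g s)"
      using u v that unfolding has_L2_deriv_def by blast+
    then have "(LBINT s:{0..t}. f s) = (LBINT s:{0..t}. g s)" by linarith
    then show ?thesis
      using set_integral_diff(2)[OF has_L2_deriv_sub[OF u that] has_L2_deriv_sub[OF v that]] by simp
  qed
  have half: "(LBINT s:{..a}. k s) = 0" for a
  proof -
    consider "a < 0" | "a \<in> {0..1}" | "1 < a" by force
    then show ?thesis
    proof cases
      case 1
      then have "(LBINT s:{..a}. k s) = (LBINT s:{..a}. 0)"
        by (intro set_lebesgue_integral_cong) (auto simp: k_def)
      then show ?thesis by simp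
    next
      case 2
      then have "(LBINT s:{..a}. k s) = (LBINT s:{0..a}. f s - g s)"
        unfolding set_lebesgue_integral_def k_def
        by (intro Bochner_Integration.integral_cong) (auto simp: indicator_def)
      then show ?thesis using 0 2 by simp
    next
      case 3
      then have "(LBINT s:{..a}. k s) = (LBINT s:{0..1}. f s - g s)"
        unfolding set_lebesgue_integral_def k_def
        by (intro Bochner_Integration.integral_cong) (auto simp: indicator_def)
      then show ?thesis using 0 by simp
    qed
  qed
  have sk: "set_integrable lborel A k" if "A \<in> sets borel" for A
    using that ki unfolding set_integrable_def
    by (intro integrable_mult_indicator) auto
  have tot: "(LBINT s:UNIV. k s) = 0"
  proof -
    have "(LBINT s:UNIV. k s) = (LBINT s:{..1}. k s)"
      unfolding set_lebesgue_integral_def k_def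
      by (intro Bochner_Integration.integral_cong) (auto simp: indicator_def)
    then show ?thesis using half by simp
  qed
  have all: "(LBINT s:A. k s) = 0" if "A \<in> sets lborel" for A
  proof -
    have "Int_stable (range (atMost :: real \<Rightarrow> _))"
      by (auto simp: Int_stable_def)
    moreover have "range (atMost :: real \<Rightarrow> _) \<subseteq> Pow UNIV" by simp
    moreover have "A \<in> sigma_sets UNIV (range atMost)"
      using that by (simp add: borel_eq_atMost sets_measure_of)
    ultimately show ?thesis
    proof (induction rule: sigma_sets_induct_disjoint)
      case (basic A) then show ?case using half by auto
    next
      case empty show ?case by (simp add: set_lebesgue_integral_def)
    next
      case (compl A)
      then have A: "A \<in> sets borel" by (simp add: borel_eq_atMost sets_measure_of)
      have "(LBINT s:A \<union> (UNIV - A). k s) = (LBINT s:A. k s) + (LBINT s:UNIV - A. k s)"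
        using A by (intro set_integral_Un sk) auto
      then show ?case using tot compl by simp
    next
      case (union A)
      then have A: "\<And>i. A i \<in> sets lborel" by (auto simp: borel_eq_atMost sets_measure_of)
      have "(LBINT s:(\<Union>i. A i). k s) = (\<Sum>i. (LBINT s:A i. k s))"
        using A union by (intro lebesgue_integral_countable_add sk) (auto simp: disjoint_family_on_def)
      then show ?case using union by simp
    qed
  qed
  have "AE t in lborel. k t = 0"
    by (rule sigma_finite_measure.density_zero[OF sigma_finite_lborel ki all])
  then show ?thesis
    by eventually_elim (auto simp: k_def)
qed

text \<open>Elements of \<open>H\<^sup>1([0,1],\<real>)\<close> are represented by their continuous representatives, extended by \<open>0\<close>
  outside \<open>[0,1]\<close> so that equality in the type is equality on \<open>[0,1]\<close>.\<close>

typedef h1 = "{u :: real \<Rightarrow> real. (\<forall>t. t \<notin> {0..1} \<longrightarrow> u t = 0) \<and> (\<exists>g. has_L2_deriv u g)}"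
  morphisms h1_fun Abs_h1
  by (intro exI[of _ "\<lambda>_. 0"] CollectI conjI exI[of _ "\<lambda>_. 0"]) (simp, rule has_L2_deriv_zero)

setup_lifting type_definition_h1

definition h1_deriv :: "h1 \<Rightarrow> real \<Rightarrow> real"
  where "h1_deriv u = (SOME g. has_L2_deriv (h1_fun u) g)"

instantiation h1 :: real_vector
begin

lift_definition zero_h1 :: h1 is "\<lambda>_. 0"
  by (intro conjI exI, simp, rule has_L2_deriv_zero)

lift_definition plus_h1 :: "h1 \<Rightarrow> h1 \<Rightarrow> h1" is "\<lambda>u v t. u t + v t"
  subgoal for u v
    by (elim conjE exE, intro conjI exI, simp, erule (1) has_L2_deriv_add)
  done

lift_definition scaleR_h1 :: "real \<Rightarrow> h1 \<Rightarrow> h1" is "\<lambda>c u t. c * u t"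
  subgoal for c u
    by (elim conjE exE, intro conjI exI, simp, erule has_L2_deriv_scale)
  done

definition uminus_h1 :: "h1 \<Rightarrow> h1" where "- u = (-1) *\<^sub>R (u :: h1)"

definition minus_h1 :: "h1 \<Rightarrow> h1 \<Rightarrow> h1" where "u - v = u + (- v :: h1)"

instance
proof
  fix a b c :: h1 and x y :: real
  note h1_fun_inject[symmetric, simp] fun_eq_iff[simp]
    plus_h1.rep_eq[simp] scaleR_h1.rep_eq[simp] zero_h1.rep_eq[simp]
  show "a + b + c = a + (b + c)" by (simp add: add.assoc)
  show "a + b = b + a" by (simp add: add.commute)
  show "0 + a = a" by simp
  show "- a + a = 0" by (simp add: uminus_h1_def)
  show "a - b = a + - b" by (rule minus_h1_def)
  show "x *\<^sub>R (a + b) = x *\<^sub>R a + x *\<^sub>R b" by (simp add: distrib_left)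
  show "(x + y) *\<^sub>R a = x *\<^sub>R a + y *\<^sub>R a" by (simp add: distrib_right)
  show "x *\<^sub>R y *\<^sub>R a = (x * y) *\<^sub>R a" by (simp add: mult.assoc)
  show "1 *\<^sub>R a = a" by simp
qed

end

lemma h1_deriv: "has_L2_deriv (h1_fun u) (h1_deriv u)"
proof -
  have "\<exists>g. has_L2_deriv (h1_fun u) g" using h1_fun[of u] by auto
  then show ?thesis unfolding h1_deriv_def by (rule someI_ex)
qed

lemma h1_deriv_add: "AE t in lborel. t \<in> {0..1} \<longrightarrow> h1_deriv (u + v) t = h1_deriv u t + h1_deriv v t"
  using has_L2_deriv_unique[OF h1_deriv[of "u + v", unfolded plus_h1.rep_eq] has_L2_deriv_add[OF h1_deriv[of u] h1_deriv[of v]]] .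

lemma h1_deriv_scaleR: "AE t in lborel. t \<in> {0..1} \<longrightarrow> h1_deriv (c *\<^sub>R u) t = c * h1_deriv u t"
  using has_L2_deriv_unique[OF h1_deriv[of "c *\<^sub>R u", unfolded scaleR_h1.rep_eq] has_L2_deriv_scale[OF h1_deriv[of u], of c]] .

lemma h1_fun_measurable [measurable]: "h1_fun u \<in> borel_measurable borel"
proof -
  have "(\<lambda>t. indicator {0..1} t *\<^sub>R h1_fun u t) \<in> borel_measurable borel"
    by (rule borel_measurable_continuous_on_indicator[of "{0..1}" "h1_fun u", OF _ has_L2_deriv_continuous[OF h1_deriv]])
      simp
  moreover have "(\<lambda>t. indicator {0..1} t *\<^sub>R h1_fun u t) = h1_fun u"
    using h1_fun[of u] by (auto simp: indicator_def fun_eq_iff)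
  ultimately show ?thesis by simp
qed

lemma h1_deriv_measurable [measurable]: "h1_deriv u \<in> borel_measurable borel"
  using h1_deriv[of u] unfolding has_L2_deriv_def by blast

lemma h1_fun_mult_integrable: "set_integrable lborel {0..1} (\<lambda>t. h1_fun u t * h1_fun v t)"
  unfolding set_integrable_def
  by (intro borel_integrable_compact compact_Icc continuous_on_mult has_L2_deriv_continuous[OF h1_deriv])

lemma h1_deriv_mult_integrable: "set_integrable lborel {0..1} (\<lambda>t. h1_deriv u t * h1_deriv v t)"
  by (rule L2_mult_integrable[OF h1_deriv_measurable h1_deriv_measurable])
    (use h1_deriv[unfolded has_L2_deriv_def] in blast)+

instantiation h1 :: real_inner
begin

definition inner_h1 :: "h1 \<Rightarrow> h1 \<Rightarrow> real"
  where "inner_h1 u v = (LBINT t:{0..1}. h1_fun u t * h1_fun v t) + (LBINT t:{0..1}. h1_deriv u t * h1_deriv v t)"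

definition norm_h1 :: "h1 \<Rightarrow> real" where "norm_h1 u = sqrt (inner u u)"

definition sgn_h1 :: "h1 \<Rightarrow> h1" where "sgn_h1 u = u /\<^sub>R norm u"

definition dist_h1 :: "h1 \<Rightarrow> h1 \<Rightarrow> real" where "dist_h1 u v = norm (u - v)"

definition uniformity_h1 :: "(h1 \<times> h1) filter"
  where "uniformity_h1 = (INF e\<in>{0<..}. principal {(x, y). dist x y < e})"

definition open_h1 :: "h1 set \<Rightarrow> bool"
  where "open_h1 U \<longleftrightarrow> (\<forall>x\<in>U. eventually (\<lambda>(x', y). x' = x \<longrightarrow> y \<in> U) uniformity)"

instance
proof
  fix x y z :: h1 and r :: real and U :: "h1 set"
  show "sgn x = x /\<^sub>R norm x" by (rule sgn_h1_def)
  show "dist x y = norm (x - y)" by (rule dist_h1_def)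
  show "uniformity = (INF e\<in>{0<..}. principal {(x::h1, y). dist x y < e})" by (rule uniformity_h1_def)
  show "open U \<longleftrightarrow> (\<forall>x\<in>U. eventually (\<lambda>(x', y). x' = x \<longrightarrow> y \<in> U) uniformity)"
    by (rule open_h1_def)
  show "inner x y = inner y x" by (simp add: inner_h1_def mult.commute)
  have "(LBINT t:{0..1}. h1_deriv (x + y) t * h1_deriv z t)
      = (LBINT t:{0..1}. h1_deriv x t * h1_deriv z t + h1_deriv y t * h1_deriv z t)"
    by (rule set_lebesgue_integral_cong_AE)
      (use h1_deriv_add[of x y] in \<open>auto simp: distrib_right elim: eventually_mono\<close>)
  then show "inner (x + y) z = inner x z + inner y z"
    unfolding inner_h1_def plus_h1.rep_eq distrib_right
    by (simp add: set_integral_add(2)[OF h1_fun_mult_integrable h1_fun_mult_integrable]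
        set_integral_add(2)[OF h1_deriv_mult_integrable h1_deriv_mult_integrable])
  have "(LBINT t:{0..1}. h1_deriv (r *\<^sub>R x) t * h1_deriv y t)
      = (LBINT t:{0..1}. r * (h1_deriv x t * h1_deriv y t))"
    by (rule set_lebesgue_integral_cong_AE)
      (use h1_deriv_scaleR[of r x] in \<open>auto simp: mult.assoc elim: eventually_mono\<close>)
  then show "inner (r *\<^sub>R x) y = r * inner x y"
    unfolding inner_h1_def scaleR_h1.rep_eq mult.assoc
    by (simp add: distrib_left)
  have f0: "0 \<le> (LBINT t:{0..1}. h1_fun x t * h1_fun x t)" and d0: "0 \<le> (LBINT t:{0..1}. h1_deriv x t * h1_deriv x t)"
    unfolding set_lebesgue_integral_def by (auto intro!: Bochner_Integration.integral_nonneg)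
  then show "0 \<le> inner x x" by (simp add: inner_h1_def)
  show "inner x x = 0 \<longleftrightarrow> x = 0"
  proof
    assume "x = 0"
    have "h1_deriv (0 *\<^sub>R (0::h1)) = h1_deriv 0" by simp
    with h1_deriv_scaleR[of 0 0] have ae: "AE t in lborel. t \<in> {0..1} \<longrightarrow> h1_deriv 0 t = 0" by simp
    have "(LBINT t:{0..1}. h1_deriv 0 t * h1_deriv 0 t) = (LBINT t:{0..1::real}. 0)"
      by (rule set_lebesgue_integral_cong_AE) (use ae in \<open>auto elim: eventually_mono\<close>)
    then show "inner x x = 0" by (simp add: \<open>x = 0\<close> inner_h1_def zero_h1.rep_eq)
  next
    assume "inner x x = 0"
    with f0 d0 have z: "(LBINT t:{0..1}. h1_fun x t * h1_fun x t) = 0" by (simp add: inner_h1_def)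
    have c: "continuous_on {0..1} (\<lambda>t. h1_fun x t * h1_fun x t)"
      by (intro continuous_intros has_L2_deriv_continuous[OF h1_deriv])
    have "integral {0..1} (\<lambda>t. h1_fun x t * h1_fun x t) = 0"
      using z set_borel_integral_eq_integral(2)[OF h1_fun_mult_integrable[of x x]] by simp
    then have "((\<lambda>t. h1_fun x t * h1_fun x t) has_integral 0) (cbox 0 1)"
      using integrable_integral[OF integrable_continuous_real[OF c]] by simp
    then have "h1_fun x t * h1_fun x t = 0" if "t \<in> {0..1}" for t
      using has_integral_0_cbox_imp_0[of 0 1 "\<lambda>t. h1_fun x t * h1_fun x t" t] c that by simp
    then have "h1_fun x t = 0" for t
      using h1_fun[of x] by (cases "t \<in> {0..1}") auto
    then show "x = 0" by transfer auto
  qed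
  show "norm x = sqrt (inner x x)" by (rule norm_h1_def)
qed

end

typedef h10 = "{u :: h1. h1_fun u 0 = 0 \<and> h1_fun u 1 = 0}"
  morphisms h10_h1 Abs_h10
  by (rule exI[of _ 0]) (simp add: zero_h1.rep_eq)

setup_lifting type_definition_h10

instantiation h10 :: real_vector
begin

lift_definition zero_h10 :: h10 is 0 by (simp add: zero_h1.rep_eq)

lift_definition plus_h10 :: "h10 \<Rightarrow> h10 \<Rightarrow> h10" is "(+)" by (simp add: plus_h1.rep_eq)

lift_definition scaleR_h10 :: "real \<Rightarrow> h10 \<Rightarrow> h10" is "(*\<^sub>R)" by (simp add: scaleR_h1.rep_eq)

definition uminus_h10 :: "h10 \<Rightarrow> h10" where "- u = (-1) *\<^sub>R (u :: h10)"

definition minus_h10 :: "h10 \<Rightarrow> h10 \<Rightarrow> h10" where "u - v = u + (- v :: h10)"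

instance
proof
  fix a b c :: h10 and x y :: real
  show "a + b + c = a + (b + c)" by transfer (simp add: add.assoc)
  show "a + b = b + a" by transfer (simp add: add.commute)
  show "0 + a = a" by transfer simp
  show "- a + a = 0" unfolding uminus_h10_def by transfer simp
  show "a - b = a + - b" by (simp add: minus_h10_def)
  show "x *\<^sub>R (a + b) = x *\<^sub>R a + x *\<^sub>R b" by transfer (simp add: scaleR_add_right)
  show "(x + y) *\<^sub>R a = x *\<^sub>R a + y *\<^sub>R a" by transfer (simp add: scaleR_add_left)
  show "x *\<^sub>R y *\<^sub>R a = (x * y) *\<^sub>R a" by transfer simp
  show "1 *\<^sub>R a = a" by transfer simp
qed

end

instantiation h10 :: real_inner
begin

lift_definition inner_h10 :: "h10 \<Rightarrow> h10 \<Rightarrow> real" is inner .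

lift_definition norm_h10 :: "h10 \<Rightarrow> real" is norm .

definition sgn_h10 :: "h10 \<Rightarrow> h10" where "sgn_h10 u = u /\<^sub>R norm u"

definition dist_h10 :: "h10 \<Rightarrow> h10 \<Rightarrow> real" where "dist_h10 u v = norm (u - v)"

definition uniformity_h10 :: "(h10 \<times> h10) filter"
  where "uniformity_h10 = (INF e\<in>{0<..}. principal {(x, y). dist x y < e})"

definition open_h10 :: "h10 set \<Rightarrow> bool"
  where "open_h10 U \<longleftrightarrow> (\<forall>x\<in>U. eventually (\<lambda>(x', y). x' = x \<longrightarrow> y \<in> U) uniformity)"

instance
proof
  fix a b c :: h10 and x :: real and U :: "h10 set"
  show "sgn a = a /\<^sub>R norm a" by (rule sgn_h10_def)
  show "dist a b = norm (a - b)" by (rule dist_h10_def)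
  show "uniformity = (INF e\<in>{0<..}. principal {(x::h10, y). dist x y < e})" by (rule uniformity_h10_def)
  show "open U \<longleftrightarrow> (\<forall>x\<in>U. eventually (\<lambda>(x', y). x' = x \<longrightarrow> y \<in> U) uniformity)"
    by (rule open_h10_def)
  show "inner a b = inner b a" by transfer (rule inner_commute)
  show "inner (a + b) c = inner a c + inner b c" by transfer (rule inner_add_left)
  show "inner (x *\<^sub>R a) b = x * inner a b" by transfer simp
  show "0 \<le> inner a a" by transfer simp
  show "inner a a = 0 \<longleftrightarrow> a = 0" by transfer simp
  show "norm a = sqrt (inner a a)" by transfer (rule norm_eq_sqrt_inner)
qed

end

abbreviation h10_fun :: "h10 \<Rightarrow> real \<Rightarrow> real" where "h10_fun u \<equiv> h1_fun (h10_h1 u)"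
abbreviation h10_deriv :: "h10 \<Rightarrow> real \<Rightarrow> real" where "h10_deriv u \<equiv> h1_deriv (h10_h1 u)"

text \<open>\<open>X = H\<^sup>1 \<times> H\<^sup>1\<^sub>0\<close>; the instance \<open>prod :: real_inner\<close> supplies its inner product.\<close>

type_synonym path_space = "h1 \<times> h10"

section \<open>Hill regions\<close>

text \<open>The potential is only meaningful on the open half plane \<open>r > 0\<close>.\<close>

definition half_plane :: "(real \<times> real) set"
  where "half_plane = {p. fst p > 0}"

definition Hill :: "(real \<times> real \<Rightarrow> real) \<Rightarrow> real \<Rightarrow> (real \<times> real) set"
  where "Hill V h = {p \<in> half_plane. V p \<le> h}"

definition boundary_graph :: "(real \<times> real \<Rightarrow> real) \<Rightarrow> real \<Rightarrow> real \<Rightarrow> bool"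
  where "boundary_graph V h \<epsilon> \<longleftrightarrow>
    (let J = {r. r > 0 \<and> (r, 0) \<in> interior (Hill V (h + 2 * \<epsilon>))} in
     \<exists>\<zeta>. continuous_on J \<zeta> \<and> (\<forall>r\<in>J. \<zeta> r > 0) \<and>
       frontier (Hill V (h + 2 * \<epsilon>)) \<inter> {p. snd p > 0} = {(r, \<zeta> r) | r. r \<in> J})"

definition Hill_condition :: "(real \<times> real \<Rightarrow> real) \<Rightarrow> real \<Rightarrow> real \<Rightarrow> bool"
  where "Hill_condition V h\<^sub>m h\<^sub>p \<longleftrightarrow> h\<^sub>m < h\<^sub>p \<and>
    (\<forall>h. h\<^sub>m < h \<and> h < h\<^sub>p \<longrightarrow>
       compact (Hill V h) \<and> simply_connected (Hill V h) \<and> (0, 0) \<notin> Hill V h \<and>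
       frontier (Hill V h) = {p \<in> half_plane. V p = h} \<and>
       (\<forall>p\<in>frontier (Hill V h). fderiv V p \<noteq> 0) \<and>
       (\<exists>\<epsilon>>0. boundary_graph V h \<epsilon>))"

definition V_zz :: "(real \<times> real \<Rightarrow> real) \<Rightarrow> real \<Rightarrow> real \<Rightarrow> real"
  where "V_zz V r z = deriv (deriv (\<lambda>y. V (r, y))) z"

definition cutoff :: "(real \<Rightarrow> real) \<Rightarrow> real \<Rightarrow> real \<Rightarrow> bool"
  where "cutoff \<phi> h \<epsilon> \<longleftrightarrow>
    Cinf_on {..<h + 2 * \<epsilon>} \<phi> \<and> (\<forall>\<tau><h + 2 * \<epsilon>. deriv \<phi> \<tau> \<ge> 1) \<and>
    (\<forall>\<tau>\<le>h + \<epsilon>. \<phi> \<tau> = \<tau>) \<and>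
    (\<forall>\<tau>\<in>{h + 3 * \<epsilon> / 2..<h + 2 * \<epsilon>}. \<phi> \<tau> = 1 / (\<tau> - h - 2 * \<epsilon>)\<^sup>2)"

section \<open>The functional\<close>

definition Gamma_hat :: "(real \<times> real \<Rightarrow> real) \<Rightarrow> real \<Rightarrow> real \<Rightarrow> path_space set"
  where "Gamma_hat V h \<epsilon> =
    {(r, z). \<forall>t\<in>{0..1}. (h1_fun r t, h10_fun z t) \<in> interior (Hill V (h + 2 * \<epsilon>))}"

definition A_fun :: "path_space \<Rightarrow> real"
  where "A_fun = (\<lambda>(r, z). LBINT t:{0..1}. (h1_deriv r t)\<^sup>2 + (h10_deriv z t)\<^sup>2)"

definition B_fun :: "(real \<times> real \<Rightarrow> real) \<Rightarrow> (real \<Rightarrow> real) \<Rightarrow> real \<Rightarrow> path_space \<Rightarrow> real"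
  where "B_fun V \<phi> h = (\<lambda>(r, z). LBINT t:{0..1}. h - \<phi> (V (h1_fun r t, h10_fun z t)))"

text \<open>Only the values on \<open>Gamma_hat V h \<epsilon>\<close>, an open set, are meaningful.\<close>

definition I_hat :: "(real \<times> real \<Rightarrow> real) \<Rightarrow> (real \<Rightarrow> real) \<Rightarrow> real \<Rightarrow> path_space \<Rightarrow> real"
  where "I_hat V \<phi> h \<gamma> = 1 / 2 * A_fun \<gamma> * B_fun V \<phi> h \<gamma>"

definition z_morse_index :: "(path_space \<Rightarrow> real) \<Rightarrow> path_space \<Rightarrow> enat"
  where "z_morse_index F \<gamma> = negative_index {(0, v) | v. True} (second_fderiv_form F \<gamma>)"

section \<open>Sturm--Liouville operators\<close>

text \<open>\<open>f = - (p v')' + q v\<close> on \<open>[0,L]\<close> in the classical sense, with one-sided derivatives at the end points.\<close>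

definition sturm_liouville ::
    "(real \<Rightarrow> real) \<Rightarrow> (real \<Rightarrow> real) \<Rightarrow> real \<Rightarrow> (real \<Rightarrow> real) \<Rightarrow> (real \<Rightarrow> real) \<Rightarrow> bool"
  where "sturm_liouville p q L v f \<longleftrightarrow>
    (\<exists>v' w. \<forall>x\<in>{0..L}.
       (v has_real_derivative v' x) (at x within {0..L}) \<and>
       ((\<lambda>y. p y * v' y) has_real_derivative w x) (at x within {0..L}) \<and>
       f x = - w x + q x * v x)"

definition dirichlet_eigenvalue :: "(real \<Rightarrow> real) \<Rightarrow> (real \<Rightarrow> real) \<Rightarrow> real \<Rightarrow> real \<Rightarrow> bool"
  where "dirichlet_eigenvalue p q L \<mu> \<longleftrightarrow>
    (\<exists>v. sturm_liouville p q L v (\<lambda>x. \<mu> * v x) \<and> v 0 = 0 \<and> v L = 0 \<and> (\<exists>x\<in>{0..L}. v x \<noteq> 0))"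

end

theory Submission
  imports Defs
begin

text \<open>
  In the direction \<open>(0, v)\<close> the second derivative of the functional at \<open>(r\<^sub>0, 0)\<close> is a positive multiple of
  \<open>\<integral> v'\<^sup>2 - lam\<^sub>0 V\<^sub>z\<^sub>z(r\<^sub>0, 0) v\<^sup>2\<close> over \<open>[0,1]\<close>: the kinetic bilinear form pairs \<open>(r\<^sub>0, 0)\<close> and \<open>(0, v)\<close> to
  zero, so the mixed terms of the product rule drop out, and \<open>\<phi> \<circ> V = V\<close> near the path. For the latter,
  testing criticality with \<open>(u, 0)\<close>, where \<open>u\<close> is free at both ends, makes \<open>r\<^sub>0\<close> a classical solution of
  the Euler--Lagrange equation; its conserved energy is \<open>lam\<^sub>0 h\<close>, hence \<open>V \<le> h\<close> along the path
  (\<open>planar_energy_bound\<close>).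

  In the variable \<open>t\<close> instead of \<open>\<theta>\<close> the Sturm--Liouville problem reads \<open>v'' = (q - \<mu> w) v\<close> on \<open>[0,1]\<close>
  with \<open>q = - lam\<^sub>0 V\<^sub>z\<^sub>z(r\<^sub>0, 0)\<close> and \<open>w = lam\<^sub>0 / r\<^sub>0\<^sup>2 > 0\<close> (\<open>dirichlet_eigenvalue_reparametrised\<close>). It remains to
  compare the index of the Dirichlet form \<open>\<integral> v'\<^sup>2 + q v\<^sup>2\<close> with the number of negative \<open>\<mu>\<close>
  (\<open>negative_index_eq_card_dirichlet_eigenvalues\<close>).

  That comparison avoids spectral theory. Let \<open>k\<close> be the number of zeros in \<open>(0,1)\<close> of the solution of
  \<open>y'' = q y\<close>, \<open>y(0) = 0\<close>, \<open>y'(0) = 1\<close>. Three inequalities close a circle: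
  \<^item> index \<open>\<le> k\<close>: the form is nonnegative on functions that vanish at these zeros (\<open>jacobi_nonneg\<close>), and
    vanishing at \<open>k\<close> points is \<open>k\<close> linear conditions (\<open>negative_index_le\<close>);
  \<^item> \<open>k \<le>\<close> number of negative eigenvalues: the Pruefer angle at \<open>t = 1\<close> depends continuously on \<open>\<mu>\<close>,
    exceeds \<open>k \<pi>\<close> at \<open>\<mu> = 0\<close> and lies below \<open>\<pi>\<close> for very negative \<open>\<mu>\<close>, so it takes each of the values
    \<open>\<pi>, \<dots>, k \<pi>\<close> at some negative \<open>\<mu>\<close> (\<open>dirichlet_eigenvalues_exist\<close>);
  \<^item> number of negative eigenvalues \<open>\<le>\<close> index: eigenfunctions for different \<open>\<mu>\<close> are orthogonal with
    weight \<open>w\<close>, so they diagonalise the form on their span (\<open>dirichlet_form_combination\<close>).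
\<close>

section \<open>Products of primitives of integrable functions\<close>

text \<open>Absolute continuity, with a chosen derivative, on an arbitrary interval: the Jacobi condition
  needs the product rule between consecutive zeros.\<close>
definition primitive_on :: "real \<Rightarrow> real \<Rightarrow> (real \<Rightarrow> real) \<Rightarrow> (real \<Rightarrow> real) \<Rightarrow> bool"
  where "primitive_on a b u g \<longleftrightarrow>
    set_integrable lborel {a..b} g \<and> (\<forall>t\<in>{a..b}. u t = u a + (LBINT s:{a..t}. g s))"

lemma primitive_onD:
  assumes "primitive_on a b u g"
  shows "set_integrable lborel {a..b} g"
    and "t \<in> {a..b} \<Longrightarrow> u t = u a + (LBINT s:{a..t}. g s)"
  using assms unfolding primitive_on_def by blast+

lemma integrable_tensor_indicator:
  fixes F G :: "real \<Rightarrow> real"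
  assumes F: "integrable lborel F" and G: "integrable lborel G"
    and P[measurable]: "Measurable.pred (lborel \<Otimes>\<^sub>M lborel) (\<lambda>p. P (fst p) (snd p))"
  shows "integrable (lborel \<Otimes>\<^sub>M lborel) (\<lambda>(x, y). F x * (G y * indicator {y. P x y} y))"
proof -
  have [measurable]: "F \<in> borel_measurable lborel" "G \<in> borel_measurable lborel"
    using F G by auto
  have "integrable (lborel \<Otimes>\<^sub>M lborel) (\<lambda>p. F (fst p) * G (snd p))"
  proof (rule lborel_pair.Fubini_integrable)
    show "integrable lborel (\<lambda>x. LINT y|lborel. norm (F (fst (x, y)) * G (snd (x, y))))"
      using F by (simp add: abs_mult)
    show "AE x in lborel. integrable lborel (\<lambda>y. F (fst (x, y)) * G (snd (x, y)))"
      using G by simp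
  qed measurable
  then show ?thesis
  proof (rule Bochner_Integration.integrable_bound)
    show "(\<lambda>(x, y). F x * (G y * indicator {y. P x y} y)) \<in> borel_measurable (lborel \<Otimes>\<^sub>M lborel)"
      unfolding case_prod_beta indicator_def mem_Collect_eq by measurable
  qed (auto simp: indicator_def)
qed

text \<open>Integration by parts for absolutely continuous functions, by Fubini: expanding both functions as
  integrals leaves the integrals of \<open>f(x) g(y)\<close> over the two triangles \<open>y \<le> x\<close> and \<open>x \<le> y\<close>, which
  together make up the square. No pointwise differentiability is involved.\<close>
lemma primitive_on_mult:
  assumes u: "primitive_on a b u f" and v: "primitive_on a b v g" and "a \<le> b"
  shows "set_integrable lborel {a..b} (\<lambda>t. f t * v t + u t * g t)"
    and "(LBINT t:{a..b}. f t * v t + u t * g t) = u b * v b - u a * v a"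
proof -
  define F where "F = (\<lambda>t. indicat_real {a..b} t * f t)"
  define G where "G = (\<lambda>t. indicat_real {a..b} t * g t)"
  have Fi: "integrable lborel F" and Gi: "integrable lborel G"
    using u v unfolding primitive_on_def set_integrable_def F_def G_def real_scaleR_def by blast+
  have ut: "u t = u a + (LBINT s. F s * indicator {s. s \<le> t} s)" if "t \<in> {a..b}" for t
  proof -
    note primitive_onD(2)[OF u that]
    also have "(LBINT s:{a..t}. f s) = (LBINT s. F s * indicator {s. s \<le> t} s)"
      unfolding set_lebesgue_integral_def F_def using that
      by (intro Bochner_Integration.integral_cong) (auto simp: indicator_def)
    finally show ?thesis .
  qed
  have vt: "v t = v a + (LBINT s. G s * indicator {s. s \<le> t} s)" if "t \<in> {a..b}" for t
  proof -
    note primitive_onD(2)[OF v that]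
    also have "(LBINT s:{a..t}. g s) = (LBINT s. G s * indicator {s. s \<le> t} s)"
      unfolding set_lebesgue_integral_def G_def using that
      by (intro Bochner_Integration.integral_cong) (auto simp: indicator_def)
    finally show ?thesis .
  qed
  define K where "K = (\<lambda>x y. F x * (G y * indicator {y. y \<le> x} y))"
  define L where "L = (\<lambda>x y. G x * (F y * indicator {y. y \<le> x} y))"
  define L' where "L' = (\<lambda>x y. F x * (G y * indicator {y. x \<le> y} y))"
  have Ki: "integrable (lborel \<Otimes>\<^sub>M lborel) (case_prod K)"
    unfolding K_def by (rule integrable_tensor_indicator[OF Fi Gi]) measurable
  have Li: "integrable (lborel \<Otimes>\<^sub>M lborel) (case_prod L)"
    unfolding L_def by (rule integrable_tensor_indicator[OF Gi Fi]) measurable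
  have L'i: "integrable (lborel \<Otimes>\<^sub>M lborel) (case_prod L')"
    unfolding L'_def by (rule integrable_tensor_indicator[OF Fi Gi]) measurable
  have K1: "integrable lborel (\<lambda>x. LINT y|lborel. K x y)"
    using lborel_pair.integrable_fst'[OF Ki] by simp
  have L1: "integrable lborel (\<lambda>x. LINT y|lborel. L x y)"
    using lborel_pair.integrable_fst'[OF Li] by simp
  have L'1: "integrable lborel (\<lambda>x. LINT y|lborel. L' x y)"
    using lborel_pair.integrable_fst'[OF L'i] by simp
  have swap: "(LINT x|lborel. LINT y|lborel. L x y) = (LINT x|lborel. LINT y|lborel. L' x y)"
  proof -
    have "(LINT x|lborel. LINT y|lborel. L x y) = (LINT y|lborel. LINT x|lborel. L x y)"
      by (rule lborel_pair.Fubini_integral[OF Li, symmetric])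
    also have "\<dots> = (LINT y|lborel. LINT x|lborel. L' y x)"
      by (intro Bochner_Integration.integral_cong) (auto simp: L_def L'_def indicator_def)
    finally show ?thesis .
  qed
  have diag: "(LINT y|lborel. K x y) + (LINT y|lborel. L' x y) = F x * (LINT y|lborel. G y)" for x
  proof -
    have *: "integrable lborel (\<lambda>y. G y * indicator A y)" if "A \<in> sets borel" for A
      using integrable_mult_indicator[OF _ Gi, of A] that by (simp add: mult.commute)
    have "(LINT y|lborel. G y * indicator {y. y \<le> x} y) + (LINT y|lborel. G y * indicator {y. x \<le> y} y)
        = (LINT y|lborel. G y * indicator {y. y \<le> x} y + G y * indicator {y. x \<le> y} y)"
      by (rule Bochner_Integration.integral_add[symmetric]) (rule *, measurable)+
    also have "\<dots> = (LINT y|lborel. G y)"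
    proof (rule integral_cong_AE)
      show "AE y in lborel. G y * indicator {y. y \<le> x} y + G y * indicator {y. x \<le> y} y = G y"
        using AE_lborel_singleton[of x] by eventually_elim (auto simp: indicator_def)
    qed (use Gi in measurable)
    finally show ?thesis unfolding K_def L'_def
      by (simp only: integral_mult_right_zero distrib_left[symmetric])
  qed
  have pt: "indicator {a..b} t *\<^sub>R (f t * v t + u t * g t)
      = F t * v a + u a * G t + (LINT y|lborel. K t y) + (LINT y|lborel. L t y)" for t
  proof (cases "t \<in> {a..b}")
    case True
    then show ?thesis
      by (simp add: ut[OF True] vt[OF True] K_def L_def F_def G_def algebra_simps
          flip: integral_mult_right_zero)
  qed (auto simp: K_def L_def F_def G_def)
  show "set_integrable lborel {a..b} (\<lambda>t. f t * v t + u t * g t)"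
    unfolding set_integrable_def pt using Fi Gi K1 L1 by auto
  have "(LBINT t:{a..b}. f t * v t + u t * g t)
     = (LBINT t. F t) * v a + u a * (LBINT t. G t) +
        ((LBINT t. LINT y|lborel. K t y) + (LBINT t. LINT y|lborel. L t y))"
    unfolding set_lebesgue_integral_def pt using Fi Gi K1 L1 by simp
  also have "(LBINT t. LINT y|lborel. K t y) + (LBINT t. LINT y|lborel. L t y)
     = (LBINT t. (LINT y|lborel. K t y) + (LINT y|lborel. L' t y))"
    unfolding swap using K1 L'1 by simp
  also have "\<dots> = (LBINT t. F t) * (LBINT t. G t)"
    unfolding diag by simp
  also have "(LBINT t. F t) = u b - u a"
    using u \<open>a \<le> b\<close> unfolding primitive_on_def F_def set_lebesgue_integral_def real_scaleR_def
    by (metis add_diff_cancel_left' atLeastAtMost_iff order_refl)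
  also have "(LBINT t. G t) = v b - v a"
    using v \<open>a \<le> b\<close> unfolding primitive_on_def G_def set_lebesgue_integral_def real_scaleR_def
    by (metis add_diff_cancel_left' atLeastAtMost_iff order_refl)
  finally show "(LBINT t:{a..b}. f t * v t + u t * g t) = u b * v b - u a * v a"
    by (simp add: algebra_simps)
qed

lemma primitive_on_subinterval:
  assumes "primitive_on a b u f" "a \<le> c" "c \<le> d" "d \<le> b"
  shows "primitive_on c d u f"
proof -
  have i: "set_integrable lborel {x..y} f" if "a \<le> x" "y \<le> b" for x y
    by (rule set_integrable_subset[where A = "{a..b}"]) (use assms(1) that in \<open>auto simp: primitive_on_def\<close>)
  have "u t = u c + (LBINT s:{c..t}. f s)" if t: "t \<in> {c..d}" for t
  proof -
    have 1: "u t = u a + (LBINT s:{a..t}. f s)" "u c = u a + (LBINT s:{a..c}. f s)"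
      by (rule primitive_onD(2)[OF assms(1)]; use assms t in simp)+
    have ioc: "{c<..t} \<subseteq> {c..t}" by auto
    have "(LBINT s:{a..c} \<union> {c<..t}. f s) = (LBINT s:{a..c}. f s) + (LBINT s:{c<..t}. f s)"
      by (rule set_integral_Un)
        (use i[of a t] assms t in \<open>auto intro!: set_integrable_subset[OF i[of a t]]\<close>)
    moreover have "{a..c} \<union> {c<..t} = {a..t}" using assms t by auto
    moreover have "(LBINT s:{c<..t}. f s) = (LBINT s:{c..t}. f s)"
      unfolding set_lebesgue_integral_def
    proof (rule integral_cong_AE)
      show "AE y in lborel. indicat_real {c<..t} y *\<^sub>R f y = indicat_real {c..t} y *\<^sub>R f y"
        using AE_lborel_singleton[of c] by eventually_elim (auto simp: indicator_def)
      show "(\<lambda>y. indicat_real {c..t} y *\<^sub>R f y) \<in> borel_measurable lborel"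
        using i[of c t] assms t by (auto simp: set_integrable_def)
      show "(\<lambda>y. indicat_real {c<..t} y *\<^sub>R f y) \<in> borel_measurable lborel"
        using set_integrable_subset[OF i[of c t], of "{c<..t}"] assms t ioc
        by (auto simp: set_integrable_def)
    qed
    ultimately show ?thesis using 1 by simp
  qed
  then show ?thesis using i[of c d] assms(2-4) unfolding primitive_on_def by blast
qed

lemma primitive_on_mult_primitive:
  assumes u: "primitive_on a b u f" and v: "primitive_on a b v g" and "a \<le> b"
  shows "primitive_on a b (\<lambda>t. u t * v t) (\<lambda>t. f t * v t + u t * g t)"
proof -
  have "(LBINT s:{a..t}. f s * v s + u s * g s) = u t * v t - u a * v a" if "t \<in> {a..b}" for t
    using primitive_on_mult(2)[OF primitive_on_subinterval[OF u] primitive_on_subinterval[OF v], of a t]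
      that by auto
  then show ?thesis
    using primitive_on_mult(1)[OF assms] unfolding primitive_on_def by auto
qed

lemma set_integrable_continuous:
  fixes f :: "real \<Rightarrow> real"
  assumes "continuous_on {a..b} f"
  shows "set_integrable lborel {a..b} f"
  using borel_integrable_compact[OF compact_Icc assms] by (simp add: set_integrable_def)

lemma primitive_on_C1:
  assumes "\<And>t. t \<in> {a..b} \<Longrightarrow> (u has_real_derivative f t) (at t within {a..b})"
    and c: "continuous_on {a..b} f"
  shows "primitive_on a b u f"
proof -
  have si: "set_integrable lborel {a..b} f" by (rule set_integrable_continuous[OF c])
  have "u t = u a + (LBINT s:{a..t}. f s)" if t: "t \<in> {a..b}" for t
  proof -
    have "(f has_integral (u t - u a)) {a..t}"
      by (rule fundamental_theorem_of_calculus)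
        (use t in \<open>auto intro!: has_field_derivative_subset[OF assms(1)] simp flip: has_real_derivative_iff_has_vector_derivative\<close>)
    moreover have "set_integrable lborel {a..t} f"
      by (rule set_integrable_subset[OF si]) (use t in auto)
    ultimately show ?thesis
      by (simp add: set_borel_integral_eq_integral(2) integral_unique)
  qed
  with si show ?thesis unfolding primitive_on_def by blast
qed

lemma primitive_on_has_L2_deriv: "has_L2_deriv u g \<Longrightarrow> primitive_on 0 1 u g"
  using has_L2_deriv_integrable[of u g] unfolding primitive_on_def has_L2_deriv_def by blast

lemma primitive_on_continuous:
  assumes "primitive_on a b u f"
  shows "continuous_on {a..b} u"
proof -
  have i: "set_integrable lborel {a..b} f" using assms by (simp add: primitive_on_def)
  have 1: "f integrable_on {a..b}"
    using set_borel_integral_eq_integral(1)[OF i] .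
  have 2: "u a + integral {a..t} f = u t" if "t \<in> {a..b}" for t
  proof -
    have "set_integrable lborel {a..t} f"
      by (rule set_integrable_subset[OF i]) (use that in auto)
    from set_borel_integral_eq_integral(2)[OF this] show ?thesis
      using primitive_onD(2)[OF assms that] by simp
  qed
  have "continuous_on {a..b} (\<lambda>t. u a + integral {a..t} f)"
    by (intro continuous_intros indefinite_integral_continuous_1 1)
  then show ?thesis by (rule continuous_on_eq) (rule 2)
qed

text \<open>The Cauchy--Schwarz inequality, obtained by expanding the variance of \<open>f\<close>. It gives the embedding
  of \<open>H\<^sup>1\<close> into the continuous functions, with a modulus that beats the simple pole of the
  cotangent in \<open>cot_weighted_limit\<close>.\<close>
lemma primitive_on_increment_sq:
  assumes u: "primitive_on a b u f" and i2: "set_integrable lborel {a..b} (\<lambda>t. (f t)\<^sup>2)" and "a \<le> b"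
  shows "(u b - u a)\<^sup>2 \<le> (b - a) * (LBINT t:{a..b}. (f t)\<^sup>2)"
proof (cases "a = b")
  case False
  have i: "set_integrable lborel {a..b} f" using u by (simp add: primitive_on_def)
  define m where "m = (u b - u a) / (b - a)"
  define k where "k = - 2 * m"
  have ub: "u b - u a = (LBINT t:{a..b}. f t)" using u \<open>a \<le> b\<close> unfolding primitive_on_def
    by (metis add_diff_cancel_left' atLeastAtMost_iff order_refl)
  have c: "set_integrable lborel {a..b} (\<lambda>t. c)" for c :: real
    by (intro set_integrable_continuous continuous_intros)
  have lc: "(LBINT t:{a..b}. c) = (b - a) * c" for c
    using \<open>a \<le> b\<close> by (simp add: set_lebesgue_integral_def)
  have "0 \<le> (LBINT t:{a..b}. (f t - m)\<^sup>2)"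
    unfolding set_lebesgue_integral_def by (intro Bochner_Integration.integral_nonneg) auto
  also have "(\<lambda>t. (f t - m)\<^sup>2) = (\<lambda>t. (f t)\<^sup>2 + (k * f t + m\<^sup>2))"
    by (simp add: k_def power2_diff algebra_simps)
  also have "(LBINT t:{a..b}. (f t)\<^sup>2 + (k * f t + m\<^sup>2))
     = (LBINT t:{a..b}. (f t)\<^sup>2) + (k * (LBINT t:{a..b}. f t) + (b - a) * m\<^sup>2)"
    by (subst set_integral_add(2) | intro i2 i c set_integral_add(1) set_integrable_mult_right | simp add: lc)+
  also have "\<dots> = (LBINT t:{a..b}. (f t)\<^sup>2) - (u b - u a)\<^sup>2 / (b - a)"
  proof -
    have "k * x + d * m\<^sup>2 = - (x\<^sup>2 / d)" if "m = x / d" "d > 0" for x d :: real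
      using that(2) unfolding k_def that(1) by (simp add: field_simps power2_eq_square)
    from this[OF m_def] show ?thesis using False \<open>a \<le> b\<close> unfolding ub[symmetric] by simp
  qed
  finally show ?thesis using False \<open>a \<le> b\<close> by (simp add: field_simps)
qed simp

section \<open>A global existence theorem for Lipschitz differential equations\<close>

definition clamp01 :: "real \<Rightarrow> real" where "clamp01 t = max 0 (min 1 t)"

text \<open>Picard iteration on all of \<open>[0,1]\<close> at once: the substitution \<open>x(t) = exp(k t) y(t)\<close> turns the integral
  operator into a contraction for the supremum norm of \<open>y\<close> as soon as \<open>k > K\<close>. The fixed point is
  sought among bounded continuous functions on the line, hence the clamping of \<open>t\<close>.\<close>
lemma ode_solution_exists:
  fixes f :: "real \<Rightarrow> real \<Rightarrow> real"
  assumes cont: "continuous_on ({0..1} \<times> UNIV) (\<lambda>(t, x). f t x)"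
    and lip: "\<And>t x y. t \<in> {0..1} \<Longrightarrow> \<bar>f t x - f t y\<bar> \<le> K * \<bar>x - y\<bar>" and "K > 0"
  shows "\<exists>x. x 0 = 0 \<and> (\<forall>t\<in>{0..1}. (x has_real_derivative f t (x t)) (at t within {0..1}))"
proof -
  define k where "k = 2 * K"
  have "k > 0" using \<open>K > 0\<close> by (simp add: k_def)
  \<comment> \<open>With \<open>k = 2 K\<close> the contraction constant is \<open>K / k = 1 / 2\<close>.\<close>
  define S where "S = (\<lambda>(y::real \<Rightarrow> real) t. integral {0..t} (\<lambda>s. f s (exp (k * s) * y s)))"
  have ig: "continuous_on {0..1} (\<lambda>s. f s (exp (k * s) * y s))" if "continuous_on UNIV y" for y
  proof -
    have "continuous_on {0..1} (\<lambda>s. (\<lambda>(t, x). f t x) (s, exp (k * s) * y s))"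
      by (rule continuous_on_compose2[OF cont])
        (auto intro!: continuous_intros continuous_on_subset[OF that])
    then show ?thesis by simp
  qed
  have c01: "clamp01 t \<in> {0..1}" for t by (simp add: clamp01_def)
  have S1: "continuous_on {0..1} (S y)" if "continuous_on UNIV y" for y
    unfolding S_def
    by (intro indefinite_integral_continuous_1 integrable_continuous_real ig that)
  have cc: "continuous_on UNIV (\<lambda>t. exp (- (k * clamp01 t)) * S y (clamp01 t))"
    if "continuous_on UNIV y" for y
  proof -
    have "continuous_on UNIV (\<lambda>t. S y (clamp01 t))"
      by (rule continuous_on_compose2[OF S1[OF that], of _ clamp01])
         (use c01 in \<open>auto simp: clamp01_def intro!: continuous_intros\<close>)
    moreover have "continuous_on UNIV clamp01" unfolding clamp01_def by (intro continuous_intros)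
    ultimately show ?thesis by (intro continuous_intros)
  qed
  have bc: "(\<lambda>t. exp (- (k * clamp01 t)) * S (apply_bcontfun y) (clamp01 t)) \<in> bcontfun" for y :: "real \<Rightarrow>\<^sub>C real"
  proof -
    let ?h = "\<lambda>t. exp (- (k * clamp01 t)) * S (apply_bcontfun y) (clamp01 t)"
    have c: "continuous_on UNIV ?h" by (rule cc) simp
    have "range ?h \<subseteq> ?h ` {0..1}"
    proof
      fix z assume "z \<in> range ?h"
      then obtain t where "z = ?h t" by auto
      moreover have "?h t = ?h (clamp01 t)" by (simp add: clamp01_def)
      ultimately show "z \<in> ?h ` {0..1}" using c01[of t] by (intro image_eqI[of _ ?h "clamp01 t"]) simp_all
    qed
    moreover have "compact (?h ` {0..1})"
      by (intro compact_continuous_image continuous_on_subset[OF c]) auto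
    ultimately have "bounded (range ?h)" using compact_imp_bounded bounded_subset by blast
    with c show ?thesis by (simp add: bcontfun_def)
  qed
  define T where "T = (\<lambda>y :: real \<Rightarrow>\<^sub>C real. Bcontfun (\<lambda>t. exp (- (k * clamp01 t)) * S (apply_bcontfun y) (clamp01 t)))"
  have T: "apply_bcontfun (T y) t = exp (- (k * clamp01 t)) * S (apply_bcontfun y) (clamp01 t)" for y t
    unfolding T_def by (simp add: Bcontfun_inverse[OF bc])
  have contr: "dist (T y) (T z) \<le> 1 / 2 * dist y z" for y z
  proof (rule dist_bound)
    fix t
    define c where "c = clamp01 t"
    have c: "0 \<le> c" "c \<le> 1" using c01[of t] by (auto simp: c_def)
    let ?i = "\<lambda>y s. f s (exp (k * s) * apply_bcontfun y s)"
    have ii: "?i y integrable_on {0..c}" for y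
      by (intro integrable_continuous_real continuous_on_subset[OF ig]) (use c in auto)
    have prim: "((\<lambda>s. K * exp (k * s) * dist y z) has_integral
        (K * exp (k * c) / k * dist y z - K * exp (k * 0) / k * dist y z)) {0..c}"
      by (rule fundamental_theorem_of_calculus)
        (use c \<open>k > 0\<close> in \<open>auto intro!: derivative_eq_intros simp: field_simps simp flip: has_real_derivative_iff_has_vector_derivative\<close>)
    have "\<bar>S y c - S z c\<bar> = \<bar>integral {0..c} (\<lambda>s. ?i y s - ?i z s)\<bar>"
      unfolding S_def using integral_diff[OF ii[of y] ii[of z]] by simp
    also have "\<dots> \<le> integral {0..c} (\<lambda>s. K * exp (k * s) * dist y z)"
    proof (rule integral_norm_bound_integral[where f = "\<lambda>s. ?i y s - ?i z s" and g = "\<lambda>s. K * exp (k * s) * dist y z", unfolded real_norm_def])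
      show "(\<lambda>s. ?i y s - ?i z s) integrable_on {0..c}" by (intro integrable_diff ii)
      show "(\<lambda>s. K * exp (k * s) * dist y z) integrable_on {0..c}" using prim by blast
      fix s assume s: "s \<in> {0..c}"
      then have "\<bar>?i y s - ?i z s\<bar> \<le> K * \<bar>exp (k * s) * y s - exp (k * s) * z s\<bar>"
        using lip c by auto
      also have "\<dots> = K * exp (k * s) * dist (y s) (z s)"
        by (simp add: dist_real_def abs_mult flip: right_diff_distrib)
      also have "\<dots> \<le> K * exp (k * s) * dist y z"
        using \<open>K > 0\<close> by (intro mult_left_mono dist_bounded) auto
      finally show "\<bar>?i y s - ?i z s\<bar> \<le> K * exp (k * s) * dist y z" .
    qed
    also have "\<dots> = (exp (k * c) - 1) * dist y z / 2"
      using integral_unique[OF prim] \<open>K > 0\<close> by (simp add: k_def field_simps)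
    also have "\<dots> \<le> exp (k * c) * dist y z / 2"
      by (intro divide_right_mono mult_right_mono) auto
    finally have *: "\<bar>S y c - S z c\<bar> \<le> exp (k * c) * dist y z / 2" .
    have "dist (T y t) (T z t) = exp (- (k * c)) * \<bar>S y c - S z c\<bar>"
      unfolding T c_def[symmetric] by (simp add: dist_real_def abs_mult flip: right_diff_distrib)
    also have "\<dots> \<le> exp (- (k * c)) * (exp (k * c) * dist y z / 2)"
      by (rule mult_left_mono[OF *]) simp
    also have "\<dots> = 1 / 2 * dist y z" by (simp add: exp_minus field_simps)
    finally show "dist (T y t) (T z t) \<le> 1 / 2 * dist y z" .
  qed
  obtain y where y: "T y = y"
    using banach_fix_type[of "1/2" T] contr by auto
  define x where "x = (\<lambda>t. exp (k * t) * apply_bcontfun y t)"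
  have xS: "x t = integral {0..t} (\<lambda>s. f s (x s))" if "t \<in> {0..1}" for t
  proof -
    have "apply_bcontfun y t = exp (- (k * t)) * S y t"
      using T[of y t] that by (simp add: y clamp01_def)
    then show ?thesis by (simp add: x_def S_def exp_minus field_simps)
  qed
  have cx: "continuous_on {0..1} (\<lambda>s. f s (x s))"
    unfolding x_def by (rule ig) simp
  have "(x has_real_derivative f t (x t)) (at t within {0..1})" if t: "t \<in> {0..1}" for t
  proof -
    have "((\<lambda>t. integral {0..t} (\<lambda>s. f s (x s))) has_real_derivative f t (x t)) (at t within {0..1})"
      by (rule integral_has_real_derivative[OF cx t])
    then show ?thesis
      by (rule has_field_derivative_transform_within[OF _ zero_less_one t]) (use xS in auto)
  qed
  moreover have "x 0 = 0" using xS[of 0] by simp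
  ultimately show ?thesis by blast
qed

section \<open>The Pruefer angle\<close>

text \<open>A solution of \<open>y'' = - c y\<close> with \<open>y(0) = 0\<close> has the polar form \<open>y = \<rho> sin \<theta>\<close>, \<open>y' = \<rho> cos \<theta>\<close>, and the
  angle satisfies an equation of its own, in which \<open>\<rho>\<close> does not occur. Zeros of \<open>y\<close> are the points
  where \<open>\<theta>\<close> is a multiple of \<open>\<pi>\<close>.\<close>
definition prufer_angle :: "(real \<Rightarrow> real) \<Rightarrow> (real \<Rightarrow> real) \<Rightarrow> bool"
  where "prufer_angle c \<theta> \<longleftrightarrow> \<theta> 0 = 0 \<and>
    (\<forall>t\<in>{0..1}. (\<theta> has_real_derivative (cos (\<theta> t))\<^sup>2 + c t * (sin (\<theta> t))\<^sup>2) (at t within {0..1}))"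

lemma sin_sq_lipschitz: "\<bar>(sin x)\<^sup>2 - (sin y)\<^sup>2\<bar> \<le> \<bar>x - y :: real\<bar>"
proof -
  have "(sin x)\<^sup>2 - (sin y)\<^sup>2 = sin (x + y) * sin (x - y)"
    unfolding sin_add sin_diff cos_squared_eq[of x, unfolded power2_eq_square]
    using sin_cos_squared_add[of x] sin_cos_squared_add[of y] by algebra
  then have "\<bar>(sin x)\<^sup>2 - (sin y)\<^sup>2\<bar> = \<bar>sin (x + y)\<bar> * \<bar>sin (x - y)\<bar>" by (simp add: abs_mult)
  also have "\<dots> \<le> 1 * \<bar>x - y\<bar>"
    by (intro mult_mono abs_sin_le_one abs_sin_x_le_abs_x) auto
  finally show ?thesis by simp
qed

lemma prufer_rhs: "(cos x)\<^sup>2 + c * (sin x)\<^sup>2 = 1 + (c - 1) * (sin x)\<^sup>2" for x c :: real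
  by (simp add: cos_squared_eq algebra_simps)

lemma prufer_angle_exists:
  assumes c: "continuous_on {0..1} c"
  shows "\<exists>\<theta>. prufer_angle c \<theta>"
proof -
  have "compact ((\<lambda>t. c t - 1) ` {0..1})"
    by (intro compact_continuous_image continuous_intros c) auto
  then obtain K where K: "K > 0" "\<And>t. t \<in> {0..1} \<Longrightarrow> \<bar>c t - 1\<bar> \<le> K"
    using compact_imp_bounded bounded_pos by (metis (no_types, lifting) image_eqI real_norm_def)
  have "\<exists>x. x 0 = 0 \<and> (\<forall>t\<in>{0..1}. (x has_real_derivative 1 + (c t - 1) * (sin (x t))\<^sup>2) (at t within {0..1}))"
  proof (rule ode_solution_exists)
    have "continuous_on ({0..1} \<times> UNIV) (\<lambda>p. c (fst p))"
      by (rule continuous_on_compose2[OF c]) (auto intro!: continuous_intros)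
    then show "continuous_on ({0..1} \<times> UNIV) (\<lambda>(t, x). 1 + (c t - 1) * (sin x)\<^sup>2)"
      unfolding case_prod_beta by (intro continuous_intros)
    show "\<bar>1 + (c t - 1) * (sin x)\<^sup>2 - (1 + (c t - 1) * (sin y)\<^sup>2)\<bar> \<le> K * \<bar>x - y\<bar>" if "t \<in> {0..1}" for t x y
    proof -
      have "\<bar>1 + (c t - 1) * (sin x)\<^sup>2 - (1 + (c t - 1) * (sin y)\<^sup>2)\<bar> = \<bar>c t - 1\<bar> * \<bar>(sin x)\<^sup>2 - (sin y)\<^sup>2\<bar>"
        by (simp flip: right_diff_distrib abs_mult)
      also have "\<dots> \<le> K * \<bar>x - y\<bar>"
        by (intro mult_mono K that sin_sq_lipschitz) (use K in auto)
      finally show ?thesis .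
    qed
  qed (rule K)
  then show ?thesis unfolding prufer_angle_def prufer_rhs .
qed

lemma prufer_angle_continuous: "prufer_angle c \<theta> \<Longrightarrow> continuous_on {0..1} \<theta>"
  unfolding prufer_angle_def by (rule DERIV_continuous_on) blast

lemma prufer_angle_deriv_at:
  assumes "prufer_angle c \<theta>" "0 < t" "t < 1"
  shows "(\<theta> has_real_derivative (cos (\<theta> t))\<^sup>2 + c t * (sin (\<theta> t))\<^sup>2) (at t)"
  using assms at_within_Icc_at[of 0 t 1] unfolding prufer_angle_def
  by (metis atLeastAtMost_iff less_eq_real_def)

text \<open>With \<open>e = \<theta> - \<psi>\<close>, the derivative of \<open>e\<^sup>2\<close> is at most \<open>2 K e\<^sup>2 + 2 |e| D \<le> (2 K + 1) e\<^sup>2 + D\<^sup>2\<close>; the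
  exponential weight absorbs the first term. Taken with \<open>D = 0\<close> this is uniqueness of the final angle.\<close>
lemma prufer_angle_dependence:
  assumes 1: "prufer_angle c \<theta>" and 2: "prufer_angle d \<psi>"
    and K: "\<And>t. t \<in> {0..1} \<Longrightarrow> \<bar>c t - 1\<bar> \<le> K" and D: "\<And>t. t \<in> {0..1} \<Longrightarrow> \<bar>c t - d t\<bar> \<le> D"
  shows "(\<theta> 1 - \<psi> 1)\<^sup>2 \<le> D\<^sup>2 * exp (2 * K + 1)"
proof -
  define e where "e = (\<lambda>t. \<theta> t - \<psi> t)"
  define g where "g = (\<lambda>t. (e t)\<^sup>2 * exp (- (2 * K + 1) * t) - D\<^sup>2 * t)"
  have "g 1 \<le> g 0"
  proof (rule DERIV_nonpos_imp_decreasing_open[where f = g and a = 0 and b = 1])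
    show "continuous_on {0..1} g" unfolding g_def e_def
      by (intro continuous_intros prufer_angle_continuous[OF 1] prufer_angle_continuous[OF 2])
    fix t :: real assume t: "0 < t" "t < 1"
    let ?p = "1 + (c t - 1) * (sin (\<theta> t))\<^sup>2" and ?q = "1 + (d t - 1) * (sin (\<psi> t))\<^sup>2"
    let ?E = "exp (- (2 * K + 1) * t)"
    note d1 = prufer_angle_deriv_at[OF 1 t, unfolded prufer_rhs]
      and d2 = prufer_angle_deriv_at[OF 2 t, unfolded prufer_rhs]
    have "(e has_real_derivative ?p - ?q) (at t)"
      unfolding e_def by (intro derivative_intros d1 d2)
    then have dg: "(g has_real_derivative
        (2 * e t * (?p - ?q)) * ?E + (e t)\<^sup>2 * (?E * (- (2 * K + 1))) - D\<^sup>2) (at t)"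
      unfolding g_def by (auto intro!: derivative_eq_intros)
    have t01: "t \<in> {0..1}" using t by auto
    have "\<bar>?p - ?q\<bar> = \<bar>(c t - 1) * ((sin (\<theta> t))\<^sup>2 - (sin (\<psi> t))\<^sup>2) + (c t - d t) * (sin (\<psi> t))\<^sup>2\<bar>"
      by (simp add: algebra_simps)
    also have "\<dots> \<le> \<bar>c t - 1\<bar> * \<bar>(sin (\<theta> t))\<^sup>2 - (sin (\<psi> t))\<^sup>2\<bar> + \<bar>c t - d t\<bar> * \<bar>(sin (\<psi> t))\<^sup>2\<bar>"
      by (metis abs_mult abs_triangle_ineq)
    also have "\<dots> \<le> K * \<bar>e t\<bar> + D * 1"
    proof (intro add_mono mult_mono K D t01)
      show "\<bar>(sin (\<theta> t))\<^sup>2 - (sin (\<psi> t))\<^sup>2\<bar> \<le> \<bar>e t\<bar>" unfolding e_def by (rule sin_sq_lipschitz)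
      show "\<bar>(sin (\<psi> t))\<^sup>2\<bar> \<le> 1" by (simp add: abs_square_le_1)
    qed (use K[OF t01] D[OF t01] in linarith)+
    finally have pq: "\<bar>?p - ?q\<bar> \<le> K * \<bar>e t\<bar> + D" by simp
    have "2 * e t * (?p - ?q) \<le> 2 * \<bar>e t\<bar> * \<bar>?p - ?q\<bar>"
      by (metis abs_ge_self abs_mult abs_numeral)
    also have "\<dots> \<le> 2 * \<bar>e t\<bar> * (K * \<bar>e t\<bar> + D)" by (intro mult_left_mono pq) auto
    also have "\<dots> = 2 * K * (e t)\<^sup>2 + 2 * \<bar>e t\<bar> * D"
      by (simp add: algebra_simps power2_eq_square flip: abs_mult)
    also have "\<dots> \<le> (2 * K + 1) * (e t)\<^sup>2 + D\<^sup>2"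
      using zero_le_power2[of "\<bar>e t\<bar> - D"] by (simp add: power2_diff algebra_simps)
    finally have "2 * e t * (?p - ?q) - (2 * K + 1) * (e t)\<^sup>2 \<le> D\<^sup>2" by simp
    then have "(2 * e t * (?p - ?q) - (2 * K + 1) * (e t)\<^sup>2) * ?E \<le> D\<^sup>2 * ?E"
      by (rule mult_right_mono) simp
    also have "\<dots> \<le> D\<^sup>2 * 1"
    proof (rule mult_left_mono)
      have "K \<ge> 0" using K[OF t01] by linarith
      then have "0 \<le> (2 * K + 1) * t" using t by (intro mult_nonneg_nonneg) auto
      then show "?E \<le> 1" by (simp add: algebra_simps)
    qed simp
    finally have "(2 * e t * (?p - ?q)) * ?E + (e t)\<^sup>2 * (?E * (- (2 * K + 1))) - D\<^sup>2 \<le> 0"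
      by (simp add: algebra_simps)
    with dg show "\<exists>y. (g has_real_derivative y) (at t) \<and> y \<le> 0" by blast
  qed simp
  then have "(e 1)\<^sup>2 * exp (- (2 * K + 1)) \<le> D\<^sup>2"
    using 1 2 by (simp add: g_def e_def prufer_angle_def)
  then have "(e 1)\<^sup>2 * exp (- (2 * K + 1)) * exp (2 * K + 1) \<le> D\<^sup>2 * exp (2 * K + 1)"
    by (rule mult_right_mono) simp
  then show ?thesis by (simp add: e_def mult.assoc flip: exp_add)
qed



lemma first_hit:
  fixes f :: "real \<Rightarrow> real"
  assumes f: "continuous_on {a..b} f" and "a \<le> b" and c: "f a < c" "c \<le> f b"
  shows "\<exists>z. a < z \<and> z \<le> b \<and> f z = c \<and> (\<forall>x. a \<le> x \<and> x < z \<longrightarrow> f x < c)"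
proof -
  define Z where "Z = {x \<in> {a..b}. f x = c}"
  have "\<exists>x\<ge>a. x \<le> b \<and> f x = c" by (rule IVT') (use assms in auto)
  then have "Z \<noteq> {}" by (auto simp: Z_def)
  have "closed Z" unfolding Z_def
    by (intro continuous_closed_preimage_constant f) auto
  moreover have "Z = {a..b} \<inter> Z" by (auto simp: Z_def)
  ultimately have "compact Z" using compact_Int_closed[of "{a..b}" Z] by simp
  then obtain z where z: "z \<in> Z" "\<And>x. x \<in> Z \<Longrightarrow> z \<le> x"
    using compact_attains_inf[OF _ \<open>Z \<noteq> {}\<close>] by blast
  have zab: "a \<le> z" "z \<le> b" "f z = c" using z(1) by (simp_all add: Z_def)
  have "f x < c" if "a \<le> x" "x < z" for x
  proof (rule ccontr)
    assume "\<not> f x < c"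
    then have "\<exists>y\<ge>a. y \<le> x \<and> f y = c"
      by (intro IVT') (use c that zab in \<open>auto intro: continuous_on_subset[OF f]\<close>)
    then obtain y where y: "a \<le> y" "y \<le> x" "f y = c" by blast
    have "y \<in> Z" unfolding Z_def using y that zab(2) by simp
    from z(2)[OF this] y that show False by simp
  qed
  moreover have "a < z" using zab c by (cases "a = z") auto
  ultimately show ?thesis using zab by blast
qed

text \<open>Where \<open>\<theta>\<close> is a multiple of \<open>\<pi>\<close> its derivative is \<open>1\<close>, whatever \<open>c\<close> is, so such a level can only be
  crossed upwards.\<close>
lemma prufer_angle_crosses_once:
  assumes \<theta>: "prufer_angle c \<theta>" and s: "0 \<le> s" "s < t" "t \<le> 1" and n: "\<theta> s = of_int n * pi"
  shows "of_int n * pi < \<theta> t"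
proof (rule ccontr)
  assume neg: "\<not> ?thesis"
  have D: "(\<theta> has_real_derivative 1) (at x within {0..1})" if "x \<in> {0..1}" "\<theta> x = of_int n * pi" for x
  proof -
    have "(\<theta> has_real_derivative (cos (\<theta> x))\<^sup>2 + c x * (sin (\<theta> x))\<^sup>2) (at x within {0..1})"
      using \<theta> that(1) by (simp add: prufer_angle_def)
    moreover have "sin (\<theta> x) = 0" using that(2) by (simp add: sin_zero_iff_int2)
    ultimately show ?thesis by (simp add: cos_squared_eq)
  qed
  have cont: "continuous_on {s..t} \<theta>"
    by (rule continuous_on_subset[OF prufer_angle_continuous[OF \<theta>]]) (use s in auto)
  obtain d where d: "d > 0" "\<And>h. 0 < h \<Longrightarrow> s + h \<in> {0..1} \<Longrightarrow> h < d \<Longrightarrow> \<theta> s < \<theta> (s + h)"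
    using has_real_derivative_pos_inc_right[OF D[of s]] n s by auto
  define s' where "s' = s + min d (t - s) / 2"
  have s': "s < s'" "s' \<le> t" "s' < s + d" using d s by (auto simp: s'_def min_def field_simps)
  have "\<theta> s < \<theta> (s + (s' - s))" by (rule d(2)) (use s' s in auto)
  then have s'2: "of_int n * pi < \<theta> s'" using n by simp
  have "continuous_on {s'..t} (\<lambda>x. - \<theta> x)"
    by (intro continuous_intros continuous_on_subset[OF cont]) (use s' in auto)
  then have "\<exists>z. s' < z \<and> z \<le> t \<and> - \<theta> z = - (of_int n * pi) \<and>
      (\<forall>x. s' \<le> x \<and> x < z \<longrightarrow> - \<theta> x < - (of_int n * pi))"
    by (rule first_hit) (use s' s'2 neg in simp_all)
  then obtain z where z: "s' < z" "z \<le> t" "\<theta> z = of_int n * pi"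
    and above: "\<And>x. s' \<le> x \<Longrightarrow> x < z \<Longrightarrow> of_int n * pi < \<theta> x" by force
  have "\<exists>e>0. \<forall>h>0. z - h \<in> {0..1} \<longrightarrow> h < e \<longrightarrow> \<theta> (z - h) < \<theta> z"
    by (rule has_real_derivative_pos_inc_left[OF D[of z] zero_less_one]) (use z s s' in simp_all)
  then obtain e where e: "e > 0" "\<And>h. 0 < h \<Longrightarrow> z - h \<in> {0..1} \<Longrightarrow> h < e \<Longrightarrow> \<theta> (z - h) < \<theta> z"
    by blast
  define y where "y = z - min e (z - s') / 2"
  have y: "s' < y" "y < z" "z - y < e" using e z by (auto simp: y_def min_def field_simps)
  have "\<theta> (z - (z - y)) < \<theta> z" by (rule e(2)) (use y s s' z in auto)
  then show False using above[of y] y z by simp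
qed

text \<open>By upward crossing, different zeros belong to different positive multiples of \<open>\<pi>\<close>, all of them
  below \<open>\<theta> 1\<close>.\<close>
lemma prufer_zeros:
  assumes \<theta>: "prufer_angle c \<theta>"
  defines "Z \<equiv> {t. 0 < t \<and> t < 1 \<and> sin (\<theta> t) = 0}"
  shows "finite Z \<and> real (card Z) * pi < \<theta> 1"
proof -
  have pos: "0 < \<theta> t" if "0 < t" "t \<le> 1" for t
    using prufer_angle_crosses_once[OF \<theta>, of 0 t 0] that \<theta> by (simp add: prufer_angle_def)
  \<comment> \<open>The largest integer \<open>m\<close> with \<open>m \<pi>\<close> strictly below \<open>\<theta> 1\<close>; a zero at the end point is not counted.\<close>
  define m where "m = \<lceil>\<theta> 1 / pi\<rceil> - 1"
  have "0 < \<theta> 1 / pi" using pos[of 1] by simp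
  then have m: "0 \<le> m" "of_int m * pi < \<theta> 1"
    unfolding m_def by (auto simp: less_ceiling_iff pos_less_divide_eq[symmetric]) linarith
  define N where "N = (\<lambda>t. \<lfloor>\<theta> t / pi\<rfloor>)"
  have N: "\<theta> t = of_int (N t) * pi" "N t \<in> {1..m}" if t: "t \<in> Z" for t
  proof -
    obtain i :: int where i: "\<theta> t = of_int i * pi" using t by (auto simp: Z_def sin_zero_iff_int2)
    then have Ni: "N t = i" by (simp add: N_def)
    with i show "\<theta> t = of_int (N t) * pi" by simp
    have t01: "0 < t" "t < 1" using t by (auto simp: Z_def)
    have "of_int i * pi < \<theta> 1"
      using prufer_angle_crosses_once[OF \<theta>, of t 1 i] t01 i by simp
    then have "of_int i < \<theta> 1 / pi" by (simp add: pos_less_divide_eq)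
    then have "i < \<lceil>\<theta> 1 / pi\<rceil>" by (simp add: less_ceiling_iff)
    moreover have "0 < i" using pos[of t] t01 i by (simp add: zero_less_mult_iff)
    ultimately show "N t \<in> {1..m}" by (simp add: Ni m_def)
  qed
  have inj: "inj_on N Z"
  proof (rule linorder_inj_onI)
    fix s t assume "s < t" "s \<in> Z" "t \<in> Z"
    then have "of_int (N s) * pi < \<theta> t"
      by (intro prufer_angle_crosses_once[OF \<theta>, of s t] N) (auto simp: Z_def)
    then show "N s \<noteq> N t" using N(1)[OF \<open>t \<in> Z\<close>] by auto
  qed auto
  have sub: "N ` Z \<subseteq> {1..m}" using N by auto
  have fin: "finite Z" using inj sub finite_imageD finite_subset by blast
  have "card Z \<le> card {1..m}" by (rule card_inj_on_le[OF inj sub]) simp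
  then have "real (card Z) \<le> of_int m" using m(1) by simp
  then have "real (card Z) * pi \<le> of_int m * pi" by (rule mult_right_mono) simp
  then have "real (card Z) * pi < \<theta> 1" using m(2) by (rule order_le_less_trans)
  with fin show ?thesis ..
qed

text \<open>The amplitude is recovered from the angle by one integration,
  \<open>\<rho>' = (1 - c) sin \<theta> cos \<theta> \<rho>\<close> with \<open>\<rho>(0) = 1\<close>.\<close>
lemma prufer_eigenfunction:
  assumes \<theta>: "prufer_angle c \<theta>" and c: "continuous_on {0..1} c" and n: "\<theta> 1 = of_int n * pi"
  shows "\<exists>y y'. (\<forall>t\<in>{0..1}. (y has_real_derivative y' t) (at t within {0..1}) \<and>
      (y' has_real_derivative - (c t * y t)) (at t within {0..1})) \<and> y 0 = 0 \<and> y 1 = 0 \<and> (\<exists>t\<in>{0..1}. y t \<noteq> 0)"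
proof -
  define k where "k = (\<lambda>t. (1 - c t) * (sin (\<theta> t) * cos (\<theta> t)))"
  have ck: "continuous_on {0..1} k"
    unfolding k_def by (intro continuous_intros c prufer_angle_continuous[OF \<theta>])
  define \<rho> where "\<rho> = (\<lambda>t. exp (integral {0..t} k))"
  have d\<rho>: "(\<rho> has_real_derivative \<rho> t * k t) (at t within {0..1})" if "t \<in> {0..1}" for t
    unfolding \<rho>_def using DERIV_chain2[OF DERIV_exp integral_has_real_derivative[OF ck that]] by simp
  have d\<theta>: "(\<theta> has_real_derivative (cos (\<theta> t))\<^sup>2 + c t * (sin (\<theta> t))\<^sup>2) (at t within {0..1})"
    if "t \<in> {0..1}" for t using \<theta> that by (simp add: prufer_angle_def)
  define y where "y = (\<lambda>t. \<rho> t * sin (\<theta> t))"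
  define y' where "y' = (\<lambda>t. \<rho> t * cos (\<theta> t))"
  have 1: "(y has_real_derivative y' t) (at t within {0..1})" if "t \<in> {0..1}" for t
  proof -
    have "(y has_real_derivative \<rho> t * k t * sin (\<theta> t)
        + cos (\<theta> t) * ((cos (\<theta> t))\<^sup>2 + c t * (sin (\<theta> t))\<^sup>2) * \<rho> t) (at t within {0..1})"
      unfolding y_def by (rule DERIV_mult[OF d\<rho>[OF that] DERIV_chain2[OF DERIV_sin d\<theta>[OF that]]])
    also have "\<rho> t * k t * sin (\<theta> t) + cos (\<theta> t) * ((cos (\<theta> t))\<^sup>2 + c t * (sin (\<theta> t))\<^sup>2) * \<rho> t = y' t"
      unfolding k_def y'_def cos_squared_eq by (simp add: power2_eq_square algebra_simps)
    finally show ?thesis .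
  qed
  have 2: "(y' has_real_derivative - (c t * y t)) (at t within {0..1})" if "t \<in> {0..1}" for t
  proof -
    have "(y' has_real_derivative \<rho> t * k t * cos (\<theta> t)
        + - sin (\<theta> t) * ((cos (\<theta> t))\<^sup>2 + c t * (sin (\<theta> t))\<^sup>2) * \<rho> t) (at t within {0..1})"
      unfolding y'_def by (rule DERIV_mult[OF d\<rho>[OF that] DERIV_chain2[OF DERIV_cos d\<theta>[OF that]]])
    also have "\<rho> t * k t * cos (\<theta> t) + - sin (\<theta> t) * ((cos (\<theta> t))\<^sup>2 + c t * (sin (\<theta> t))\<^sup>2) * \<rho> t
        = \<rho> t * sin (\<theta> t) * (- c t * ((sin (\<theta> t))\<^sup>2 + (cos (\<theta> t))\<^sup>2))"
      unfolding k_def by algebra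
    also have "\<dots> = - (c t * y t)" by (simp add: y_def)
    finally show ?thesis .
  qed
  have "\<exists>t\<in>{0..1}. y t \<noteq> 0"
  proof (rule ccontr)
    assume "\<not> ?thesis"
    then have z: "y t = 0" if "t \<in> {0..1}" for t using that by blast
    have "((\<lambda>_. 0) has_real_derivative y' 0) (at 0 within {0..1})"
      by (rule has_field_derivative_transform_within[OF 1[of 0] zero_less_one]) (use z in auto)
    then have "y' 0 = 0"
      using DERIV_const has_field_derivative_unique[of "\<lambda>_. 0" "y' 0" "0::real" "{0..1}" 0]
      by (simp add: trivial_limit_within islimpt_Icc)
    then show False using \<theta> by (simp add: y'_def \<rho>_def prufer_angle_def)
  qed
  moreover have "y 0 = 0" using \<theta> by (simp add: y_def prufer_angle_def)
  moreover have "y 1 = 0" by (simp add: y_def n sin_zero_iff_int2)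
  ultimately show ?thesis using 1 2 by blast
qed

text \<open>A barrier: at the level \<open>\<pi> / 2\<close> the derivative of \<open>\<theta>\<close> is \<open>c < 0\<close>, so the level is never reached.\<close>
lemma prufer_angle_below:
  assumes \<theta>: "prufer_angle c \<theta>" and neg: "\<And>t. t \<in> {0..1} \<Longrightarrow> c t < 0"
  shows "\<theta> 1 < pi / 2"
proof (rule ccontr)
  assume "\<not> ?thesis"
  then have "\<exists>z. 0 < z \<and> z \<le> 1 \<and> \<theta> z = pi / 2 \<and> (\<forall>x. 0 \<le> x \<and> x < z \<longrightarrow> \<theta> x < pi / 2)"
    by (intro first_hit prufer_angle_continuous[OF \<theta>] zero_le_one)
      (use \<theta> in \<open>simp_all add: prufer_angle_def\<close>)
  then obtain z where z: "0 < z" "z \<le> 1" "\<theta> z = pi / 2"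
    and low: "\<And>x. 0 \<le> x \<Longrightarrow> x < z \<Longrightarrow> \<theta> x < pi / 2" by blast
  have z01: "z \<in> {0..1}" using z by simp
  have "(\<theta> has_real_derivative (cos (\<theta> z))\<^sup>2 + c z * (sin (\<theta> z))\<^sup>2) (at z within {0..1})"
    using \<theta> z01 unfolding prufer_angle_def by blast
  then have D: "(\<theta> has_real_derivative c z) (at z within {0..1})" by (simp add: z(3))
  obtain e where e: "e > 0" "\<And>h. 0 < h \<Longrightarrow> z - h \<in> {0..1} \<Longrightarrow> h < e \<Longrightarrow> \<theta> z < \<theta> (z - h)"
    using has_real_derivative_neg_dec_left[OF D neg[OF z01]] by blast
  define y where "y = z - min e z / 2"
  have y: "0 < y" "y < z" "z - y < e" using e z by (auto simp: y_def min_def field_simps)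
  have "\<theta> z < \<theta> (z - (z - y))" by (rule e(2)) (use y z in auto)
  then show False using low[of y] y z by simp
qed

section \<open>Negative Dirichlet eigenvalues from the Pruefer angle\<close>

definition dirichlet_solution :: "(real \<Rightarrow> real) \<Rightarrow> (real \<Rightarrow> real) \<Rightarrow> real \<Rightarrow> (real \<Rightarrow> real) \<Rightarrow> (real \<Rightarrow> real) \<Rightarrow> bool"
  where "dirichlet_solution q w \<mu> y y' \<longleftrightarrow>
     (\<forall>t\<in>{0..1}. (y has_real_derivative y' t) (at t within {0..1}) \<and>
      (y' has_real_derivative (q t - \<mu> * w t) * y t) (at t within {0..1})) \<and>
     y 0 = 0 \<and> y 1 = 0 \<and> (\<exists>t\<in>{0..1}. y t \<noteq> 0)"

lemma dirichlet_solutionD: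
  assumes "dirichlet_solution q w \<mu> y y'"
  shows "t \<in> {0..1} \<Longrightarrow> (y has_real_derivative y' t) (at t within {0..1})"
    and "t \<in> {0..1} \<Longrightarrow> (y' has_real_derivative (q t - \<mu> * w t) * y t) (at t within {0..1})"
    and "continuous_on {0..1} y" and "continuous_on {0..1} y'"
proof -
  show d: "t \<in> {0..1} \<Longrightarrow> (y has_real_derivative y' t) (at t within {0..1})"
    and d': "t \<in> {0..1} \<Longrightarrow> (y' has_real_derivative (q t - \<mu> * w t) * y t) (at t within {0..1})" for t
    using assms unfolding dirichlet_solution_def by blast+
  show "continuous_on {0..1} y" "continuous_on {0..1} y'"
    by (rule DERIV_continuous_on[OF d] DERIV_continuous_on[OF d']; assumption)+
qed

text \<open>Oscillation count, by continuity in \<open>\<mu>\<close> of the final Pruefer angle of \<open>y'' = (q - \<mu> w) y\<close>: the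
  intermediate value theorem provides, for \<open>n = 1, \<dots>, k\<close>, a negative \<open>\<mu>\<close> with final angle \<open>n \<pi>\<close>. These
  \<open>\<mu>\<close> are distinct because their final angles are.\<close>
lemma dirichlet_eigenvalues_exist:
  assumes q: "continuous_on {0..1} q" and w: "continuous_on {0..1} w" and wpos: "\<And>t. t \<in> {0..1} \<Longrightarrow> w t > 0"
    and \<theta>: "prufer_angle (\<lambda>t. - q t) \<theta>" and k: "real k * pi < \<theta> 1"
  shows "\<exists>M. M \<subseteq> {\<mu>. \<mu> < 0 \<and> (\<exists>y y'. dirichlet_solution q w \<mu> y y')} \<and> finite M \<and> card M = k"
proof -
  define c where "c = (\<lambda>\<mu> t. \<mu> * w t - q t)"
  have cc: "continuous_on {0..1} (c \<mu>)" for \<mu> unfolding c_def by (intro continuous_intros q w)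
  have "\<exists>\<Theta>. \<forall>\<mu>. prufer_angle (c \<mu>) (\<Theta> \<mu>)"
    using prufer_angle_exists[OF cc] by (intro choice) blast
  then obtain \<Theta> where \<Theta>: "\<And>\<mu>. prufer_angle (c \<mu>) (\<Theta> \<mu>)" by blast
  obtain w0 where w0: "w0 > 0" "\<And>t. t \<in> {0..1} \<Longrightarrow> w0 \<le> w t"
  proof -
    have "\<exists>x\<in>{0..1}. \<forall>y\<in>{0..1}. w x \<le> w y"
      by (rule continuous_attains_inf[OF compact_Icc _ w]) auto
    then show ?thesis using that wpos by blast
  qed
  obtain W where W: "W > 0" "\<And>t. t \<in> {0..1} \<Longrightarrow> \<bar>w t\<bar> \<le> W"
    using compact_imp_bounded[OF compact_continuous_image[OF w compact_Icc]] unfolding bounded_pos by auto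
  obtain Q where Q: "Q > 0" "\<And>t. t \<in> {0..1} \<Longrightarrow> \<bar>q t\<bar> \<le> Q"
    using compact_imp_bounded[OF compact_continuous_image[OF q compact_Icc]] unfolding bounded_pos by auto
  \<comment> \<open>For \<open>\<mu> = - m\<close> the coefficient \<open>\<mu> w - q\<close> is at most \<open>- (Q + 1) + Q < 0\<close>, so the barrier applies.\<close>
  define m where "m = (Q + 1) / w0"
  have "m > 0" using Q w0 by (simp add: m_def)
  have low: "\<Theta> (- m) 1 < pi / 2"
  proof (rule prufer_angle_below[OF \<Theta>])
    fix t :: real assume t: "t \<in> {0..1}"
    have "Q + 1 = m * w0" using w0 by (simp add: m_def)
    also have "\<dots> \<le> m * w t" using w0(2)[OF t] \<open>m > 0\<close> by simp
    finally show "c (- m) t < 0" using Q(2)[OF t] by (simp add: c_def)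
  qed
  have "\<Theta> 0 1 = \<theta> 1"
  proof -
    have "(\<Theta> 0 1 - \<theta> 1)\<^sup>2 \<le> 0\<^sup>2 * exp (2 * (Q + 1) + 1)"
      by (rule prufer_angle_dependence[OF \<Theta> \<theta>]) (use Q in \<open>force simp: c_def abs_le_iff\<close>)+
    then show ?thesis by simp
  qed
  have cont: "continuous_on {-m..0} (\<lambda>\<mu>. \<Theta> \<mu> 1)"
  proof -
    define L where "L = W * sqrt (exp (2 * (m * W + Q + 1) + 1))"
    have "L \<ge> 0" using W by (simp add: L_def)
    have "dist (\<Theta> \<mu> 1) (\<Theta> \<nu> 1) \<le> L * dist \<mu> \<nu>" if "\<mu> \<in> {-m..0}" for \<mu> \<nu>
    proof -
      have "(\<Theta> \<mu> 1 - \<Theta> \<nu> 1)\<^sup>2 \<le> (\<bar>\<mu> - \<nu>\<bar> * W)\<^sup>2 * exp (2 * (m * W + Q + 1) + 1)"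
      proof (rule prufer_angle_dependence[OF \<Theta> \<Theta>])
        fix t :: real assume t: "t \<in> {0..1}"
        have "\<bar>\<mu> * w t\<bar> \<le> m * W" unfolding abs_mult using that W(2)[OF t] by (intro mult_mono) auto
        then show "\<bar>c \<mu> t - 1\<bar> \<le> m * W + Q + 1" unfolding c_def using Q(2)[OF t] by linarith
        have "\<bar>c \<mu> t - c \<nu> t\<bar> = \<bar>\<mu> - \<nu>\<bar> * \<bar>w t\<bar>" by (simp add: c_def flip: left_diff_distrib abs_mult)
        also have "\<dots> \<le> \<bar>\<mu> - \<nu>\<bar> * W" by (intro mult_left_mono W(2)[OF t]) auto
        finally show "\<bar>c \<mu> t - c \<nu> t\<bar> \<le> \<bar>\<mu> - \<nu>\<bar> * W" .
      qed
      then have "sqrt ((\<Theta> \<mu> 1 - \<Theta> \<nu> 1)\<^sup>2) \<le> sqrt ((\<bar>\<mu> - \<nu>\<bar> * W)\<^sup>2 * exp (2 * (m * W + Q + 1) + 1))"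
        by (rule real_sqrt_le_mono)
      then show ?thesis using W by (simp add: real_sqrt_mult dist_real_def L_def ac_simps)
    qed
    then have "L-lipschitz_on {-m..0} (\<lambda>\<mu>. \<Theta> \<mu> 1)"
      using \<open>L \<ge> 0\<close> by (intro lipschitz_onI) auto
    then show ?thesis by (rule lipschitz_on_continuous_on)
  qed
  have ex: "\<exists>\<mu>. -m \<le> \<mu> \<and> \<mu> < 0 \<and> \<Theta> \<mu> 1 = real n * pi" if n: "n \<in> {1..k}" for n
  proof -
    have n1: "real n * pi < \<Theta> 0 1"
    proof -
      have "real n * pi \<le> real k * pi" using n by simp
      then show ?thesis using k \<open>\<Theta> 0 1 = \<theta> 1\<close> by linarith
    qed
    have "1 * pi \<le> real n * pi" by (rule mult_right_mono) (use n in auto)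
    then have "pi / 2 \<le> real n * pi" using pi_gt_zero by linarith
    then have "\<Theta> (-m) 1 \<le> real n * pi" using low by linarith
    then have "\<exists>\<mu>\<ge>-m. \<mu> \<le> 0 \<and> \<Theta> \<mu> 1 = real n * pi"
      by (intro IVT' cont) (use n1 \<open>m > 0\<close> in auto)
    then obtain \<mu> where "-m \<le> \<mu>" "\<mu> \<le> 0" "\<Theta> \<mu> 1 = real n * pi" by blast
    moreover from this n1 have "\<mu> \<noteq> 0" by auto
    ultimately show ?thesis by force
  qed
  then have "\<exists>f. \<forall>n\<in>{1..k}. -m \<le> f n \<and> f n < 0 \<and> \<Theta> (f n) 1 = real n * pi" by (intro bchoice) blast
  then obtain f where f: "\<And>n. n \<in> {1..k} \<Longrightarrow> -m \<le> f n \<and> f n < 0 \<and> \<Theta> (f n) 1 = real n * pi" by blast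
  have "inj_on f {1..k}"
    by (rule inj_on_inverseI[of _ "\<lambda>\<mu>. nat \<lfloor>\<Theta> \<mu> 1 / pi\<rfloor>"]) (use f in auto)
  moreover have "f n \<in> {\<mu>. \<mu> < 0 \<and> (\<exists>y y'. dirichlet_solution q w \<mu> y y')}" if "n \<in> {1..k}" for n
  proof -
    have "\<Theta> (f n) 1 = of_int (int n) * pi" using f[OF that] by simp
    from prufer_eigenfunction[OF \<Theta> cc this] have "\<exists>y y'. dirichlet_solution q w (f n) y y'"
      unfolding dirichlet_solution_def c_def by (simp add: algebra_simps)
    then show ?thesis using f[OF that] by blast
  qed
  ultimately show ?thesis
    by (intro exI[of _ "f ` {1..k}"]) (auto simp: card_image)
qed

section \<open>The Jacobi condition\<close>

text \<open>At an end point \<open>e\<close> with \<open>sin (\<theta> e) = 0\<close> the cotangent grows like \<open>1 / |t - e|\<close>, as \<open>\<theta>\<close> has slope \<open>1\<close>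
  there, while \<open>v\<^sup>2 \<le> |t - e| \<integral> g\<^sup>2\<close> with the integral taken between \<open>t\<close> and \<open>e\<close>, which tends to \<open>0\<close>.\<close>
lemma cot_weighted_limit:
  assumes \<theta>: "prufer_angle c \<theta>" and e: "e \<in> {0..1}" "e \<in> {a..b}" "{a..b} \<subseteq> {0..1}" and "a < b"
    and v: "primitive_on a b v g" and g2: "set_integrable lborel {a..b} (\<lambda>t. (g t)\<^sup>2)" and ve: "v e = 0"
  shows "((\<lambda>t. (v t)\<^sup>2 * cot (\<theta> t)) \<longlongrightarrow> 0) (at e within {a..b})"
proof -
  have tt: "(\<theta> \<longlongrightarrow> \<theta> e) (at e within {a..b})"
    using prufer_angle_continuous[OF \<theta>] e by (meson continuous_on_def tendsto_within_subset)
  have vt: "(v \<longlongrightarrow> 0) (at e within {a..b})"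
    using primitive_on_continuous[OF v] e ve by (metis continuous_on_def)
  show ?thesis
  proof (cases "sin (\<theta> e) = 0")
    case False
    have "((\<lambda>t. (v t)\<^sup>2 * cot (\<theta> t)) \<longlongrightarrow> 0\<^sup>2 * cot (\<theta> e)) (at e within {a..b})"
      by (intro tendsto_intros vt tt False)
    then show ?thesis by simp
  next
    case True
    define I where "I = (\<lambda>t. integral {a..t} (\<lambda>s. (g s)\<^sup>2))"
    have ii: "set_integrable lborel {x..y} (\<lambda>s. (g s)\<^sup>2)" if "a \<le> x" "y \<le> b" for x y
      by (rule set_integrable_subset[OF g2]) (use that in auto)
    have hk: "(\<lambda>s. (g s)\<^sup>2) integrable_on {a..b}"
      by (rule set_borel_integral_eq_integral(1)[OF g2])
    have Ic: "continuous_on {a..b} I"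
      unfolding I_def by (rule indefinite_integral_continuous_1[OF hk])
    have Id: "I y - I x = (LBINT s:{x..y}. (g s)\<^sup>2)" if "a \<le> x" "x \<le> y" "y \<le> b" for x y
    proof -
      have "(\<lambda>s. (g s)\<^sup>2) integrable_on {a..y}" by (rule integrable_on_subinterval[OF hk]) (use that in auto)
      from Henstock_Kurzweil_Integration.integral_combine[OF that(1,2) this] show ?thesis
        using set_borel_integral_eq_integral(2)[OF ii[OF that(1,3)]] by (simp add: I_def)
    qed
    have vb: "(v t)\<^sup>2 \<le> \<bar>t - e\<bar> * \<bar>I t - I e\<bar>" if t: "t \<in> {a..b}" for t
    proof (cases "t \<le> e")
      case True
      have "(v e - v t)\<^sup>2 \<le> (e - t) * (LBINT s:{t..e}. (g s)\<^sup>2)"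
        by (rule primitive_on_increment_sq[OF primitive_on_subinterval[OF v]]) (use True t e ii in auto)
      also have "(LBINT s:{t..e}. (g s)\<^sup>2) = I e - I t" using Id[of t e] True t e by simp
      also have "(e - t) * (I e - I t) \<le> \<bar>t - e\<bar> * \<bar>I t - I e\<bar>"
        unfolding abs_mult[symmetric] by (rule order_trans[OF _ abs_ge_self]) (simp add: algebra_simps)
      finally show ?thesis by (simp add: ve)
    next
      case False
      have "(v t - v e)\<^sup>2 \<le> (t - e) * (LBINT s:{e..t}. (g s)\<^sup>2)"
        by (rule primitive_on_increment_sq[OF primitive_on_subinterval[OF v]]) (use False t e ii in auto)
      also have "(LBINT s:{e..t}. (g s)\<^sup>2) = I t - I e" using Id[of e t] False t e by simp
      also have "(t - e) * (I t - I e) \<le> \<bar>t - e\<bar> * \<bar>I t - I e\<bar>"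
        unfolding abs_mult[symmetric] by (rule abs_ge_self)
      finally show ?thesis by (simp add: ve)
    qed
    have c1: "\<bar>cos (\<theta> e)\<bar> = 1" using True sin_cos_squared_add[of "\<theta> e"] by (simp add: power2_eq_1_iff abs_if split: if_splits) auto
    have "(\<theta> has_real_derivative 1) (at e within {0..1})"
      using \<theta> e(1) True unfolding prufer_angle_def by (auto simp: cos_squared_eq dest!: bspec[of _ _ e])
    then have d1: "(\<theta> has_real_derivative 1) (at e within {a..b})"
      by (rule has_field_derivative_subset) (rule e(3))
    have "((\<lambda>t. sin (\<theta> t)) has_real_derivative cos (\<theta> e) * 1) (at e within {a..b})"
      by (rule DERIV_chain2[OF DERIV_sin d1])
    then have "((\<lambda>t. sin (\<theta> t) / (t - e)) \<longlongrightarrow> cos (\<theta> e)) (at e within {a..b})"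
      unfolding has_field_derivative_iff by (simp add: True)
    then have "((\<lambda>t. \<bar>I t - I e\<bar> * (\<bar>cos (\<theta> t)\<bar> / \<bar>sin (\<theta> t) / (t - e)\<bar>)) \<longlongrightarrow> \<bar>I e - I e\<bar> * (\<bar>cos (\<theta> e)\<bar> / \<bar>cos (\<theta> e)\<bar>)) (at e within {a..b})"
      using Ic e c1 by (intro tendsto_intros tt) (auto simp: continuous_on_def)
    then have lim: "((\<lambda>t. \<bar>I t - I e\<bar> * (\<bar>cos (\<theta> t)\<bar> / \<bar>sin (\<theta> t) / (t - e)\<bar>)) \<longlongrightarrow> 0) (at e within {a..b})"
      by simp
    show ?thesis
    proof (rule Lim_null_comparison[OF _ lim])
      show "\<forall>\<^sub>F t in at e within {a..b}. norm ((v t)\<^sup>2 * cot (\<theta> t))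
          \<le> \<bar>I t - I e\<bar> * (\<bar>cos (\<theta> t)\<bar> / \<bar>sin (\<theta> t) / (t - e)\<bar>)"
        unfolding eventually_at_filter
      proof (intro always_eventually allI impI)
        fix t assume t: "t \<noteq> e" "t \<in> {a..b}"
        have "norm ((v t)\<^sup>2 * cot (\<theta> t)) = (v t)\<^sup>2 * \<bar>cot (\<theta> t)\<bar>" by (simp add: abs_mult)
        also have "\<dots> \<le> (\<bar>t - e\<bar> * \<bar>I t - I e\<bar>) * \<bar>cot (\<theta> t)\<bar>"
          by (rule mult_right_mono[OF vb[OF t(2)]]) simp
        also have "\<dots> = \<bar>I t - I e\<bar> * (\<bar>cos (\<theta> t)\<bar> / \<bar>sin (\<theta> t) / (t - e)\<bar>)"
          by (simp add: cot_def abs_divide)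
        finally show "norm ((v t)\<^sup>2 * cot (\<theta> t)) \<le> \<bar>I t - I e\<bar> * (\<bar>cos (\<theta> t)\<bar> / \<bar>sin (\<theta> t) / (t - e)\<bar>)" .
      qed
    qed
  qed
qed

text \<open>Completing the square with \<open>C = cot \<theta> = y' / y\<close>, a solution of the Riccati equation \<open>C' = q - C\<^sup>2\<close>: the
  integrand \<open>g\<^sup>2 + q v\<^sup>2\<close> is \<open>(g - C v)\<^sup>2\<close> plus the derivative of \<open>v\<^sup>2 C\<close>.\<close>
lemma jacobi_interval_regular:
  assumes \<theta>: "prufer_angle (\<lambda>t. - q t) \<theta>" and q: "continuous_on {0..1} q"
    and ab: "0 \<le> a" "a \<le> b" "b \<le> 1" and nz: "\<And>t. t \<in> {a..b} \<Longrightarrow> sin (\<theta> t) \<noteq> 0"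
    and v: "primitive_on a b v g" and g2: "set_integrable lborel {a..b} (\<lambda>t. (g t)\<^sup>2)"
  shows "(v b)\<^sup>2 * cot (\<theta> b) - (v a)\<^sup>2 * cot (\<theta> a) \<le> (LBINT t:{a..b}. (g t)\<^sup>2 + q t * (v t)\<^sup>2)"
proof -
  define C where "C = (\<lambda>t. cot (\<theta> t))"
  define C' where "C' = (\<lambda>t. q t - (C t)\<^sup>2)"
  have sub: "{a..b} \<subseteq> {0..1}" using ab by auto
  have c\<theta>: "continuous_on {a..b} \<theta>" by (rule continuous_on_subset[OF prufer_angle_continuous[OF \<theta>] sub])
  have cq: "continuous_on {a..b} q" by (rule continuous_on_subset[OF q sub])
  have cC: "continuous_on {a..b} C" unfolding C_def by (intro continuous_intros c\<theta>) (use nz in auto)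
  have cC': "continuous_on {a..b} C'" unfolding C'_def by (intro continuous_intros cC cq)
  have cv: "continuous_on {a..b} v" by (rule primitive_on_continuous[OF v])
  have pC: "primitive_on a b C C'"
  proof (rule primitive_on_C1[OF _ cC'])
    fix t assume t: "t \<in> {a..b}"
    have "(\<theta> has_real_derivative (cos (\<theta> t))\<^sup>2 + - q t * (sin (\<theta> t))\<^sup>2) (at t within {0..1})"
      using \<theta> t sub unfolding prufer_angle_def by blast
    then have "(\<theta> has_real_derivative (cos (\<theta> t))\<^sup>2 + - q t * (sin (\<theta> t))\<^sup>2) (at t within {a..b})"
      by (rule has_field_derivative_subset[OF _ sub])
    from DERIV_chain2[OF DERIV_cot[OF nz[OF t]] this]
    have "(C has_real_derivative - inverse ((sin (\<theta> t))\<^sup>2) * ((cos (\<theta> t))\<^sup>2 + - q t * (sin (\<theta> t))\<^sup>2)) (at t within {a..b})"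
      unfolding C_def .
    also have "- inverse ((sin (\<theta> t))\<^sup>2) * ((cos (\<theta> t))\<^sup>2 + - q t * (sin (\<theta> t))\<^sup>2) = C' t"
      using nz[OF t] by (simp add: C'_def C_def cot_def field_simps power_divide)
    finally show "(C has_real_derivative C' t) (at t within {a..b})" .
  qed
  note pvv = primitive_on_mult_primitive[OF v v ab(2)]
  have si: "set_integrable lborel {a..b} (\<lambda>t. (g t * v t + v t * g t) * C t + v t * v t * C' t)"
    by (rule primitive_on_mult(1)[OF pvv pC ab(2)])
  have bd: "(LBINT t:{a..b}. (g t * v t + v t * g t) * C t + v t * v t * C' t) = v b * v b * C b - v a * v a * C a"
    by (rule primitive_on_mult(2)[OF pvv pC ab(2)])
  have qi: "set_integrable lborel {a..b} (\<lambda>t. (g t)\<^sup>2 + q t * (v t)\<^sup>2)"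
    by (intro set_integral_add(1) g2 set_integrable_continuous continuous_intros cq cv)
  have "0 \<le> (LBINT t:{a..b}. (g t - C t * v t)\<^sup>2)"
    unfolding set_lebesgue_integral_def by (intro Bochner_Integration.integral_nonneg) auto
  also have "\<dots> = (LBINT t:{a..b}. ((g t)\<^sup>2 + q t * (v t)\<^sup>2) - ((g t * v t + v t * g t) * C t + v t * v t * C' t))"
    unfolding C'_def by (simp add: power2_eq_square algebra_simps)
  also have "\<dots> = (LBINT t:{a..b}. (g t)\<^sup>2 + q t * (v t)\<^sup>2) - (v b * v b * C b - v a * v a * C a)"
    using set_integral_diff(2)[OF qi si] bd by simp
  finally show ?thesis by (simp add: C_def power2_eq_square)
qed

text \<open>The end points may be zeros of \<open>sin \<theta>\<close>, where the cotangent is singular; they are approached from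
  inside, one after the other.\<close>
lemma jacobi_interval:
  assumes \<theta>: "prufer_angle (\<lambda>t. - q t) \<theta>" and q: "continuous_on {0..1} q"
    and ab: "0 \<le> a" "a < b" "b \<le> 1" and nz: "\<And>t. a < t \<Longrightarrow> t < b \<Longrightarrow> sin (\<theta> t) \<noteq> 0"
    and v: "primitive_on a b v g" and g2: "set_integrable lborel {a..b} (\<lambda>t. (g t)\<^sup>2)"
    and va: "v a = 0" and vb: "v b = 0"
  shows "0 \<le> (LBINT t:{a..b}. (g t)\<^sup>2 + q t * (v t)\<^sup>2)"
proof -
  let ?f = "\<lambda>t. (g t)\<^sup>2 + q t * (v t)\<^sup>2" and ?c = "\<lambda>t. (v t)\<^sup>2 * cot (\<theta> t)"
  have sub: "{a..b} \<subseteq> {0..1}" using ab by auto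
  have cq: "continuous_on {a..b} q" by (rule continuous_on_subset[OF q sub])
  have cv: "continuous_on {a..b} v" by (rule primitive_on_continuous[OF v])
  have qi: "set_integrable lborel {a..b} ?f"
    by (intro set_integral_add(1) g2 set_integrable_continuous continuous_intros cq cv)
  then have hk: "?f integrable_on {a..b}" by (rule set_borel_integral_eq_integral(1))
  define J where "J = (\<lambda>t. integral {a..t} ?f)"
  have Jc: "continuous_on {a..b} J" unfolding J_def by (rule indefinite_integral_continuous_1[OF hk])
  have key: "?c y - ?c x \<le> J y - J x" if "a < x" "x \<le> y" "y < b" for x y
  proof -
    have s: "set_integrable lborel {x..y} f" if "set_integrable lborel {a..b} f" for f :: "real \<Rightarrow> real"
      by (rule set_integrable_subset[OF that]) (use \<open>a < x\<close> \<open>y < b\<close> in auto)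
    have "?c y - ?c x \<le> (LBINT t:{x..y}. ?f t)"
      by (rule jacobi_interval_regular[OF \<theta> q _ _ _ _ primitive_on_subinterval[OF v] s[OF g2]])
        (use that ab nz in auto)
    also have "\<dots> = integral {x..y} ?f" by (rule set_borel_integral_eq_integral(2)[OF s[OF qi]])
    also have "\<dots> = J y - J x"
    proof -
      have "?f integrable_on {a..y}" by (rule integrable_on_subinterval[OF hk]) (use that in auto)
      from Henstock_Kurzweil_Integration.integral_combine[OF _ that(2) this] show ?thesis using that by (simp add: J_def)
    qed
    finally show ?thesis .
  qed
  have ca: "(?c \<longlongrightarrow> 0) (at a within {a..b})"
    by (rule cot_weighted_limit[OF \<theta> _ _ sub ab(2) v g2 va]) (use ab in auto)
  have cb: "(?c \<longlongrightarrow> 0) (at b within {a..b})"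
    by (rule cot_weighted_limit[OF \<theta> _ _ sub ab(2) v g2 vb]) (use ab in auto)
  have nt: "at a within {a..b} \<noteq> bot" "at b within {a..b} \<noteq> bot"
    using ab by (simp_all add: trivial_limit_within islimpt_Icc)
  have step: "- ?c x \<le> J b - J x" if x: "a < x" "x < b" for x
  proof (rule tendsto_le[OF nt(2)])
    show "((\<lambda>y. J y - J x) \<longlongrightarrow> J b - J x) (at b within {a..b})"
      using Jc ab by (intro tendsto_intros) (auto simp: continuous_on_def)
    show "((\<lambda>y. ?c y - ?c x) \<longlongrightarrow> - ?c x) (at b within {a..b})"
      using tendsto_diff[OF cb tendsto_const[of "?c x"]] by simp
    have "\<forall>\<^sub>F y in at b within {a..b}. x < y"
      using x by (intro order_tendstoD(1)[OF tendsto_ident_at])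
    moreover have "\<forall>\<^sub>F y in at b within {a..b}. y \<noteq> b \<and> y \<in> {a..b}"
      by (simp add: eventually_at_filter)
    ultimately show "\<forall>\<^sub>F y in at b within {a..b}. ?c y - ?c x \<le> J y - J x"
      by eventually_elim (rule key, use x in auto)
  qed
  have "0 \<le> J b - J a"
  proof (rule tendsto_le[OF nt(1)])
    show "((\<lambda>x. J b - J x) \<longlongrightarrow> J b - J a) (at a within {a..b})"
      using Jc ab by (intro tendsto_intros) (auto simp: continuous_on_def)
    show "((\<lambda>x. - ?c x) \<longlongrightarrow> 0) (at a within {a..b})"
      using tendsto_minus[OF ca] by simp
    have "\<forall>\<^sub>F x in at a within {a..b}. x < b"
      using ab by (intro order_tendstoD(2)[OF tendsto_ident_at])
    moreover have "\<forall>\<^sub>F x in at a within {a..b}. x \<noteq> a \<and> x \<in> {a..b}"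
      by (simp add: eventually_at_filter)
    ultimately show "\<forall>\<^sub>F x in at a within {a..b}. - ?c x \<le> J b - J x"
      by eventually_elim (rule step, auto)
  qed
  also have "J b - J a = (LBINT t:{a..b}. ?f t)"
    using set_borel_integral_eq_integral(2)[OF qi] by (simp add: J_def)
  finally show ?thesis .
qed

text \<open>Jacobi's condition on each interval between consecutive zeros, summed up by induction on the number
  of zeros left of the end point.\<close>
lemma jacobi_nonneg:
  assumes \<theta>: "prufer_angle (\<lambda>t. - q t) \<theta>" and q: "continuous_on {0..1} q"
    and Z: "finite {t. 0 < t \<and> t < 1 \<and> sin (\<theta> t) = 0}"
    and v: "has_L2_deriv v g" and v0: "v 0 = 0" "v 1 = 0"
    and vZ: "\<And>t. 0 < t \<Longrightarrow> t < 1 \<Longrightarrow> sin (\<theta> t) = 0 \<Longrightarrow> v t = 0"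
  shows "0 \<le> (LBINT t:{0..1}. (g t)\<^sup>2 + q t * (v t)\<^sup>2)"
proof -
  define Z where "Z = {t. 0 < t \<and> t < 1 \<and> sin (\<theta> t) = 0}"
  have fZ: "finite Z" using Z by (simp add: Z_def)
  let ?f = "\<lambda>t. (g t)\<^sup>2 + q t * (v t)\<^sup>2"
  have p: "primitive_on 0 1 v g" by (rule primitive_on_has_L2_deriv[OF v])
  have g2: "set_integrable lborel {0..1} (\<lambda>t. (g t)\<^sup>2)" using v by (simp add: has_L2_deriv_def)
  have cv: "continuous_on {0..1} v" by (rule has_L2_deriv_continuous[OF v])
  have "set_integrable lborel {0..1} (\<lambda>t. q t * (v t)\<^sup>2)"
    by (intro set_integrable_continuous continuous_intros q cv)
  then have fi: "set_integrable lborel {0..1} ?f" by (rule set_integral_add(1)[OF g2])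
  then have hk: "?f integrable_on {0..1}" by (rule set_borel_integral_eq_integral(1))
  have step: "0 \<le> integral {a..b} ?f"
    if "0 \<le> a" "a < b" "b \<le> 1" "v a = 0" "v b = 0" "\<And>t. a < t \<Longrightarrow> t < b \<Longrightarrow> t \<notin> Z" for a b
  proof -
    have s: "set_integrable lborel {a..b} f" if "set_integrable lborel {0..1} f" for f :: "real \<Rightarrow> real"
      by (rule set_integrable_subset[OF that]) (use \<open>0 \<le> a\<close> \<open>b \<le> 1\<close> in auto)
    have "0 \<le> (LBINT t:{a..b}. ?f t)"
    proof (rule jacobi_interval[OF \<theta> q that(1-3) _ primitive_on_subinterval[OF p] s[OF g2] that(4,5)])
      show "sin (\<theta> t) \<noteq> 0" if "a < t" "t < b" for t
        using \<open>\<And>t. a < t \<Longrightarrow> t < b \<Longrightarrow> t \<notin> Z\<close>[OF that] that \<open>0 \<le> a\<close> \<open>b \<le> 1\<close> by (auto simp: Z_def)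
    qed (use that in auto)
    also have "\<dots> = integral {a..b} ?f" by (rule set_borel_integral_eq_integral(2)[OF s[OF fi]])
    finally show ?thesis .
  qed
  have "0 \<le> integral {0..b} ?f" if "b \<in> insert 1 Z" for b
    using that
  proof (induction "card {z\<in>Z. z < b}" arbitrary: b rule: less_induct)
    case less
    have b: "0 < b" "b \<le> 1" "v b = 0" using less.prems v0 vZ by (auto simp: Z_def)
    show ?case
    proof (cases "{z\<in>Z. z < b} = {}")
      case True
      show ?thesis by (rule step) (use True b v0 in auto)
    next
      case False
      define a where "a = Max {z\<in>Z. z < b}"
      have fin: "finite {z\<in>Z. z < b}" using fZ by simp
      have "a \<in> {z\<in>Z. z < b}" unfolding a_def by (rule Max_in[OF fin False])
      then have a: "a \<in> Z" "a < b" by auto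
      have "{z\<in>Z. z < a} \<subset> {z\<in>Z. z < b}" using a by auto
      then have "card {z\<in>Z. z < a} < card {z\<in>Z. z < b}" by (rule psubset_card_mono[OF fin])
      then have 1: "0 \<le> integral {0..a} ?f" using less.hyps a(1) by blast
      have a01: "0 \<le> a" "v a = 0" using a vZ by (auto simp: Z_def)
      have 2: "0 \<le> integral {a..b} ?f"
      proof (rule step)
        fix t assume "a < t" "t < b"
        then show "t \<notin> Z" using Max_ge[OF fin, of t] unfolding a_def by auto
      qed (use a a01 b in auto)
      have "?f integrable_on {0..b}" by (rule integrable_on_subinterval[OF hk]) (use b in auto)
      from Henstock_Kurzweil_Integration.integral_combine[OF a01(1) _ this] a 1 2
      show ?thesis by fastforce
    qed
  qed
  from this[of 1] show ?thesis
    using set_borel_integral_eq_integral(2)[OF fi] by simp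
qed

section \<open>Bounds for the negative index of a quadratic form\<close>

text \<open>Each functional cuts the dimension by at most one.\<close>
lemma finite_spanning_of_functionals:
  fixes f :: "'i \<Rightarrow> 'a::real_vector \<Rightarrow> real"
  assumes "finite I" and "\<And>i. i \<in> I \<Longrightarrow> linear (f i)"
    and "subspace W" and "\<And>u. u \<in> W \<Longrightarrow> (\<forall>i\<in>I. f i u = 0) \<Longrightarrow> u = 0"
  shows "\<exists>B. finite B \<and> card B \<le> card I \<and> span B = W"
  using assms
proof (induction I arbitrary: W rule: finite_induct)
  case empty
  then have "W = {0}" using subspace_0 by force
  then show ?case by (intro exI[of _ "{}"]) simp
next
  case (insert i I)
  define W' where "W' = {u \<in> W. f i u = 0}"
  have li: "linear (f i)" using insert.prems by simp
  have sW': "subspace W'"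
    using insert.prems(2) li unfolding W'_def subspace_def
    by (auto simp: linear_add linear_0 linear_scale)
  have "\<exists>B. finite B \<and> card B \<le> card I \<and> span B = W'"
    by (rule insert.IH[OF _ sW']) (use insert.prems in \<open>auto simp: W'_def\<close>)
  then obtain B where B: "finite B" "card B \<le> card I" "span B = W'" by blast
  show ?case
  proof (cases "W' = W")
    case True
    with B insert.hyps show ?thesis by (intro exI[of _ B]) auto
  next
    case False
    then obtain w where w: "w \<in> W" "f i w \<noteq> 0" unfolding W'_def by auto
    have "span (insert w B) = W"
    proof
      have "insert w B \<subseteq> W" using w B span_superset[of B] by (auto simp: W'_def)
      then show "span (insert w B) \<subseteq> W" using insert.prems(2) span_minimal by blast
      show "W \<subseteq> span (insert w B)"
      proof
        fix u assume u: "u \<in> W"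
        let ?u = "u - (f i u / f i w) *\<^sub>R w"
        have "?u \<in> W'"
          using u w li insert.prems(2) unfolding W'_def
          by (simp add: linear_diff linear_scale subspace_diff subspace_scale)
        then have "?u \<in> span B" using B by simp
        then show "u \<in> span (insert w B)" by (auto simp: span_breakdown_eq)
      qed
    qed
    moreover have "card (insert w B) \<le> Suc (card B)" by (rule card_insert_le_m1) auto
    ultimately show ?thesis using B insert.hyps by (intro exI[of _ "insert w B"]) auto
  qed
qed

lemma negative_index_le:
  fixes f :: "'i \<Rightarrow> 'a::real_vector \<Rightarrow> real"
  assumes "finite I" and "\<And>i. i \<in> I \<Longrightarrow> linear (f i)"
    and nn: "\<And>u. u \<in> Z \<Longrightarrow> (\<forall>i\<in>I. f i u = 0) \<Longrightarrow> Q u \<ge> 0"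
  shows "negative_index Z Q \<le> enat (card I)"
  unfolding negative_index_def
proof (rule SUP_least)
  fix W assume "W \<in> {W. subspace W \<and> W \<subseteq> Z \<and> (\<forall>u\<in>W. u \<noteq> 0 \<longrightarrow> Q u < 0)}"
  then have W: "subspace W" "W \<subseteq> Z" "\<And>u. u \<in> W \<Longrightarrow> u \<noteq> 0 \<Longrightarrow> Q u < 0" by auto
  have "\<exists>B. finite B \<and> card B \<le> card I \<and> span B = W"
    by (rule finite_spanning_of_functionals[OF assms(1,2) W(1)]) (use W nn in \<open>force\<close>)+
  then obtain B where B: "finite B" "card B \<le> card I" "span B = W" by blast
  have "dim W \<le> card B" using B(1,3) by (intro dim_le_card) auto
  then show "edim W \<le> enat (card I)" using B by (auto simp: edim_def)
qed

lemma negative_index_ge: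
  fixes e :: "'i \<Rightarrow> 'a::real_vector"
  assumes I: "finite I" and Z: "subspace Z" "\<And>i. i \<in> I \<Longrightarrow> e i \<in> Z" and Q0: "Q 0 = 0"
    and neg: "\<And>c. \<exists>i\<in>I. c i \<noteq> 0 \<Longrightarrow> Q (\<Sum>i\<in>I. c i *\<^sub>R e i) < 0"
  shows "enat (card I) \<le> negative_index Z Q"
proof -
  have indep: "c i = 0" if "(\<Sum>i\<in>I. c i *\<^sub>R e i) = 0" "i \<in> I" for c i
    using neg[of c] that Q0 by force
  have inj: "inj_on e I"
  proof (rule inj_onI, rule ccontr)
    fix i j assume ij: "i \<in> I" "j \<in> I" "e i = e j" "i \<noteq> j"
    let ?c = "\<lambda>l. (if l = i then 1 else 0) - (if l = j then 1 else 0) :: real"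
    have "(\<Sum>l\<in>I. ?c l *\<^sub>R e l) = e i - e j"
      using ij I by (simp add: scaleR_diff_left sum_subtractf if_distrib[of "\<lambda>x. x *\<^sub>R _"] sum.delta cong: if_cong)
    then have "?c i = 0" using ij by (intro indep) auto
    then show False using ij by simp
  qed
  have "independent (e ` I)"
  proof (rule independent_if_scalars_zero)
    fix f x assume s: "(\<Sum>x\<in>e ` I. f x *\<^sub>R x) = 0" and "x \<in> e ` I"
    then obtain i where i: "i \<in> I" "x = e i" by auto
    have "(\<Sum>i\<in>I. f (e i) *\<^sub>R e i) = 0" using s by (simp add: sum.reindex[OF inj])
    from indep[OF this i(1)] show "f x = 0" using i by simp
  qed (use I in simp)
  then have dim: "dim (span (e ` I)) = card I"
    using dim_span_eq_card_independent card_image[OF inj] by metis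
  have "span (e ` I) \<in> {W. subspace W \<and> W \<subseteq> Z \<and> (\<forall>u\<in>W. u \<noteq> 0 \<longrightarrow> Q u < 0)}"
  proof (intro CollectI conjI ballI impI)
    show "span (e ` I) \<subseteq> Z" using Z by (intro span_minimal) auto
    fix u assume "u \<in> span (e ` I)" "u \<noteq> 0"
    then obtain f where f: "u = (\<Sum>x\<in>e ` I. f x *\<^sub>R x)" using I by (auto simp: span_finite)
    then have u: "u = (\<Sum>i\<in>I. f (e i) *\<^sub>R e i)" by (simp add: sum.reindex[OF inj])
    have "\<exists>i\<in>I. f (e i) \<noteq> 0"
    proof (rule ccontr)
      assume "\<not> ?thesis"
      then have "u = 0" unfolding u by (intro sum.neutral) auto
      with \<open>u \<noteq> 0\<close> show False by simp
    qed
    from neg[OF this] show "Q u < 0" unfolding u .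
  qed simp
  then have "edim (span (e ` I)) \<le> negative_index Z Q"
    unfolding negative_index_def by (rule SUP_upper)
  moreover have "edim (span (e ` I)) = enat (card I)"
    using I dim unfolding edim_def by auto
  ultimately show ?thesis by simp
qed

section \<open>The index of the Dirichlet form\<close>

text \<open>The derivative of the Wronskian \<open>y z' - z y'\<close>, which vanishes at both ends, is \<open>(\<mu> - \<nu>) w y z\<close>.\<close>
lemma dirichlet_solution_orthogonal:
  assumes q: "continuous_on {0..1} q" and w: "continuous_on {0..1} w"
    and 1: "dirichlet_solution q w \<mu> y y'" and 2: "dirichlet_solution q w \<nu> z z'" and "\<mu> \<noteq> \<nu>"
  shows "integral {0..1} (\<lambda>t. w t * (y t * z t)) = 0"
proof -
  have "((\<lambda>t. (\<mu> - \<nu>) * (w t * (y t * z t))) has_integral (y 1 * z' 1 - z 1 * y' 1) - (y 0 * z' 0 - z 0 * y' 0)) {0..1}"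
  proof (rule fundamental_theorem_of_calculus)
    fix t :: real assume t: "t \<in> {0..1}"
    have "((\<lambda>t. y t * z' t - z t * y' t) has_real_derivative
        (y' t * z' t + ((q t - \<nu> * w t) * z t) * y t) - (z' t * y' t + ((q t - \<mu> * w t) * y t) * z t)) (at t within {0..1})"
      by (intro DERIV_diff DERIV_mult dirichlet_solutionD[OF 1] dirichlet_solutionD[OF 2] t)
    also have "(y' t * z' t + ((q t - \<nu> * w t) * z t) * y t) - (z' t * y' t + ((q t - \<mu> * w t) * y t) * z t)
        = (\<mu> - \<nu>) * (w t * (y t * z t))" by (simp add: algebra_simps)
    finally show "((\<lambda>t. y t * z' t - z t * y' t) has_vector_derivative (\<mu> - \<nu>) * (w t * (y t * z t))) (at t within {0..1})"
      by (simp add: has_real_derivative_iff_has_vector_derivative)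
  qed simp
  moreover have "y 0 = 0" "y 1 = 0" "z 0 = 0" "z 1 = 0" using 1 2 by (auto simp: dirichlet_solution_def)
  ultimately have "((\<lambda>t. (\<mu> - \<nu>) * (w t * (y t * z t))) has_integral 0) {0..1}" by simp
  from integral_unique[OF this] have "(\<mu> - \<nu>) * integral {0..1} (\<lambda>t. w t * (y t * z t)) = 0"
    unfolding integral_mult_right .
  then show ?thesis using \<open>\<mu> \<noteq> \<nu>\<close> by simp
qed

text \<open>Since \<open>Y'' = q Y - \<Sum> c\<^sub>\<mu> \<mu> w y\<^sub>\<mu>\<close>, integrating the derivative of \<open>Y Y'\<close> turns the form into
  \<open>\<integral> \<Sum> c\<^sub>\<mu> \<mu> w y\<^sub>\<mu> Y\<close>, and orthogonality leaves the squares.\<close>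
lemma dirichlet_form_combination:
  fixes c :: "real \<Rightarrow> real"
  assumes q: "continuous_on {0..1} q" and w: "continuous_on {0..1} w" and M: "finite M"
    and sol: "\<And>\<mu>. \<mu> \<in> M \<Longrightarrow> dirichlet_solution q w \<mu> (y \<mu>) (y' \<mu>)"
  defines "Y \<equiv> \<lambda>t. \<Sum>\<mu>\<in>M. c \<mu> * y \<mu> t" and "Y' \<equiv> \<lambda>t. \<Sum>\<mu>\<in>M. c \<mu> * y' \<mu> t"
  shows "integral {0..1} (\<lambda>t. (Y' t)\<^sup>2 + q t * (Y t)\<^sup>2) = (\<Sum>\<mu>\<in>M. \<mu> * (c \<mu>)\<^sup>2 * integral {0..1} (\<lambda>t. w t * (y \<mu> t)\<^sup>2))"
proof -
  note d = dirichlet_solutionD(1,2)[OF sol] and cy = dirichlet_solutionD(3)[OF sol]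
    and cy' = dirichlet_solutionD(4)[OF sol]
  have cY: "continuous_on {0..1} Y" "continuous_on {0..1} Y'"
    unfolding Y_def Y'_def by (intro continuous_intros cy cy'; assumption)+
  define S where "S = (\<lambda>t. \<Sum>\<mu>\<in>M. (\<mu> * c \<mu>) * (w t * (y \<mu> t * Y t)))"
  have cS: "continuous_on {0..1} S"
    unfolding S_def by (intro continuous_intros cy w cY; assumption)
  have Y0: "Y 0 = 0" "Y 1 = 0" using sol unfolding Y_def dirichlet_solution_def by (simp_all add: sum.neutral)
  have "((\<lambda>t. ((Y' t)\<^sup>2 + q t * (Y t)\<^sup>2) - S t) has_integral Y 1 * Y' 1 - Y 0 * Y' 0) {0..1}"
  proof (rule fundamental_theorem_of_calculus)
    fix t :: real assume t: "t \<in> {0..1}"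
    have dY: "(Y has_real_derivative Y' t) (at t within {0..1})"
      unfolding Y_def Y'_def by (rule DERIV_sum, rule DERIV_cmult, rule d(1)[OF _ t])
    have dY': "(Y' has_real_derivative (\<Sum>\<mu>\<in>M. c \<mu> * ((q t - \<mu> * w t) * y \<mu> t))) (at t within {0..1})"
      unfolding Y'_def by (rule DERIV_sum, rule DERIV_cmult, rule d(2)[OF _ t])
    have "((\<lambda>t. Y t * Y' t) has_real_derivative Y' t * Y' t + (\<Sum>\<mu>\<in>M. c \<mu> * ((q t - \<mu> * w t) * y \<mu> t)) * Y t) (at t within {0..1})"
      by (rule DERIV_mult[OF dY dY'])
    also have "(\<Sum>\<mu>\<in>M. c \<mu> * ((q t - \<mu> * w t) * y \<mu> t)) * Y t = q t * Y t * Y t - S t"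
    proof -
      have "q t * Y t * Y t = (\<Sum>\<mu>\<in>M. q t * (c \<mu> * y \<mu> t) * Y t)"
      proof -
        have "q t * X * Z = (\<Sum>\<mu>\<in>M. q t * (c \<mu> * y \<mu> t) * Z)" if "X = (\<Sum>\<mu>\<in>M. c \<mu> * y \<mu> t)" for X Z
          unfolding that by (simp add: sum_distrib_left sum_distrib_right)
        then show ?thesis by (simp only: Y_def)
      qed
      then show ?thesis
        unfolding S_def sum_distrib_right by (simp add: sum_subtractf[symmetric] algebra_simps)
    qed
    also have "Y' t * Y' t + (q t * Y t * Y t - S t) = ((Y' t)\<^sup>2 + q t * (Y t)\<^sup>2) - S t"
      by (simp add: power2_eq_square)
    finally show "((\<lambda>t. Y t * Y' t) has_vector_derivative ((Y' t)\<^sup>2 + q t * (Y t)\<^sup>2) - S t) (at t within {0..1})"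
      by (simp add: has_real_derivative_iff_has_vector_derivative)
  qed simp
  then have "integral {0..1} (\<lambda>t. ((Y' t)\<^sup>2 + q t * (Y t)\<^sup>2) - S t) = 0"
    using Y0 by (simp add: integral_unique)
  moreover have "integral {0..1} (\<lambda>t. ((Y' t)\<^sup>2 + q t * (Y t)\<^sup>2) - S t)
      = integral {0..1} (\<lambda>t. (Y' t)\<^sup>2 + q t * (Y t)\<^sup>2) - integral {0..1} S"
    by (intro integral_diff integrable_continuous_real continuous_intros q cY cS)
  ultimately have "integral {0..1} (\<lambda>t. (Y' t)\<^sup>2 + q t * (Y t)\<^sup>2) = integral {0..1} S" by simp
  also have "\<dots> = (\<Sum>\<mu>\<in>M. (\<mu> * c \<mu>) * integral {0..1} (\<lambda>t. w t * (y \<mu> t * Y t)))"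
    unfolding S_def
    by (subst integral_sum, rule M, intro integrable_continuous_real continuous_intros w cy cY, assumption) simp
  also have "\<dots> = (\<Sum>\<mu>\<in>M. \<mu> * (c \<mu>)\<^sup>2 * integral {0..1} (\<lambda>t. w t * (y \<mu> t)\<^sup>2))"
  proof (rule sum.cong[OF refl])
    fix \<mu> assume \<mu>: "\<mu> \<in> M"
    have "integral {0..1} (\<lambda>t. w t * (y \<mu> t * Y t)) = integral {0..1} (\<lambda>t. \<Sum>\<nu>\<in>M. c \<nu> * (w t * (y \<mu> t * y \<nu> t)))"
      unfolding Y_def sum_distrib_left by (simp add: ac_simps)
    also have "\<dots> = (\<Sum>\<nu>\<in>M. c \<nu> * integral {0..1} (\<lambda>t. w t * (y \<mu> t * y \<nu> t)))"
      by (subst integral_sum, rule M, intro integrable_continuous_real continuous_intros w cy \<mu>, assumption) simp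
    also have "\<dots> = (\<Sum>\<nu>\<in>M. if \<nu> = \<mu> then c \<mu> * integral {0..1} (\<lambda>t. w t * (y \<mu> t)\<^sup>2) else 0)"
      using dirichlet_solution_orthogonal[OF q w sol[OF \<mu>] sol]
      by (intro sum.cong refl) (auto simp: power2_eq_square)
    also have "\<dots> = c \<mu> * integral {0..1} (\<lambda>t. w t * (y \<mu> t)\<^sup>2)" using M \<mu> by simp
    finally show "(\<mu> * c \<mu>) * integral {0..1} (\<lambda>t. w t * (y \<mu> t * Y t)) = \<mu> * (c \<mu>)\<^sup>2 * integral {0..1} (\<lambda>t. w t * (y \<mu> t)\<^sup>2)"
      by (simp add: power2_eq_square)
  qed
  finally show ?thesis .
qed

lemma primitive_on_imp_has_L2_deriv:
  assumes C: "\<And>t. t \<in> {0..1} \<Longrightarrow> (y has_real_derivative y' t) (at t within {0..1})"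
    and c: "continuous_on {0..1} y'"
  shows "has_L2_deriv y (\<lambda>t. indicator {0..1} t * y' t)"
proof -
  have m: "(\<lambda>t. indicator {0..1} t *\<^sub>R y' t) \<in> borel_measurable borel"
    by (rule borel_measurable_continuous_on_indicator[OF _ c]) simp
  have "set_integrable lborel {0..1} (\<lambda>t. (y' t)\<^sup>2)"
    by (intro set_integrable_continuous continuous_intros c)
  then have i: "set_integrable lborel {0..1} (\<lambda>t. (indicator {0..1} t * y' t)\<^sup>2)"
    by (rule set_integrable_cong[THEN iffD1, rotated -1]) auto
  have "y t = y 0 + (LBINT s:{0..t}. indicator {0..1} s * y' s)" if "t \<in> {0..1}" for t
  proof -
    have "y t = y 0 + (LBINT s:{0..t}. y' s)"
      by (rule primitive_onD(2)[OF primitive_on_C1[OF C c] that])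
    also have "(LBINT s:{0..t}. y' s) = (LBINT s:{0..t}. indicator {0..1} s * y' s)"
      by (rule set_lebesgue_integral_cong) (use that in \<open>auto simp: indicator_def\<close>)
    finally show ?thesis .
  qed
  with m i show ?thesis unfolding has_L2_deriv_def real_scaleR_def by blast
qed

lemma h1_of_C1:
  assumes C: "\<And>t. t \<in> {0..1} \<Longrightarrow> (y has_real_derivative y' t) (at t within {0..1})"
    and c: "continuous_on {0..1} y'"
  shows "\<exists>u. \<forall>t\<in>{0..1}. h1_fun u t = y t"
proof -
  define u where "u = (\<lambda>t. indicator {0..1} t * y t)"
  have "has_L2_deriv u (\<lambda>t. indicator {0..1} t * y' t)"
  proof (rule primitive_on_imp_has_L2_deriv[OF _ c])
    fix t :: real assume t: "t \<in> {0..1}"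
    show "(u has_real_derivative y' t) (at t within {0..1})"
      by (rule has_field_derivative_transform_within[OF C[OF t] zero_less_one t]) (simp add: u_def)
  qed
  then have "h1_fun (Abs_h1 u) = u"
    by (intro Abs_h1_inverse) (auto simp: u_def)
  then show ?thesis by (intro exI[of _ "Abs_h1 u"]) (simp add: u_def)
qed

lemma h1_deriv_of_C1:
  assumes C: "\<And>t. t \<in> {0..1} \<Longrightarrow> (h1_fun u has_real_derivative y' t) (at t within {0..1})"
    and c: "continuous_on {0..1} y'"
  shows "AE t in lborel. t \<in> {0..1} \<longrightarrow> h1_deriv u t = y' t"
  using has_L2_deriv_unique[OF h1_deriv primitive_on_imp_has_L2_deriv[OF C c]]
  by (auto elim: eventually_mono)

lemma h10_of_C1:
  assumes C: "\<And>t. t \<in> {0..1} \<Longrightarrow> (y has_real_derivative y' t) (at t within {0..1})"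
    and c: "continuous_on {0..1} y'" and y0: "y 0 = 0" "y 1 = 0"
  shows "\<exists>v. \<forall>t\<in>{0..1}. h10_fun v t = y t"
proof -
  obtain u where u: "\<And>t. t \<in> {0..1} \<Longrightarrow> h1_fun u t = y t"
    using h1_of_C1[OF C c] by blast
  have "h10_h1 (Abs_h10 u) = u"
    by (rule Abs_h10_inverse) (simp add: u y0)
  with u show ?thesis by (intro exI[of _ "Abs_h10 u"]) simp
qed

lemma h10_fun_sum: "h10_fun (\<Sum>i\<in>I. c i *\<^sub>R v i) t = (\<Sum>i\<in>I. c i * h10_fun (v i) t)"
  by (induction I rule: infinite_finite_induct)
    (simp_all add: zero_h10.rep_eq zero_h1.rep_eq plus_h10.rep_eq plus_h1.rep_eq scaleR_h10.rep_eq scaleR_h1.rep_eq)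

lemma h10_form_cong:
  assumes f: "\<And>t. t \<in> {0..1} \<Longrightarrow> h10_fun v t = y t" and d: "AE t in lborel. t \<in> {0..1} \<longrightarrow> h10_deriv v t = y' t"
    and c: "continuous_on {0..1} y" "continuous_on {0..1} y'" "continuous_on {0..1} q"
  shows "(LBINT t:{0..1}. (h10_deriv v t)\<^sup>2 + q t * (h10_fun v t)\<^sup>2) = integral {0..1} (\<lambda>t. (y' t)\<^sup>2 + q t * (y t)\<^sup>2)"
proof -
  let ?f = "\<lambda>t. (y' t)\<^sup>2 + q t * (y t)\<^sup>2"
  have si: "set_integrable lborel {0..1} ?f"
    by (intro set_integrable_continuous continuous_intros c)
  have cont: "continuous_on {0..1} (\<lambda>t. q t * (h10_fun v t)\<^sup>2)"
    by (intro continuous_intros c has_L2_deriv_continuous[OF h1_deriv])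
  have m2: "(\<lambda>t. indicator {0..1} t *\<^sub>R (q t * (h10_fun v t)\<^sup>2)) \<in> borel_measurable borel"
    by (rule borel_measurable_continuous_on_indicator[OF _ cont]) simp
  have "(LBINT t:{0..1}. (h10_deriv v t)\<^sup>2 + q t * (h10_fun v t)\<^sup>2) = (LBINT t:{0..1}. ?f t)"
    unfolding set_lebesgue_integral_def
  proof (rule integral_cong_AE)
    have "(\<lambda>t. indicator {0..1} t *\<^sub>R (h10_deriv v t)\<^sup>2 + indicator {0..1} t *\<^sub>R (q t * (h10_fun v t)\<^sup>2)) \<in> borel_measurable lborel"
      using m2 by simp
    then show "(\<lambda>t. indicator {0..1} t *\<^sub>R ((h10_deriv v t)\<^sup>2 + q t * (h10_fun v t)\<^sup>2)) \<in> borel_measurable lborel"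
      by (simp add: distrib_left)
    show "(\<lambda>t. indicator {0..1} t *\<^sub>R ?f t) \<in> borel_measurable lborel"
      using si unfolding set_integrable_def by (rule borel_measurable_integrable)
    show "AE t in lborel. indicat_real {0..1} t *\<^sub>R ((h10_deriv v t)\<^sup>2 + q t * (h10_fun v t)\<^sup>2) = indicat_real {0..1} t *\<^sub>R ?f t"
      using d by eventually_elim (auto simp: indicator_def f)
  qed
  also have "\<dots> = integral {0..1} ?f" by (rule set_borel_integral_eq_integral(2)[OF si])
  finally show ?thesis .
qed

text \<open>With \<open>k\<close> the number of interior zeros, index \<open>\<le> k \<le> card N \<le>\<close> index. The last bound is proved for
  finite subsets of \<open>N\<close> first, as finiteness of \<open>N\<close> is itself a consequence of it.\<close>
lemma negative_index_eq_card_dirichlet_eigenvalues: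
  fixes Q :: "path_space \<Rightarrow> real"
  assumes q: "continuous_on {0..1} q" and w: "continuous_on {0..1} w" and wpos: "\<And>t. t \<in> {0..1} \<Longrightarrow> w t > 0"
    and b: "b > 0" and Q: "\<And>v. Q (0, v) = b * (LBINT t:{0..1}. (h10_deriv v t)\<^sup>2 + q t * (h10_fun v t)\<^sup>2)"
  defines "N \<equiv> {\<mu>. \<mu> < 0 \<and> (\<exists>y y'. dirichlet_solution q w \<mu> y y')}"
  shows "finite N \<and> negative_index {(0, v) | v. True} Q = enat (card N)"
proof -
  let ?Z = "{(0, v) | v. True} :: path_space set"
  have Q0: "Q 0 = 0"
  proof -
    have "(LBINT t:{0..1}. (h10_deriv 0 t)\<^sup>2 + q t * (h10_fun 0 t)\<^sup>2) = integral {0..1} (\<lambda>t::real. 0\<^sup>2 + q t * 0\<^sup>2)"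
    proof (rule h10_form_cong[OF _ _ _ _ q])
      show "h10_fun 0 t = 0" for t by (simp add: zero_h10.rep_eq zero_h1.rep_eq)
      have "AE t in lborel. t \<in> {0..1} \<longrightarrow> h1_deriv (0 *\<^sub>R (0::h1)) t = 0 * h1_deriv 0 t" by (rule h1_deriv_scaleR)
      then show "AE t in lborel. t \<in> {0..1} \<longrightarrow> h10_deriv 0 t = 0" by (simp add: zero_h10.rep_eq)
    qed auto
    then show ?thesis using Q[of 0] by (simp add: zero_prod_def)
  qed
  have sZ: "subspace ?Z" by (auto simp: subspace_def zero_prod_def)
  have lower: "enat (card M) \<le> negative_index ?Z Q" if M: "finite M" "M \<subseteq> N" for M
  proof -
    have "\<exists>y. \<forall>\<mu>\<in>M. \<exists>y'. dirichlet_solution q w \<mu> (y \<mu>) y'" using M(2) unfolding N_def by (intro bchoice) blast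
    then obtain y where "\<forall>\<mu>\<in>M. \<exists>y'. dirichlet_solution q w \<mu> (y \<mu>) y'" by blast
    then have "\<exists>y'. \<forall>\<mu>\<in>M. dirichlet_solution q w \<mu> (y \<mu>) (y' \<mu>)" by (rule bchoice)
    then obtain y' where sol: "\<And>\<mu>. \<mu> \<in> M \<Longrightarrow> dirichlet_solution q w \<mu> (y \<mu>) (y' \<mu>)" by blast
    note d = dirichlet_solutionD(1)[OF sol] and cy = dirichlet_solutionD(3)[OF sol]
      and cy' = dirichlet_solutionD(4)[OF sol]
    have "\<forall>\<mu>\<in>M. \<exists>v. (\<forall>t\<in>{0..1}. h10_fun v t = y \<mu> t)"
      using h10_of_C1[OF d cy'] sol unfolding dirichlet_solution_def by blast
    then obtain v where v: "\<And>\<mu> t. \<mu> \<in> M \<Longrightarrow> t \<in> {0..1} \<Longrightarrow> h10_fun (v \<mu>) t = y \<mu> t"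
      using bchoice[of M "\<lambda>\<mu> v. \<forall>t\<in>{0..1}. h10_fun v t = y \<mu> t"] by blast
    show ?thesis
    proof (rule negative_index_ge[where e = "\<lambda>\<mu>. (0, v \<mu>)" and Z = ?Z and I = M and Q = Q, OF M(1) sZ _ Q0])
      fix c :: "real \<Rightarrow> real" assume c: "\<exists>\<mu>\<in>M. c \<mu> \<noteq> 0"
      let ?u = "\<Sum>\<mu>\<in>M. c \<mu> *\<^sub>R v \<mu>"
      let ?Y = "\<lambda>t. \<Sum>\<mu>\<in>M. c \<mu> * y \<mu> t" and ?Y' = "\<lambda>t. \<Sum>\<mu>\<in>M. c \<mu> * y' \<mu> t"
      have cY: "continuous_on {0..1} ?Y" "continuous_on {0..1} ?Y'"
        by (intro continuous_intros cy cy'; assumption)+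
      have uY: "h10_fun ?u t = ?Y t" if "t \<in> {0..1}" for t
        unfolding h10_fun_sum by (rule sum.cong) (auto simp: v[OF _ that])
      have dY: "(?Y has_real_derivative ?Y' t) (at t within {0..1})" if "t \<in> {0..1}" for t
        by (rule DERIV_sum, rule DERIV_cmult, rule d[OF _ that])
      have "(h10_fun ?u has_real_derivative ?Y' t) (at t within {0..1})" if t: "t \<in> {0..1}" for t
        by (rule has_field_derivative_transform_within[OF dY[OF t] zero_less_one t]) (simp add: uY)
      then have dae: "AE t in lborel. t \<in> {0..1} \<longrightarrow> h10_deriv ?u t = ?Y' t"
        by (rule h1_deriv_of_C1[OF _ cY(2)])
      have "(\<Sum>\<mu>\<in>M. c \<mu> *\<^sub>R (0::h1, v \<mu>)) = (0, ?u)"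
        by (simp add: prod_eq_iff fst_sum snd_sum)
      then have "Q (\<Sum>\<mu>\<in>M. c \<mu> *\<^sub>R (0, v \<mu>)) = b * integral {0..1} (\<lambda>t. (?Y' t)\<^sup>2 + q t * (?Y t)\<^sup>2)"
        using Q h10_form_cong[OF uY dae cY q] by simp
      also have "\<dots> = b * (\<Sum>\<mu>\<in>M. \<mu> * (c \<mu>)\<^sup>2 * integral {0..1} (\<lambda>t. w t * (y \<mu> t)\<^sup>2))"
        by (simp only: dirichlet_form_combination[OF q w M(1) sol])
      also have "\<dots> < 0"
      proof -
        have pos: "0 < integral {0..1} (\<lambda>t. w t * (y \<mu> t)\<^sup>2)" if "\<mu> \<in> M" for \<mu>
        proof -
          let ?h = "\<lambda>t. w t * (y \<mu> t)\<^sup>2"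
          have ch: "continuous_on {0..1} ?h" by (intro continuous_intros w cy that)
          have h0: "0 \<le> ?h t" if "t \<in> {0..1}" for t using wpos[OF that] by simp
          have "integral {0..1} ?h \<ge> 0" by (rule integral_nonneg[OF integrable_continuous_real[OF ch] h0])
          moreover have "integral {0..1} ?h \<noteq> 0"
          proof
            assume "integral {0..1} ?h = 0"
            then have z: "(?h has_integral 0) (cbox 0 1)"
              using integrable_integral[OF integrable_continuous_real[OF ch]] by simp
            have "?h t = 0" if "t \<in> {0..1}" for t
              using has_integral_0_cbox_imp_0[of 0 1 ?h t] ch h0 z that by simp
            then have "y \<mu> t = 0" if "t \<in> {0..1}" for t using wpos[OF that] that by fastforce
            with sol[OF \<open>\<mu> \<in> M\<close>] show False unfolding dirichlet_solution_def by blast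
          qed
          ultimately show ?thesis by simp
        qed
        have neg: "\<mu> < 0" if "\<mu> \<in> M" for \<mu> using that M(2) by (auto simp: N_def)
        obtain \<mu> where \<mu>: "\<mu> \<in> M" "c \<mu> \<noteq> 0" using c by blast
        have "(\<Sum>\<mu>\<in>M. \<mu> * (c \<mu>)\<^sup>2 * integral {0..1} (\<lambda>t. w t * (y \<mu> t)\<^sup>2)) < (\<Sum>\<mu>\<in>M. 0)"
        proof (rule sum_strict_mono_ex1[OF M(1)])
          show "\<forall>\<mu>\<in>M. \<mu> * (c \<mu>)\<^sup>2 * integral {0..1} (\<lambda>t. w t * (y \<mu> t)\<^sup>2) \<le> 0"
            using pos neg by (auto intro!: mult_nonpos_nonneg simp: less_imp_le)
          show "\<exists>\<mu>\<in>M. \<mu> * (c \<mu>)\<^sup>2 * integral {0..1} (\<lambda>t. w t * (y \<mu> t)\<^sup>2) < 0"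
            using \<mu> pos[OF \<mu>(1)] neg[OF \<mu>(1)] by (intro bexI[of _ \<mu>] mult_neg_pos) auto
        qed
        then show ?thesis using b by (simp add: mult_pos_neg)
      qed
      finally show "Q (\<Sum>\<mu>\<in>M. c \<mu> *\<^sub>R (0, v \<mu>)) < 0" .
    qed auto
  qed
  obtain \<theta> where \<theta>: "prufer_angle (\<lambda>t. - q t) \<theta>"
    using prufer_angle_exists[of "\<lambda>t. - q t"] q continuous_on_minus by blast
  define Z where "Z = {t. 0 < t \<and> t < 1 \<and> sin (\<theta> t) = 0}"
  have Z: "finite Z" "real (card Z) * pi < \<theta> 1" using prufer_zeros[OF \<theta>] by (auto simp: Z_def)
  have upper: "negative_index ?Z Q \<le> enat (card Z)"
  proof (rule negative_index_le[where f = "\<lambda>t u. h10_fun (snd u) t" and Z = ?Z and I = Z and Q = Q, OF Z(1)])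
    show "linear (\<lambda>u. h10_fun (snd u) t)" for t
      by (rule linearI) (simp_all add: plus_h10.rep_eq plus_h1.rep_eq scaleR_h10.rep_eq scaleR_h1.rep_eq)
    fix u assume "u \<in> ?Z" and vz: "\<forall>t\<in>Z. h10_fun (snd u) t = 0"
    then obtain v where u: "u = (0, v)" by auto
    have "0 \<le> (LBINT t:{0..1}. (h10_deriv v t)\<^sup>2 + q t * (h10_fun v t)\<^sup>2)"
      by (rule jacobi_nonneg[OF \<theta> q _ h1_deriv])
        (use Z(1) vz u h10_h1[of v] in \<open>auto simp: Z_def\<close>)
    then show "Q u \<ge> 0" unfolding u Q using b by simp
  qed
  obtain M where M: "M \<subseteq> N" "finite M" "card M = card Z"
    using dirichlet_eigenvalues_exist[OF q w wpos \<theta> Z(2)] unfolding N_def by blast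
  have "finite N"
  proof (rule finite_if_finite_subsets_card_bdd[THEN conjunct1])
    show "card M \<le> card Z" if "M \<subseteq> N" "finite M" for M
      using order_trans[OF lower[OF that(2,1)] upper] by simp
  qed
  moreover have "card N = card Z"
    using order_trans[OF lower[OF \<open>finite N\<close> order_refl] upper] card_mono[OF \<open>finite N\<close> M(1)] M(3) by simp
  ultimately show ?thesis
    using lower[OF \<open>finite N\<close> order_refl] upper by simp
qed

section \<open>Evaluation and kinetic form on the path space\<close>

definition deriv_inner :: "h1 \<Rightarrow> h1 \<Rightarrow> real"
  where "deriv_inner u v = (LBINT t:{0..1}. h1_deriv u t * h1_deriv v t)"

lemma deriv_inner_nonneg: "0 \<le> deriv_inner u u"
  unfolding deriv_inner_def set_lebesgue_integral_def by (intro Bochner_Integration.integral_nonneg) auto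

lemma h1_norm_sq: "(norm u)\<^sup>2 = (LBINT t:{0..1}. h1_fun u t * h1_fun u t) + deriv_inner u u"
  by (simp only: power2_norm_eq_inner inner_h1_def deriv_inner_def)

lemma h1_increment_sq:
  assumes "s \<in> {0..1}" "t \<in> {0..1}"
  shows "(h1_fun u t - h1_fun u s)\<^sup>2 \<le> \<bar>t - s\<bar> * deriv_inner u u"
proof -
  have d2: "set_integrable lborel {0..1} (\<lambda>t. (h1_deriv u t)\<^sup>2)"
    using h1_deriv[of u] by (simp add: has_L2_deriv_def)
  have *: "(h1_fun u t - h1_fun u s)\<^sup>2 \<le> \<bar>t - s\<bar> * deriv_inner u u" if "s \<le> t" "0 \<le> s" "t \<le> 1" for s t
  proof -
    have si: "set_integrable lborel {s..t} (\<lambda>t. (h1_deriv u t)\<^sup>2)"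
      by (rule set_integrable_subset[OF d2]) (use that in auto)
    have "(h1_fun u t - h1_fun u s)\<^sup>2 \<le> (t - s) * (LBINT t:{s..t}. (h1_deriv u t)\<^sup>2)"
      by (rule primitive_on_increment_sq[OF primitive_on_subinterval[OF primitive_on_has_L2_deriv[OF h1_deriv]] si])
        (use that in auto)
    also have "\<dots> \<le> (t - s) * deriv_inner u u"
    proof (rule mult_left_mono)
      show "(LBINT t:{s..t}. (h1_deriv u t)\<^sup>2) \<le> deriv_inner u u"
        unfolding deriv_inner_def set_lebesgue_integral_def power2_eq_square
        by (intro integral_mono si[unfolded set_integrable_def power2_eq_square] d2[unfolded set_integrable_def power2_eq_square])
          (use that in \<open>auto simp: indicator_def\<close>)
    qed (use that in simp)
    finally show ?thesis using that by simp
  qed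
  show ?thesis
    using *[of s t] *[of t s] assms by (cases "s \<le> t") (auto simp: power2_commute abs_minus_commute)
qed

lemma h1_increment_sq_norm:
  assumes "s \<in> {0..1}" "t \<in> {0..1}"
  shows "(h1_fun u t - h1_fun u s)\<^sup>2 \<le> \<bar>t - s\<bar> * (norm u)\<^sup>2"
proof -
  have "0 \<le> (LBINT t:{0..1}. h1_fun u t * h1_fun u t)"
    unfolding set_lebesgue_integral_def by (intro Bochner_Integration.integral_nonneg) auto
  then have "\<bar>t - s\<bar> * deriv_inner u u \<le> \<bar>t - s\<bar> * (norm u)\<^sup>2"
    unfolding h1_norm_sq by (intro mult_left_mono) auto
  with h1_increment_sq[OF assms] show ?thesis by (rule order_trans)
qed

text \<open>At a point \<open>s\<close> where \<open>|u|\<close> is minimal, \<open>|u s|\<close> is at most the \<open>L\<^sup>2\<close> norm of \<open>u\<close>; the increment from \<open>s\<close> to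
  \<open>t\<close> is at most the \<open>L\<^sup>2\<close> norm of the derivative.\<close>
lemma h1_fun_bound: "\<bar>h1_fun u t\<bar> \<le> 2 * norm u"
proof (cases "t \<in> {0..1}")
  case True
  have "\<exists>s\<in>{0..1}. \<forall>x\<in>{0..1}. \<bar>h1_fun u s\<bar> \<le> \<bar>h1_fun u x\<bar>"
    by (rule continuous_attains_inf)
      (auto intro: continuous_on_rabs has_L2_deriv_continuous[OF h1_deriv])
  then obtain s where s: "s \<in> {0..1}" "\<And>x. x \<in> {0..1} \<Longrightarrow> \<bar>h1_fun u s\<bar> \<le> \<bar>h1_fun u x\<bar>"
    by blast
  have "(h1_fun u s)\<^sup>2 = (LBINT x:{0..1::real}. (h1_fun u s)\<^sup>2)"
    by (simp add: set_lebesgue_integral_def)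
  also have "\<dots> \<le> (LBINT x:{0..1}. h1_fun u x * h1_fun u x)"
    unfolding set_lebesgue_integral_def
  proof (rule integral_mono)
    show "integrable lborel (\<lambda>x. indicat_real {0..1::real} x *\<^sub>R (h1_fun u s)\<^sup>2)"
      using borel_integrable_compact[of "{0..1::real}" "\<lambda>_. (h1_fun u s)\<^sup>2"] by simp
    show "integrable lborel (\<lambda>x. indicat_real {0..1} x *\<^sub>R (h1_fun u x * h1_fun u x))"
      using h1_fun_mult_integrable by (simp add: set_integrable_def)
    show "indicat_real {0..1} x *\<^sub>R (h1_fun u s)\<^sup>2 \<le> indicat_real {0..1} x *\<^sub>R (h1_fun u x * h1_fun u x)" for x
      using s(2)[of x] by (auto simp: indicator_def abs_le_square_iff power2_eq_square)
  qed
  also have "\<dots> \<le> (norm u)\<^sup>2" unfolding h1_norm_sq using deriv_inner_nonneg[of u] by simp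
  finally have 1: "\<bar>h1_fun u s\<bar> \<le> norm u" using abs_le_square_iff[of "h1_fun u s" "norm u"] by simp
  have "(h1_fun u t - h1_fun u s)\<^sup>2 \<le> \<bar>t - s\<bar> * (norm u)\<^sup>2" by (rule h1_increment_sq_norm[OF s(1) True])
  also have "\<dots> \<le> 1 * (norm u)\<^sup>2" using True s(1) by (intro mult_right_mono) auto
  finally have "\<bar>h1_fun u t - h1_fun u s\<bar> \<le> norm u"
    using abs_le_square_iff[of "h1_fun u t - h1_fun u s" "norm u"] by simp
  with 1 show ?thesis by linarith
next
  case False
  then have "h1_fun u t = 0" using h1_fun[of u] by blast
  then show ?thesis by simp
qed

lemma bounded_linear_h1_fun: "bounded_linear (\<lambda>u. h1_fun u t)"
  by (rule bounded_linear_intro[where K = 2])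
    (use h1_fun_bound[of _ t] in \<open>auto simp: plus_h1.rep_eq scaleR_h1.rep_eq mult.commute\<close>)

lemma bounded_linear_h10_h1: "bounded_linear h10_h1"
  by (rule bounded_linear_intro[where K = 1])
    (auto simp: plus_h10.rep_eq scaleR_h10.rep_eq norm_h10.rep_eq)

definition point_eval :: "real \<Rightarrow> path_space \<Rightarrow>\<^sub>L (real \<times> real)"
  where "point_eval t = Blinfun (\<lambda>\<gamma>. (h1_fun (fst \<gamma>) t, h10_fun (snd \<gamma>) t))"

lemma point_eval_apply: "blinfun_apply (point_eval t) \<gamma> = (h1_fun (fst \<gamma>) t, h10_fun (snd \<gamma>) t)"
proof -
  have "bounded_linear (\<lambda>\<gamma>::path_space. (h1_fun (fst \<gamma>) t, h10_fun (snd \<gamma>) t))"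
    by (intro bounded_linear_Pair bounded_linear_compose[OF bounded_linear_h1_fun]
        bounded_linear_compose[OF bounded_linear_h10_h1] bounded_linear_fst bounded_linear_snd)
  then show ?thesis unfolding point_eval_def by (simp add: bounded_linear_Blinfun_apply)
qed

abbreviation path_at :: "real \<Rightarrow> path_space \<Rightarrow> real \<times> real"
  where "path_at t \<equiv> blinfun_apply (point_eval t)"

text \<open>Hoelder continuity in operator norm, with exponent one half. It fails on the space of continuous
  paths and is what lets \<open>has_derivative_integral\<close> apply.\<close>
lemma continuous_on_point_eval: "continuous_on {0..1} point_eval"
proof (rule continuous_onI)
  fix s e :: real assume s: "s \<in> {0..1}" and e: "e > 0"
  have "dist (point_eval t) (point_eval s) \<le> e" if t: "t \<in> {0..1}" "dist t s < (e / 2)\<^sup>2" for t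
    unfolding dist_norm
  proof (rule norm_blinfun_bound)
    fix \<gamma> :: path_space
    have b: "\<bar>h1_fun u t - h1_fun u s\<bar> \<le> e / 2 * norm u" for u
    proof -
      have "(h1_fun u t - h1_fun u s)\<^sup>2 \<le> \<bar>t - s\<bar> * (norm u)\<^sup>2" by (rule h1_increment_sq_norm[OF s t(1)])
      also have "\<dots> \<le> (e / 2)\<^sup>2 * (norm u)\<^sup>2" using t(2) by (intro mult_right_mono) (auto simp: dist_real_def)
      also have "\<dots> = (e / 2 * norm u)\<^sup>2" by (simp only: power_mult_distrib)
      finally show ?thesis using e by (simp add: abs_le_square_iff[symmetric] abs_mult)
    qed
    have "norm (blinfun_apply (point_eval t - point_eval s) \<gamma>)
        = norm (h1_fun (fst \<gamma>) t - h1_fun (fst \<gamma>) s, h10_fun (snd \<gamma>) t - h10_fun (snd \<gamma>) s)"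
      by (simp add: minus_blinfun.rep_eq point_eval_apply)
    also have "\<dots> \<le> \<bar>h1_fun (fst \<gamma>) t - h1_fun (fst \<gamma>) s\<bar> + \<bar>h10_fun (snd \<gamma>) t - h10_fun (snd \<gamma>) s\<bar>"
      using norm_Pair_le[of "h1_fun (fst \<gamma>) t - h1_fun (fst \<gamma>) s" "h10_fun (snd \<gamma>) t - h10_fun (snd \<gamma>) s"] by simp
    also have "\<dots> \<le> e / 2 * norm (fst \<gamma>) + e / 2 * norm (snd \<gamma>)"
      using b[of "fst \<gamma>"] b[of "h10_h1 (snd \<gamma>)"] by (simp add: norm_h10.rep_eq)
    also have "\<dots> \<le> e / 2 * norm \<gamma> + e / 2 * norm \<gamma>"
      using e norm_fst_le[of "fst \<gamma>" "snd \<gamma>"] norm_snd_le[of "snd \<gamma>" "fst \<gamma>"] by (intro add_mono mult_left_mono) auto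
    also have "\<dots> = e * norm \<gamma>" by (simp add: field_simps)
    finally show "norm (blinfun_apply (point_eval t - point_eval s) \<gamma>) \<le> e * norm \<gamma>" .
  qed (use e in simp)
  then show "\<exists>d>0. \<forall>t\<in>{0..1}. dist t s < d \<longrightarrow> dist (point_eval t) (point_eval s) \<le> e"
    using e by (intro exI[of _ "(e / 2)\<^sup>2"]) auto
qed

text \<open>The representative \<open>h1_deriv\<close> is linear only almost everywhere, so linearity is taken from the inner
  product of \<open>H\<^sup>1\<close>, of which this form is the part left after removing the \<open>L\<^sup>2\<close> product.\<close>
lemma bounded_bilinear_deriv_inner: "bounded_bilinear deriv_inner"
proof -
  define m where "m = (\<lambda>u v. LBINT t:{0..1}. h1_fun u t * h1_fun v t)"
  have D: "deriv_inner u v = inner u v - m u v" for u v by (simp add: deriv_inner_def inner_h1_def m_def)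
  have msym: "m u v = m v u" for u v by (simp add: m_def mult.commute)
  have madd: "m (u + u') v = m u v + m u' v" for u u' v
    unfolding m_def plus_h1.rep_eq distrib_right
    by (rule set_integral_add(2)[OF h1_fun_mult_integrable h1_fun_mult_integrable])
  have mscale: "m (r *\<^sub>R u) v = r * m u v" for r u v
    unfolding m_def scaleR_h1.rep_eq mult.assoc by simp
  have mb: "\<bar>m u v\<bar> \<le> 4 * (norm u * norm v)" for u v
  proof -
    have "\<bar>m u v\<bar> = norm (LBINT t:{0..1}. h1_fun u t * h1_fun v t)" by (simp add: m_def)
    also have "\<dots> \<le> (LBINT t:{0..1}. norm (h1_fun u t * h1_fun v t))"
      by (rule set_integral_norm_bound[OF h1_fun_mult_integrable])
    also have "\<dots> \<le> (LBINT t:{0..1::real}. (2 * norm u) * (2 * norm v))"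
      unfolding set_lebesgue_integral_def
    proof (rule integral_mono)
      show "integrable lborel (\<lambda>x. indicat_real {0..1} x *\<^sub>R norm (h1_fun u x * h1_fun v x))"
        using set_integrable_norm[OF h1_fun_mult_integrable[of u v]] by (simp add: set_integrable_def)
      show "integrable lborel (\<lambda>x. indicat_real {0..1::real} x *\<^sub>R ((2 * norm u) * (2 * norm v)))"
        using borel_integrable_compact[of "{0..1::real}" "\<lambda>_. (2 * norm u) * (2 * norm v)"] by simp
      show "indicat_real {0..1} x *\<^sub>R norm (h1_fun u x * h1_fun v x) \<le> indicat_real {0..1} x *\<^sub>R ((2 * norm u) * (2 * norm v))" for x
      proof (rule scaleR_left_mono)
        show "norm (h1_fun u x * h1_fun v x) \<le> (2 * norm u) * (2 * norm v)"
          unfolding real_norm_def abs_mult by (intro mult_mono h1_fun_bound) auto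
      qed simp
    qed
    finally show ?thesis by (simp add: set_lebesgue_integral_def)
  qed
  show ?thesis
  proof
    fix u u' v v' :: h1 and r :: real
    show "deriv_inner (u + u') v = deriv_inner u v + deriv_inner u' v" by (simp add: D inner_add_left madd)
    show "deriv_inner u (v + v') = deriv_inner u v + deriv_inner u v'"
      using madd[of v v' u] by (simp add: D inner_add_right msym[of u])
    show "deriv_inner (r *\<^sub>R u) v = r *\<^sub>R deriv_inner u v" by (simp add: D mscale right_diff_distrib)
    show "deriv_inner u (r *\<^sub>R v) = r *\<^sub>R deriv_inner u v"
      using mscale[of r v u] by (simp add: D msym[of u] right_diff_distrib)
    show "\<exists>K. \<forall>a b. norm (deriv_inner a b) \<le> norm a * norm b * K"
    proof (intro exI allI)
      fix a b show "norm (deriv_inner a b) \<le> norm a * norm b * 5"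
        using mb[of a b] Cauchy_Schwarz_ineq2[of a b] unfolding D real_norm_def by linarith
    qed
  qed
qed

definition kinetic :: "path_space \<Rightarrow> path_space \<Rightarrow> real"
  where "kinetic \<gamma> \<eta> = deriv_inner (fst \<gamma>) (fst \<eta>) + deriv_inner (h10_h1 (snd \<gamma>)) (h10_h1 (snd \<eta>))"

lemma bounded_bilinear_kinetic: "bounded_bilinear kinetic"
proof -
  interpret d: bounded_bilinear deriv_inner by (rule bounded_bilinear_deriv_inner)
  have 1: "bounded_bilinear (\<lambda>(\<gamma>::path_space) (\<eta>::path_space). deriv_inner (fst \<gamma>) (fst \<eta>))"
    by (rule d.comp[OF bounded_linear_fst bounded_linear_fst])
  have b: "bounded_linear (\<lambda>\<gamma>::path_space. h10_h1 (snd \<gamma>))"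
    by (rule bounded_linear_compose[OF bounded_linear_h10_h1 bounded_linear_snd])
  have 2: "bounded_bilinear (\<lambda>(\<gamma>::path_space) (\<eta>::path_space). deriv_inner (h10_h1 (snd \<gamma>)) (h10_h1 (snd \<eta>)))"
    using d.comp[OF b b] .
  from bounded_bilinear.pos_bounded[OF 1] bounded_bilinear.pos_bounded[OF 2]
  obtain K L where K: "\<And>(a :: path_space) (b :: path_space). norm (deriv_inner (fst a) (fst b)) \<le> norm a * norm b * K"
    and L: "\<And>(a :: path_space) (b :: path_space). norm (deriv_inner (h10_h1 (snd a)) (h10_h1 (snd b))) \<le> norm a * norm b * L"
    by blast
  show ?thesis
  proof
    show "\<exists>K. \<forall>a b. norm (kinetic a b) \<le> norm a * norm b * K"
    proof (intro exI allI)
      fix a b show "norm (kinetic a b) \<le> norm a * norm b * (K + L)"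
        using K[of a b] L[of a b] unfolding kinetic_def distrib_left real_norm_def by linarith
    qed
  qed (simp_all add: kinetic_def bounded_bilinear.add_left[OF 1] bounded_bilinear.add_left[OF 2]
      bounded_bilinear.add_right[OF 1] bounded_bilinear.add_right[OF 2]
      bounded_bilinear.scaleR_left[OF 1] bounded_bilinear.scaleR_left[OF 2]
      bounded_bilinear.scaleR_right[OF 1] bounded_bilinear.scaleR_right[OF 2] distrib_left
      d.add_left d.add_right d.scaleR_left d.scaleR_right plus_h10.rep_eq scaleR_h10.rep_eq)
qed

lemma kinetic_sym: "kinetic \<gamma> \<eta> = kinetic \<eta> \<gamma>"
  by (simp add: kinetic_def deriv_inner_def mult.commute)

lemma A_fun_kinetic: "A_fun \<gamma> = kinetic \<gamma> \<gamma>"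
proof -
  obtain r z where [simp]: "\<gamma> = (r, z)" by force
  have "A_fun \<gamma> = (LBINT t:{0..1}. h1_deriv r t * h1_deriv r t + h10_deriv z t * h10_deriv z t)"
    by (simp add: A_fun_def power2_eq_square)
  also have "\<dots> = kinetic \<gamma> \<gamma>"
    using set_integral_add(2)[OF h1_deriv_mult_integrable[of r r] h1_deriv_mult_integrable[of "h10_h1 z" "h10_h1 z"]]
    by (simp add: kinetic_def deriv_inner_def)
  finally show ?thesis .
qed

section \<open>Second derivatives of the functional\<close>

text \<open>Differentiation under the integral for a parameter in a normed space that need not be complete, as
  \<open>H\<^sup>1\<close> is given here only as an inner product space. By compactness of \<open>[0,1]\<close> the derivative varies by at
  most \<open>e\<close>, uniformly in \<open>t\<close>, on a ball around \<open>x0\<close>.\<close>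
lemma has_derivative_integral:
  fixes F :: "'a::real_normed_vector \<Rightarrow> real \<Rightarrow> 'b::banach"
  assumes U: "open U" "convex U" "x0 \<in> U"
    and d: "\<And>x t. x \<in> U \<Longrightarrow> t \<in> {0..1} \<Longrightarrow> ((\<lambda>x. F x t) has_derivative blinfun_apply (F' x t)) (at x)"
    and cF: "\<And>x. x \<in> U \<Longrightarrow> continuous_on {0..1} (F x)"
    and cF': "continuous_on (U \<times> {0..1}) (\<lambda>(x, t). F' x t)"
  shows "((\<lambda>x. integral {0..1} (F x)) has_derivative blinfun_apply (integral {0..1} (F' x0))) (at x0)"
  unfolding has_derivative_at_alt
proof (intro conjI allI impI blinfun.bounded_linear_right)
  fix e :: real assume "e > 0"
  obtain X where X: "x0 \<in> X" "open X"
    and X': "\<forall>x\<in>X \<inter> U. \<forall>t\<in>{0..1}. dist (case (x, t) of (x, t) \<Rightarrow> F' x t) (case (x0, t) of (x, t) \<Rightarrow> F' x t) \<le> e"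
    by (rule continuous_on_prod_compactE[OF cF' compact_Icc U(3) \<open>e > 0\<close>])
  have XF': "dist (F' x t) (F' x0 t) \<le> e" if "x \<in> X \<inter> U" "t \<in> {0..1}" for x t
    using X' that by simp
  obtain r where r: "r > 0" "ball x0 r \<subseteq> X \<inter> U"
    using openE[OF open_Int[OF X(2) U(1)], of x0] X(1) U(3) by auto
  have cF'x: "continuous_on {0..1} (F' x0)"
  proof -
    have "continuous_on {0..1} (\<lambda>t::real. (x0, t))" by (intro continuous_intros)
    from continuous_on_compose2[OF cF' this] U(3) show ?thesis by auto
  qed
  have "norm (integral {0..1} (F y) - integral {0..1} (F x0) - blinfun_apply (integral {0..1} (F' x0)) (y - x0))
      \<le> e * norm (y - x0)" if y: "norm (y - x0) < r" for y
  proof -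
    have yb: "y \<in> ball x0 r" "x0 \<in> ball x0 r" using y r(1) by (auto simp: dist_norm norm_minus_commute)
    then have yU: "y \<in> U" using r by auto
    note ii = integrable_continuous_real[OF cF[OF yU]] integrable_continuous_real[OF cF[OF U(3)]]
      integrable_continuous_real[OF cF'x]
    have ib: "(\<lambda>t. blinfun_apply (F' x0 t) (y - x0)) integrable_on {0..1}"
      by (intro integrable_continuous_real continuous_intros cF'x)
    have "integral {0..1} (F y) - integral {0..1} (F x0) - blinfun_apply (integral {0..1} (F' x0)) (y - x0)
        = integral {0..1} (\<lambda>t. F y t - F x0 t - blinfun_apply (F' x0 t) (y - x0))"
      unfolding blinfun_apply_integral[OF ii(3)]
      by (simp add: integral_diff ii ib integrable_diff)
    also have "norm \<dots> \<le> integral {0..1} (\<lambda>t::real. e * norm (y - x0))"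
    proof (rule Henstock_Kurzweil_Integration.integral_norm_bound_integral)
      show "(\<lambda>t. F y t - F x0 t - blinfun_apply (F' x0 t) (y - x0)) integrable_on {0..1}"
        by (intro integrable_diff ii ib)
      fix t :: real assume t: "t \<in> {0..1}"
      have "norm (F y t - F x0 t - blinfun_apply (F' x0 t) (y - x0)) \<le> norm (y - x0) * e"
      proof (rule differentiable_bound_linearization[where S = "ball x0 r" and f = "\<lambda>x. F x t" and f' = "\<lambda>x. blinfun_apply (F' x t)"])
        show "x0 + s *\<^sub>R (y - x0) \<in> ball x0 r" if "s \<in> {0..1}" for s
        proof -
          have "closed_segment x0 y \<subseteq> ball x0 r" by (rule closed_segment_subset[OF yb(2,1) convex_ball])
          moreover have "x0 + s *\<^sub>R (y - x0) \<in> closed_segment x0 y"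
            using that by (auto simp: closed_segment_def algebra_simps intro!: exI[of _ s])
          ultimately show ?thesis by blast
        qed
        show "((\<lambda>x. F x t) has_derivative blinfun_apply (F' x t)) (at x within ball x0 r)" if "x \<in> ball x0 r" for x
          by (rule has_derivative_at_withinI[OF d]) (use that r t in auto)
        show "onorm (blinfun_apply (F' x t) - blinfun_apply (F' x0 t)) \<le> e" if "x \<in> ball x0 r" for x
        proof -
          have "x \<in> X \<inter> U" using that r(2) by blast
          from XF'[OF this t] have "norm (F' x t - F' x0 t) \<le> e" by (simp add: dist_norm)
          then show ?thesis by (simp add: norm_blinfun.rep_eq minus_blinfun.rep_eq fun_diff_def)
        qed
      qed (rule yb)
      then show "norm (F y t - F x0 t - blinfun_apply (F' x0 t) (y - x0)) \<le> e * norm (y - x0)"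
        by (simp add: mult.commute)
    qed (rule integrable_const_ivl)
    also have "\<dots> = e * norm (y - x0)" by simp
    finally show ?thesis .
  qed
  then show "\<exists>d>0. \<forall>y. norm (y - x0) < d \<longrightarrow> norm (integral {0..1} (F y) - integral {0..1} (F x0) - blinfun_apply (integral {0..1} (F' x0)) (y - x0)) \<le> e * norm (y - x0)"
    using r(1) by blast
qed

definition potential_action :: "(real \<times> real \<Rightarrow> real) \<Rightarrow> path_space \<Rightarrow> real"
  where "potential_action G \<gamma> = integral {0..1} (\<lambda>t. G (path_at t \<gamma>))"

definition potential_gradient :: "(real \<times> real \<Rightarrow> (real \<times> real) \<Rightarrow>\<^sub>L real) \<Rightarrow> path_space \<Rightarrow> path_space \<Rightarrow>\<^sub>L real"
  where "potential_gradient G' \<gamma> = integral {0..1} (\<lambda>t. G' (path_at t \<gamma>) o\<^sub>L point_eval t)"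

text \<open>The path stays at positive distance from the complement of \<open>S\<close>, and evaluation is bounded uniformly
  in \<open>t\<close>.\<close>
lemma path_tube:
  assumes S: "open S" and \<gamma>: "\<And>t. t \<in> {0..1} \<Longrightarrow> path_at t \<gamma> \<in> S"
  shows "\<exists>r>0. \<forall>\<eta>\<in>ball \<gamma> r. \<forall>t\<in>{0..1}. path_at t \<eta> \<in> S"
proof -
  let ?K = "(\<lambda>t. path_at t \<gamma>) ` {0..1}"
  have "compact ?K"
    by (intro compact_continuous_image continuous_intros continuous_on_point_eval compact_Icc)
  then obtain e where e: "e > 0" "(\<Union>x\<in>?K. ball x e) \<subseteq> S"
    using compact_subset_open_imp_ball_epsilon_subset[of ?K S] S \<gamma> by blast
  obtain C where C: "C > 0" "\<And>t. t \<in> {0..1} \<Longrightarrow> norm (point_eval t) \<le> C"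
    using compact_imp_bounded[OF compact_continuous_image[OF continuous_on_point_eval compact_Icc]]
    unfolding bounded_pos by auto
  have "path_at t \<eta> \<in> S" if "\<eta> \<in> ball \<gamma> (e / C)" "t \<in> {0..1}" for \<eta> t
  proof -
    have "dist (path_at t \<gamma>) (path_at t \<eta>)
        = norm (path_at t (\<gamma> - \<eta>))"
      by (simp add: dist_norm blinfun.bilinear_simps)
    also have "\<dots> \<le> norm (point_eval t) * norm (\<gamma> - \<eta>)" by (rule norm_blinfun)
    also have "\<dots> \<le> C * norm (\<gamma> - \<eta>)" by (rule mult_right_mono[OF C(2)[OF that(2)]]) simp
    also have "\<dots> < e" using that(1) C(1) by (simp add: dist_norm field_simps)
    finally have "path_at t \<eta> \<in> ball (path_at t \<gamma>) e" by simp
    then show ?thesis using e(2) that(2) by blast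
  qed
  then show ?thesis using e(1) C(1) by (intro exI[of _ "e / C"]) auto
qed

lemma continuous_on_eval_pair:
  "continuous_on (U \<times> {0..1}) (\<lambda>(\<gamma>, t). path_at t \<gamma>)"
  unfolding case_prod_beta
  by (intro continuous_intros continuous_on_compose2[OF continuous_on_point_eval]) auto

lemma potential_action_has_derivative:
  assumes U: "open U" "convex U" "\<gamma> \<in> U"
    and US: "\<And>\<eta> t. \<eta> \<in> U \<Longrightarrow> t \<in> {0..1} \<Longrightarrow> path_at t \<eta> \<in> S"
    and G: "\<And>p. p \<in> S \<Longrightarrow> (G has_derivative blinfun_apply (G' p)) (at p)"
    and cG': "continuous_on S G'"
  shows "(potential_action G has_derivative blinfun_apply (potential_gradient G' \<gamma>)) (at \<gamma>)"
  unfolding potential_action_def[abs_def] potential_gradient_def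
proof (rule has_derivative_integral[OF U])
  fix \<eta> assume \<eta>: "\<eta> \<in> U"
  have cG: "continuous_on S G"
    by (rule continuous_at_imp_continuous_on) (use G has_derivative_continuous in blast)
  show "continuous_on {0..1} (\<lambda>t. G (path_at t \<eta>))"
    by (rule continuous_on_compose2[OF cG]) (auto intro!: continuous_intros continuous_on_point_eval US \<eta>)
  fix t :: real assume t: "t \<in> {0..1}"
  have "((\<lambda>\<eta>. path_at t \<eta>) has_derivative path_at t) (at \<eta>)"
    by (rule bounded_linear_imp_has_derivative[OF blinfun.bounded_linear_right])
  from has_derivative_compose[OF this G[OF US[OF \<eta> t]]]
  show "((\<lambda>\<eta>. G (path_at t \<eta>)) has_derivative
      blinfun_apply (G' (path_at t \<eta>) o\<^sub>L point_eval t)) (at \<eta>)"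
    by (simp add: blinfun_compose.rep_eq comp_def)
next
  have "continuous_on (U \<times> {0..1}) (\<lambda>p. G' (blinfun_apply (point_eval (snd p)) (fst p)))"
    by (rule continuous_on_compose2[OF cG' continuous_on_eval_pair[unfolded case_prod_beta]], rule image_subsetI, rule US) auto
  moreover have "continuous_on (U \<times> {0..1}) (\<lambda>p. point_eval (snd p))"
    by (rule continuous_on_compose2[OF continuous_on_point_eval]) (auto intro!: continuous_intros)
  ultimately show "continuous_on (U \<times> {0..1}) (\<lambda>(\<gamma>, t). G' (path_at t \<gamma>) o\<^sub>L point_eval t)"
    unfolding case_prod_beta by (rule bounded_bilinear.continuous_on[OF bounded_bilinear_blinfun_compose])
qed

text \<open>Second derivatives of \<open>G\<close> along a path take values in functionals on the plane; this operator
  pulls them back to functionals on the path space.\<close>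
definition precompose :: "(path_space \<Rightarrow>\<^sub>L (real \<times> real)) \<Rightarrow> ((real \<times> real) \<Rightarrow>\<^sub>L real) \<Rightarrow>\<^sub>L (path_space \<Rightarrow>\<^sub>L real)"
  where "precompose = bounded_bilinear.prod_left (o\<^sub>L)"

lemma precompose_apply: "blinfun_apply (precompose E) A = A o\<^sub>L E"
  unfolding precompose_def by (simp add: bounded_bilinear.prod_left.rep_eq[OF bounded_bilinear_blinfun_compose])

lemma bounded_linear_precompose: "bounded_linear precompose"
  unfolding precompose_def by (rule bounded_bilinear.bounded_linear_prod_left[OF bounded_bilinear_blinfun_compose])

lemma potential_gradient_has_derivative:
  assumes U: "open U" "convex U" "\<gamma> \<in> U"
    and US: "\<And>\<eta> t. \<eta> \<in> U \<Longrightarrow> t \<in> {0..1} \<Longrightarrow> path_at t \<eta> \<in> S"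
    and G': "\<And>p. p \<in> S \<Longrightarrow> (G' has_derivative blinfun_apply (G'' p)) (at p)"
    and cG'': "continuous_on S G''"
  shows "(potential_gradient G' has_derivative blinfun_apply (integral {0..1}
      (\<lambda>t. precompose (point_eval t) o\<^sub>L (G'' (path_at t \<gamma>) o\<^sub>L point_eval t)))) (at \<gamma>)"
  unfolding potential_gradient_def[abs_def]
proof (rule has_derivative_integral[OF U])
  fix \<eta> assume \<eta>: "\<eta> \<in> U"
  have cG': "continuous_on S G'"
    by (rule continuous_at_imp_continuous_on) (use G' has_derivative_continuous in blast)
  have "continuous_on {0..1} (\<lambda>t. G' (path_at t \<eta>))"
    by (rule continuous_on_compose2[OF cG']) (auto intro!: continuous_intros continuous_on_point_eval US \<eta>)
  then show "continuous_on {0..1} (\<lambda>t. G' (path_at t \<eta>) o\<^sub>L point_eval t)"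
    by (rule bounded_bilinear.continuous_on[OF bounded_bilinear_blinfun_compose _ continuous_on_point_eval])
  fix t :: real assume t: "t \<in> {0..1}"
  have "((\<lambda>\<eta>. path_at t \<eta>) has_derivative path_at t) (at \<eta>)"
    by (rule bounded_linear_imp_has_derivative[OF blinfun.bounded_linear_right])
  from has_derivative_compose[OF this G'[OF US[OF \<eta> t]]]
  have "((\<lambda>\<eta>. G' (path_at t \<eta>)) has_derivative
      (\<lambda>x. blinfun_apply (G'' (path_at t \<eta>)) (path_at t x))) (at \<eta>)" .
  from has_derivative_compose[OF this bounded_linear_imp_has_derivative[OF blinfun.bounded_linear_right[of "precompose (point_eval t)"]]]
  show "((\<lambda>\<eta>. G' (path_at t \<eta>) o\<^sub>L point_eval t) has_derivative
      blinfun_apply (precompose (point_eval t) o\<^sub>L (G'' (path_at t \<eta>) o\<^sub>L point_eval t))) (at \<eta>)"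
    by (simp add: blinfun_compose.rep_eq comp_def precompose_apply)
next
  have 1: "continuous_on (U \<times> {0..1}) (\<lambda>p. G'' (blinfun_apply (point_eval (snd p)) (fst p)))"
    by (rule continuous_on_compose2[OF cG'' continuous_on_eval_pair[unfolded case_prod_beta]], rule image_subsetI, rule US) auto
  have 2: "continuous_on (U \<times> {0..1}) (\<lambda>p. point_eval (snd p))"
    by (rule continuous_on_compose2[OF continuous_on_point_eval]) (auto intro!: continuous_intros)
  have 3: "continuous_on (U \<times> {0..1}) (\<lambda>p. precompose (point_eval (snd p)))"
    by (rule bounded_linear.continuous_on[OF bounded_linear_precompose 2])
  show "continuous_on (U \<times> {0..1}) (\<lambda>(\<gamma>, t). precompose (point_eval t) o\<^sub>L (G'' (path_at t \<gamma>) o\<^sub>L point_eval t))"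
    unfolding case_prod_beta
    by (intro bounded_bilinear.continuous_on[OF bounded_bilinear_blinfun_compose] 1 2 3)
qed

text \<open>The functional \<open>I_hat\<close> for a general potential \<open>G\<close>: it is used with \<open>\<phi> \<circ> V\<close> to locate the critical point
  and with \<open>V\<close> itself to compute the second derivative.\<close>
definition maupertuis :: "(real \<times> real \<Rightarrow> real) \<Rightarrow> real \<Rightarrow> path_space \<Rightarrow> real"
  where "maupertuis G h \<gamma> = 1 / 2 * kinetic \<gamma> \<gamma> * (h - potential_action G \<gamma>)"

definition kinetic_gradient :: "path_space \<Rightarrow> path_space \<Rightarrow>\<^sub>L real"
  where "kinetic_gradient = bounded_bilinear.prod_right kinetic"

lemma kinetic_gradient_apply: "blinfun_apply (kinetic_gradient \<gamma>) \<eta> = kinetic \<gamma> \<eta>"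
  unfolding kinetic_gradient_def by (simp add: bounded_bilinear.prod_right.rep_eq[OF bounded_bilinear_kinetic])

lemma bounded_linear_kinetic_gradient: "bounded_linear kinetic_gradient"
  unfolding kinetic_gradient_def by (rule bounded_bilinear.bounded_linear_prod_right[OF bounded_bilinear_kinetic])

definition maupertuis_gradient :: "(real \<times> real \<Rightarrow> real) \<Rightarrow> (real \<times> real \<Rightarrow> (real \<times> real) \<Rightarrow>\<^sub>L real) \<Rightarrow> real \<Rightarrow> path_space \<Rightarrow> path_space \<Rightarrow>\<^sub>L real"
  where "maupertuis_gradient G G' h \<gamma> = (h - potential_action G \<gamma>) *\<^sub>R kinetic_gradient \<gamma>
    - (1 / 2 * kinetic \<gamma> \<gamma>) *\<^sub>R potential_gradient G' \<gamma>"

lemma kinetic_has_derivative: "((\<lambda>\<gamma>. kinetic \<gamma> \<gamma>) has_derivative (\<lambda>\<eta>. 2 * kinetic \<gamma> \<eta>)) (at \<gamma>)"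
proof -
  have "((\<lambda>\<gamma>. kinetic \<gamma> \<gamma>) has_derivative (\<lambda>\<eta>. kinetic \<gamma> \<eta> + kinetic \<eta> \<gamma>)) (at \<gamma>)"
    by (rule bounded_bilinear.FDERIV[OF bounded_bilinear_kinetic has_derivative_ident has_derivative_ident])
  then show ?thesis by (simp add: kinetic_sym[of _ \<gamma>])
qed

lemma maupertuis_has_derivative:
  assumes "(potential_action G has_derivative blinfun_apply (potential_gradient G' \<gamma>)) (at \<gamma>)"
  shows "(maupertuis G h has_derivative blinfun_apply (maupertuis_gradient G G' h \<gamma>)) (at \<gamma>)"
  unfolding maupertuis_def[abs_def]
  by (rule derivative_eq_intros kinetic_has_derivative assms refl)+
    (simp add: fun_eq_iff maupertuis_gradient_def blinfun.bilinear_simps kinetic_gradient_apply algebra_simps)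

text \<open>The hypothesis \<open>kinetic \<gamma> \<eta> = 0\<close> removes the two mixed terms of the product rule.\<close>
lemma maupertuis_gradient_has_derivative:
  assumes "(potential_action G has_derivative blinfun_apply (potential_gradient G' \<gamma>)) (at \<gamma>)"
    and "(potential_gradient G' has_derivative blinfun_apply D) (at \<gamma>)"
  shows "\<exists>L :: path_space \<Rightarrow>\<^sub>L path_space \<Rightarrow>\<^sub>L real. (maupertuis_gradient G G' h has_derivative blinfun_apply L) (at \<gamma>) \<and>
    (\<forall>\<eta>. kinetic \<gamma> \<eta> = 0 \<longrightarrow> blinfun_apply (blinfun_apply L \<eta>) \<eta> =
      (h - potential_action G \<gamma>) * kinetic \<eta> \<eta> - 1 / 2 * kinetic \<gamma> \<gamma> * blinfun_apply (blinfun_apply D \<eta>) \<eta>)"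
proof -
  have kg: "(kinetic_gradient has_derivative kinetic_gradient) (at \<gamma>)"
    by (rule bounded_linear_imp_has_derivative[OF bounded_linear_kinetic_gradient])
  let ?d = "\<lambda>\<eta>. ((h - potential_action G \<gamma>) *\<^sub>R kinetic_gradient \<eta> + (- blinfun_apply (potential_gradient G' \<gamma>) \<eta>) *\<^sub>R kinetic_gradient \<gamma>)
     - ((1 / 2 * kinetic \<gamma> \<gamma>) *\<^sub>R blinfun_apply D \<eta> + (kinetic \<gamma> \<eta>) *\<^sub>R potential_gradient G' \<gamma>)"
  have d: "(maupertuis_gradient G G' h has_derivative ?d) (at \<gamma>)"
    unfolding maupertuis_gradient_def[abs_def]
    by (rule derivative_eq_intros kinetic_has_derivative assms kg refl)+ simp
  then have b: "bounded_linear ?d" by (rule has_derivative_bounded_linear)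
  have L: "blinfun_apply (Blinfun ?d) = ?d" by (rule bounded_linear_Blinfun_apply[OF b])
  show ?thesis
  proof (intro exI[of _ "Blinfun ?d"] conjI allI impI)
    show "(maupertuis_gradient G G' h has_derivative blinfun_apply (Blinfun ?d)) (at \<gamma>)" unfolding L by (rule d)
    fix \<eta> assume "kinetic \<gamma> \<eta> = 0"
    then show "blinfun_apply (blinfun_apply (Blinfun ?d) \<eta>) \<eta> =
      (h - potential_action G \<gamma>) * kinetic \<eta> \<eta> - 1 / 2 * kinetic \<gamma> \<gamma> * blinfun_apply (blinfun_apply D \<eta>) \<eta>"
      unfolding L by (simp add: blinfun.bilinear_simps kinetic_gradient_apply)
  qed
qed

section \<open>The energy of a planar critical point\<close>

lemma integral_h1_deriv_C1:
  assumes C: "\<And>t. t \<in> {0..1} \<Longrightarrow> (h1_fun u has_real_derivative y' t) (at t within {0..1})"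
    and c: "continuous_on {0..1} y'"
    and k: "(\<lambda>t. indicator {0..1} t *\<^sub>R k t) \<in> borel_measurable borel"
  shows "(LBINT t:{0..1}. h1_deriv u t * k t) = (LBINT t:{0..1}. y' t * k t)"
  unfolding set_lebesgue_integral_def
proof (rule integral_cong_AE)
  have "(\<lambda>t. indicator {0..1} t *\<^sub>R y' t) \<in> borel_measurable borel"
    by (rule borel_measurable_continuous_on_indicator[OF _ c]) simp
  then have "(\<lambda>t. (indicator {0..1} t *\<^sub>R y' t) * (indicator {0..1} t *\<^sub>R k t)) \<in> borel_measurable lborel"
    using k by simp
  also have "(\<lambda>t. (indicator {0..1} t *\<^sub>R y' t) * (indicator {0..1} t *\<^sub>R k t)) = (\<lambda>t. indicator {0..1} t *\<^sub>R (y' t * k t))"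
    by (auto simp: indicator_def)
  finally show "(\<lambda>t. indicator {0..1} t *\<^sub>R (y' t * k t)) \<in> borel_measurable lborel" .
  have "(\<lambda>t. h1_deriv u t * (indicator {0..1} t *\<^sub>R k t)) \<in> borel_measurable lborel"
    using k by simp
  then show "(\<lambda>t. indicator {0..1} t *\<^sub>R (h1_deriv u t * k t)) \<in> borel_measurable lborel"
    by (simp add: mult.left_commute)
  have "AE t in lborel. t \<in> {0..1} \<longrightarrow> h1_deriv u t = y' t" by (rule h1_deriv_of_C1[OF C c])
  then show "AE t in lborel. indicat_real {0..1} t *\<^sub>R (h1_deriv u t * k t) = indicat_real {0..1} t *\<^sub>R (y' t * k t)"
    by eventually_elim (auto simp: indicator_def)
qed

lemma deriv_inner_C1_left:
  assumes C: "\<And>t. t \<in> {0..1} \<Longrightarrow> (h1_fun u has_real_derivative y' t) (at t within {0..1})"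
    and c: "continuous_on {0..1} y'"
  shows "deriv_inner u v = (LBINT t:{0..1}. y' t * h1_deriv v t)"
  unfolding deriv_inner_def by (rule integral_h1_deriv_C1[OF C c]) measurable

text \<open>Regularity with natural boundary conditions. Let \<open>F\<close> be the primitive of \<open>f\<close> and \<open>p\<close> that of \<open>F\<close>. The test
  function \<open>1\<close> yields \<open>c F(1) = 0\<close>; the test function \<open>u = r + c p\<close> then gives \<open>\<integral> u'\<^sup>2 = 0\<close> after one
  integration by parts, so \<open>r\<close> is a constant minus \<open>c p\<close>.\<close>
lemma du_bois_reymond:
  assumes f: "continuous_on {0..1} f"
    and weak: "\<And>u. deriv_inner r u = c * integral {0..1} (\<lambda>t. f t * h1_fun u t)"
  shows "\<exists>R. (\<forall>t\<in>{0..1}. (h1_fun r has_real_derivative R t) (at t within {0..1}) \<and>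
    (R has_real_derivative - (c * f t)) (at t within {0..1}))"
proof -
  interpret d: bounded_bilinear deriv_inner by (rule bounded_bilinear_deriv_inner)
  define F where "F = (\<lambda>t. integral {0..t} f)"
  have dF: "(F has_real_derivative f t) (at t within {0..1})" if "t \<in> {0..1}" for t
    unfolding F_def by (rule integral_has_real_derivative[OF f that])
  have cF: "continuous_on {0..1} F" by (rule DERIV_continuous_on[OF dF])
  define P where "P = (\<lambda>t. integral {0..t} F)"
  have dP: "(P has_real_derivative F t) (at t within {0..1})" if "t \<in> {0..1}" for t
    unfolding P_def by (rule integral_has_real_derivative[OF cF that])
  obtain p where p: "\<And>t. t \<in> {0..1} \<Longrightarrow> h1_fun p t = P t"
    using h1_of_C1[OF dP cF] by blast
  have dp: "(h1_fun p has_real_derivative F t) (at t within {0..1})" if "t \<in> {0..1}" for t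
    by (rule has_field_derivative_transform_within[OF dP[OF that] zero_less_one that]) (simp add: p)
  have "\<exists>u. \<forall>t\<in>{0..1}. h1_fun u t = 1" by (rule h1_of_C1[of "\<lambda>_. 1" "\<lambda>_. 0"]) auto
  then obtain e where e: "\<And>t. t \<in> {0..1} \<Longrightarrow> h1_fun e t = 1" by blast
  have de: "(h1_fun e has_real_derivative 0) (at t within {0..1})" if "t \<in> {0..1}" for t
    by (rule has_field_derivative_transform_within[OF DERIV_const[of 1] zero_less_one that]) (simp add: e)
  have "deriv_inner e r = 0"
  proof -
    have "deriv_inner e r = (LBINT t:{0..1}. 0 * h1_deriv r t)"
      by (rule deriv_inner_C1_left[OF de continuous_on_const])
    then show ?thesis by (simp add: set_lebesgue_integral_def)
  qed
  then have "c * integral {0..1} (\<lambda>t. f t * h1_fun e t) = 0"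
    unfolding weak[of e, symmetric] by (simp add: deriv_inner_def mult.commute)
  moreover have "integral {0..1} (\<lambda>t. f t * h1_fun e t) = F 1"
    unfolding F_def by (rule integral_cong) (simp add: e)
  ultimately have cF1: "c * F 1 = 0" by simp
  define u where "u = r + c *\<^sub>R p"
  have cu: "continuous_on {0..1} (h1_fun u)" by (rule has_L2_deriv_continuous[OF h1_deriv])
  have primF: "primitive_on 0 1 F f" by (rule primitive_on_C1[OF dF f])
  have primu: "primitive_on 0 1 (h1_fun u) (h1_deriv u)" by (rule primitive_on_has_L2_deriv[OF h1_deriv])
  have "deriv_inner r u = - c * deriv_inner p u"
  proof -
    have i1: "set_integrable lborel {0..1} (\<lambda>t. f t * h1_fun u t)"
      by (intro set_integrable_continuous continuous_intros f cu)
    have i2: "set_integrable lborel {0..1} (\<lambda>t. F t * h1_deriv u t)"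
      using set_integral_diff(1)[OF primitive_on_mult(1)[OF primF primu zero_le_one] i1] by simp
    have "(LBINT t:{0..1}. f t * h1_fun u t) + (LBINT t:{0..1}. F t * h1_deriv u t)
        = F 1 * h1_fun u 1 - F 0 * h1_fun u 0"
      using primitive_on_mult(2)[OF primF primu zero_le_one] set_integral_add(2)[OF i1 i2] by simp
    moreover have "(LBINT t:{0..1}. F t * h1_deriv u t) = deriv_inner p u"
      by (rule deriv_inner_C1_left[OF dp cF, symmetric])
    moreover have "(LBINT t:{0..1}. f t * h1_fun u t) = integral {0..1} (\<lambda>t. f t * h1_fun u t)"
      by (rule set_borel_integral_eq_integral(2)[OF i1])
    moreover have "F 0 = 0" by (simp add: F_def)
    ultimately have s: "integral {0..1} (\<lambda>t. f t * h1_fun u t) = F 1 * h1_fun u 1 - deriv_inner p u" by simp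
    have "deriv_inner r u = (c * F 1) * h1_fun u 1 - c * deriv_inner p u"
      unfolding weak s by (simp add: algebra_simps)
    then show ?thesis using cF1 by simp
  qed
  then have "deriv_inner u u = 0"
    by (subst (1) u_def) (simp add: d.add_left d.scaleR_left)
  then have uconst: "h1_fun u t = h1_fun u 0" if "t \<in> {0..1}" for t
    using h1_increment_sq[of 0 t u] that by simp
  have "(h1_fun r has_real_derivative - (c * F t)) (at t within {0..1})" if t: "t \<in> {0..1}" for t
  proof (rule has_field_derivative_transform_within[OF _ zero_less_one t])
    show "((\<lambda>t. h1_fun u 0 - c * P t) has_real_derivative - (c * F t)) (at t within {0..1})"
      using DERIV_diff[OF DERIV_const DERIV_cmult[OF dP[OF t]]] by simp
    show "h1_fun u 0 - c * P s = h1_fun r s" if "s \<in> {0..1}" for s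
      using uconst[OF that] p[OF that] by (simp add: u_def plus_h1.rep_eq scaleR_h1.rep_eq)
  qed
  moreover have "((\<lambda>t. - (c * F t)) has_real_derivative - (c * f t)) (at t within {0..1})" if "t \<in> {0..1}" for t
    by (intro DERIV_minus DERIV_cmult dF that)
  ultimately show ?thesis by (intro exI[of _ "\<lambda>t. - (c * F t)"] ballI conjI)
qed

text \<open>Write \<open>K\<close> for \<open>\<integral> r'\<^sup>2\<close> and \<open>B = h - \<integral> G(r, 0)\<close>. With \<open>lam = K / (2 B)\<close> the energy \<open>R\<^sup>2 / 2 + lam G(r, 0)\<close>, \<open>R = r'\<close>, is constant along the path. Its mean over
  \<open>[0,1]\<close> is \<open>K / 2 + lam (h - B) = lam h\<close>, so its value is \<open>lam h\<close> and \<open>G \<le> h\<close>.\<close>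
lemma planar_energy_bound:
  assumes S: "\<And>t. t \<in> {0..1} \<Longrightarrow> (h1_fun r t, 0) \<in> S"
    and G: "\<And>p. p \<in> S \<Longrightarrow> (G has_derivative blinfun_apply (G' p)) (at p)" and cG': "continuous_on S G'"
    and crit: "maupertuis_gradient G G' h (r, 0) = 0"
    and K: "kinetic (r, 0) (r, 0) > 0" and B: "h - potential_action G (r, 0) > 0" and t: "t \<in> {0..1}"
  shows "G (h1_fun r t, 0) \<le> h"
proof -
  interpret d: bounded_bilinear deriv_inner by (rule bounded_bilinear_deriv_inner)
  have z0: "h10_h1 0 = 0" by (simp add: zero_h10.rep_eq)
  have z00: "h1_fun 0 t = 0" for t by (simp add: zero_h1.rep_eq)
  have ev: "path_at t (u, 0) = (h1_fun u t, 0)" for t u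
    by (simp add: point_eval_apply z0 z00)
  have kin: "kinetic (r, 0) (u, 0) = deriv_inner r u" for u
    by (simp add: kinetic_def z0 d.zero_left)
  define b where "b = h - potential_action G (r, 0)"
  define lam where "lam = kinetic (r, 0) (r, 0) / (2 * b)"
  have lam: "lam > 0" using K B by (simp add: lam_def b_def)
  define f where "f = (\<lambda>t. blinfun_apply (G' (h1_fun r t, 0)) (1, 0))"
  have cr: "continuous_on {0..1} (\<lambda>t. (h1_fun r t, 0::real))"
    by (intro continuous_intros has_L2_deriv_continuous[OF h1_deriv])
  have cGr: "continuous_on {0..1} (\<lambda>t. G' (h1_fun r t, 0))"
    by (rule continuous_on_compose2[OF cG' cr]) (use S in auto)
  have cf: "continuous_on {0..1} f" unfolding f_def by (intro continuous_intros cGr)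
  have weak: "deriv_inner r u = lam * integral {0..1} (\<lambda>t. f t * h1_fun u t)" for u
  proof -
    have ig: "(\<lambda>t. G' (path_at t (r, 0)) o\<^sub>L point_eval t) integrable_on {0..1}"
      unfolding ev
      by (intro integrable_continuous_real bounded_bilinear.continuous_on[OF bounded_bilinear_blinfun_compose] cGr continuous_on_point_eval)
    have "blinfun_apply (potential_gradient G' (r, 0)) (u, 0)
        = integral {0..1} (\<lambda>t. blinfun_apply (G' (path_at t (r, 0)) o\<^sub>L point_eval t) (u, 0))"
      by (simp only: potential_gradient_def blinfun_apply_integral[OF ig])
    also have "\<dots> = integral {0..1} (\<lambda>t. f t * h1_fun u t)"
      unfolding blinfun_apply_blinfun_compose ev
    proof (rule integral_cong)
      fix t :: real
      have "(h1_fun u t, 0::real) = h1_fun u t *\<^sub>R (1, 0)" by simp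
      then show "blinfun_apply (G' (h1_fun r t, 0)) (h1_fun u t, 0) = f t * h1_fun u t"
        unfolding f_def by (simp only: blinfun.scaleR_right) simp
    qed
    finally have "blinfun_apply (potential_gradient G' (r, 0)) (u, 0) = integral {0..1} (\<lambda>t. f t * h1_fun u t)" .
    moreover have "blinfun_apply (maupertuis_gradient G G' h (r, 0)) (u, 0) = 0" by (simp add: crit)
    ultimately have "b * deriv_inner r u = 1 / 2 * kinetic (r, 0) (r, 0) * integral {0..1} (\<lambda>t. f t * h1_fun u t)"
      by (simp add: maupertuis_gradient_def blinfun.bilinear_simps kinetic_gradient_apply kin b_def)
    then show ?thesis using B unfolding lam_def b_def[symmetric] by (simp add: field_simps)
  qed
  obtain R where R: "\<And>t. t \<in> {0..1} \<Longrightarrow> (h1_fun r has_real_derivative R t) (at t within {0..1})"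
      "\<And>t. t \<in> {0..1} \<Longrightarrow> (R has_real_derivative - (lam * f t)) (at t within {0..1})"
    using du_bois_reymond[OF cf weak] by blast
  have cR: "continuous_on {0..1} R" by (rule DERIV_continuous_on[OF R(2)])
  define E where "E = (\<lambda>t. (R t)\<^sup>2 / 2 + lam * G (h1_fun r t, 0))"
  have dG: "((\<lambda>t. G (h1_fun r t, 0)) has_real_derivative f t * R t) (at t within {0..1})" if t: "t \<in> {0..1}" for t
  proof -
    have "((\<lambda>t. (h1_fun r t, 0::real)) has_derivative (\<lambda>x. (R t * x, 0))) (at t within {0..1})"
      using R(1)[OF t] unfolding has_field_derivative_def by (intro has_derivative_Pair has_derivative_const)
    from has_derivative_compose[OF this G[OF S[OF t]]]
    have "((\<lambda>t. G (h1_fun r t, 0)) has_derivative (\<lambda>x. blinfun_apply (G' (h1_fun r t, 0)) (R t * x, 0))) (at t within {0..1})" .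
    moreover have "blinfun_apply (G' (h1_fun r t, 0)) (R t * x, 0) = f t * R t * x" for x
    proof -
      have "(R t * x, 0::real) = (R t * x) *\<^sub>R (1, 0)" by simp
      then show ?thesis unfolding f_def by (simp only: blinfun.scaleR_right) simp
    qed
    ultimately show ?thesis unfolding has_field_derivative_def by simp
  qed
  have cGc: "continuous_on {0..1} (\<lambda>t. G (h1_fun r t, 0))" by (rule DERIV_continuous_on[OF dG])
  have dE: "(E has_real_derivative 0) (at t within {0..1})" if t: "t \<in> {0..1}" for t
  proof -
    have "(E has_real_derivative (- (lam * f t) * R t + - (lam * f t) * R t) / 2 + lam * (f t * R t)) (at t within {0..1})"
      unfolding E_def power2_eq_square
      by (rule DERIV_add[OF DERIV_cdivide[OF DERIV_mult[OF R(2)[OF t] R(2)[OF t]]] DERIV_cmult[OF dG[OF t]]])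
    then show ?thesis by simp
  qed
  have Econst: "E t = E 0" if "t \<in> {0..1}" for t
    using has_field_derivative_zero_constant[of "{0..1}" E] dE that by (metis atLeastAtMost_iff convex_real_interval(5) order_refl zero_le_one)
  have "integral {0..1} E = E 0"
  proof -
    have "integral {0..1} E = integral {0..1} (\<lambda>t::real. E 0)" by (rule integral_cong) (rule Econst)
    then show ?thesis by simp
  qed
  moreover have "integral {0..1} E = integral {0..1} (\<lambda>t. (R t)\<^sup>2 / 2) + lam * potential_action G (r, 0)"
  proof -
    have "integral {0..1} E = integral {0..1} (\<lambda>t. (R t)\<^sup>2 / 2) + integral {0..1} (\<lambda>t. lam * G (h1_fun r t, 0))"
      unfolding E_def by (intro integral_add integrable_continuous_real continuous_intros cR cGc) auto
    then show ?thesis by (simp add: potential_action_def ev)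
  qed
  moreover have "integral {0..1} (\<lambda>t. (R t)\<^sup>2 / 2) = kinetic (r, 0) (r, 0) / 2"
  proof -
    have si: "set_integrable lborel {0..1} (\<lambda>t. (R t)\<^sup>2)"
      by (intro set_integrable_continuous continuous_intros cR)
    have "deriv_inner r r = (LBINT t:{0..1}. R t * h1_deriv r t)" by (rule deriv_inner_C1_left[OF R(1) cR])
    also have "\<dots> = (LBINT t:{0..1}. h1_deriv r t * R t)" by (simp add: mult.commute)
    also have "\<dots> = (LBINT t:{0..1}. R t * R t)"
      by (rule integral_h1_deriv_C1[OF R(1) cR borel_measurable_continuous_on_indicator[OF _ cR]]) simp_all
    also have "\<dots> = (LBINT t:{0..1}. (R t)\<^sup>2)" by (simp add: power2_eq_square)
    also have "\<dots> = integral {0..1} (\<lambda>t. (R t)\<^sup>2)" by (rule set_borel_integral_eq_integral(2)[OF si])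
    finally show ?thesis by (simp add: kin)
  qed
  ultimately have "E 0 = kinetic (r, 0) (r, 0) / 2 + lam * potential_action G (r, 0)" by simp
  also have "kinetic (r, 0) (r, 0) / 2 = lam * b" using B unfolding lam_def b_def[symmetric] by simp
  finally have "E 0 = lam * h" by (simp add: b_def algebra_simps)
  then have "(R t)\<^sup>2 / 2 + lam * G (h1_fun r t, 0) = lam * h" using Econst[OF t] by (simp add: E_def)
  then have "lam * G (h1_fun r t, 0) \<le> lam * h" using zero_le_power2[of "R t"] by linarith
  then show ?thesis using lam by simp
qed

section \<open>Change of the independent variable\<close>

lemma has_real_derivative_inverse_within:
  fixes f T :: "real \<Rightarrow> real"
  assumes d: "(f has_real_derivative D) (at t within S)" and D: "D \<noteq> 0" and t: "t \<in> S"
    and T: "\<And>s. s \<in> S \<Longrightarrow> T (f s) = s" and cT: "continuous_on (f ` S) T"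
  shows "(T has_real_derivative inverse D) (at (f t) within f ` S)"
proof -
  have "((\<lambda>s. inverse ((f s - f t) / (s - t))) \<longlongrightarrow> inverse D) (at t within S)"
    using d D unfolding has_field_derivative_iff by (intro tendsto_inverse)
  moreover have "filterlim T (at t within S) (at (f t) within f ` S)"
    unfolding filterlim_at
  proof
    show "\<forall>\<^sub>F y in at (f t) within f ` S. T y \<in> S \<and> T y \<noteq> t"
      using T by (auto simp: eventually_at_filter intro!: always_eventually)
    show "(T \<longlongrightarrow> t) (at (f t) within f ` S)"
      using cT T[OF t] t unfolding continuous_on_def by force
  qed
  ultimately have "((\<lambda>y. inverse ((f (T y) - f t) / (T y - t))) \<longlongrightarrow> inverse D) (at (f t) within f ` S)"
    by (rule filterlim_compose)
  then show ?thesis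
    unfolding has_field_derivative_iff
  proof (rule Lim_transform_eventually)
    show "\<forall>\<^sub>F y in at (f t) within f ` S. inverse ((f (T y) - f t) / (T y - t)) = (T y - T (f t)) / (y - f t)"
      using T t by (auto simp: eventually_at_filter intro!: always_eventually)
  qed
qed

text \<open>As \<open>d\<theta> / dt = \<omega> s / r\<^sup>2\<close> with \<open>s = \<surd>lam\<close>, the flux \<open>p d/d\<theta>\<close> is \<open>(\<omega> / s) d/dt\<close>: in the variable \<open>t\<close> the leading
  coefficient becomes constant and the factor \<open>lam / r\<^sup>2\<close> moves to the eigenvalue parameter.\<close>
lemma dirichlet_eigenvalue_reparametrised:
  fixes \<omega> lam \<theta>\<^sub>0 :: real and r \<theta> rbar U :: "real \<Rightarrow> real"
  assumes \<omega>: "\<omega> > 0" and lam: "lam > 0"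
    and r: "continuous_on {0..1} r" and rpos: "\<And>t. t \<in> {0..1} \<Longrightarrow> r t > 0"
    and \<theta>: "\<And>t. t \<in> {0..1} \<Longrightarrow> \<theta> t = (LBINT s:{0..t}. \<omega> * sqrt lam / (r s)\<^sup>2)"
    and \<theta>0: "\<theta>\<^sub>0 = \<theta> 1" and rbar: "\<And>t. t \<in> {0..1} \<Longrightarrow> rbar (\<theta> t) = r t"
  shows "dirichlet_eigenvalue (\<lambda>x. \<omega>\<^sup>2 / (rbar x)\<^sup>2) (\<lambda>x. - ((rbar x)\<^sup>2 * U (rbar x))) \<theta>\<^sub>0 \<mu>
    \<longleftrightarrow> (\<exists>y y'. dirichlet_solution (\<lambda>t. - (lam * U (r t))) (\<lambda>t. lam / (r t)\<^sup>2) \<mu> y y')"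
    (is "?L \<longleftrightarrow> ?R")
proof -
  let ?p = "\<lambda>x. \<omega>\<^sup>2 / (rbar x)\<^sup>2" and ?q = "\<lambda>x. - ((rbar x)\<^sup>2 * U (rbar x))"
  define s where "s = sqrt lam"
  have s: "s > 0" "lam = s * s" using lam by (auto simp: s_def)
  define g where "g = (\<lambda>t. \<omega> * s / (r t)\<^sup>2)"
  have gpos: "g t > 0" if "t \<in> {0..1}" for t using \<omega> s rpos[OF that] by (simp add: g_def)
  have cg: "continuous_on {0..1} g"
    unfolding g_def using rpos by (intro continuous_intros r) (fastforce)
  have \<theta>g: "\<theta> t = integral {0..t} g" if t: "t \<in> {0..1}" for t
  proof -
    have "set_integrable lborel {0..t} g"
      by (rule set_integrable_continuous[OF continuous_on_subset[OF cg]]) (use t in auto)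
    then show ?thesis using \<theta>[OF t] set_borel_integral_eq_integral(2) unfolding g_def s_def by metis
  qed
  have d\<theta>: "(\<theta> has_real_derivative g t) (at t within {0..1})" if t: "t \<in> {0..1}" for t
    by (rule has_field_derivative_transform_within[OF integral_has_real_derivative[OF cg t] zero_less_one t])
      (simp add: \<theta>g)
  have c\<theta>: "continuous_on {0..1} \<theta>" by (rule DERIV_continuous_on[OF d\<theta>])
  have mono: "\<theta> a < \<theta> b" if "0 \<le> a" "a < b" "b \<le> 1" for a b
  proof (rule DERIV_pos_imp_increasing_open[OF that(2)])
    show "\<exists>y. (\<theta> has_real_derivative y) (at x) \<and> 0 < y" if "a < x" "x < b" for x
      using d\<theta>[of x] gpos[of x] at_within_Icc_at[of 0 x 1] that \<open>0 \<le> a\<close> \<open>b \<le> 1\<close> by auto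
    show "continuous_on {a..b} \<theta>" by (rule continuous_on_subset[OF c\<theta>]) (use that in auto)
  qed
  have inj: "inj_on \<theta> {0..1}"
    by (rule linorder_inj_onI) (use mono in force)+
  have t00: "\<theta> 0 = 0" using \<theta>g[of 0] by simp
  have img: "\<theta> ` {0..1} = {0..\<theta>\<^sub>0}"
  proof
    show "\<theta> ` {0..1} \<subseteq> {0..\<theta>\<^sub>0}"
    proof
      fix x assume "x \<in> \<theta> ` {0..1}"
      then obtain t where t: "t \<in> {0..1}" "x = \<theta> t" by auto
      have "\<theta> 0 \<le> \<theta> t" using mono[of 0 t] t by (cases "t = 0") auto
      moreover have "\<theta> t \<le> \<theta> 1" using mono[of t 1] t by (cases "t = 1") auto
      ultimately show "x \<in> {0..\<theta>\<^sub>0}" using t t00 \<theta>0 by simp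
    qed
    show "{0..\<theta>\<^sub>0} \<subseteq> \<theta> ` {0..1}"
    proof
      fix x assume "x \<in> {0..\<theta>\<^sub>0}"
      then have "\<exists>t\<ge>0. t \<le> 1 \<and> \<theta> t = x" by (intro IVT' c\<theta>) (auto simp: t00 \<theta>0)
      then show "x \<in> \<theta> ` {0..1}" by auto
    qed
  qed
  define T where "T = the_inv_into {0..1} \<theta>"
  have T: "T (\<theta> t) = t" if "t \<in> {0..1}" for t unfolding T_def by (rule the_inv_into_f_f[OF inj that])
  have cT: "continuous_on (\<theta> ` {0..1}) T" by (rule continuous_on_inv[OF c\<theta> compact_Icc]) (use T in blast)
  have dT: "(T has_real_derivative inverse (g t)) (at (\<theta> t) within {0..\<theta>\<^sub>0})" if t: "t \<in> {0..1}" for t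
    using has_real_derivative_inverse_within[OF d\<theta>[OF t] _ t T cT] gpos[OF t] unfolding img by simp
  have T01: "T x \<in> {0..1}" "\<theta> (T x) = x" if "x \<in> {0..\<theta>\<^sub>0}" for x
  proof -
    have "x \<in> \<theta> ` {0..1}" using that by (simp only: img)
    then obtain t where t: "t \<in> {0..1}" "x = \<theta> t" by blast
    show "T x \<in> {0..1}" "\<theta> (T x) = x" unfolding t(2) T[OF t(1)] by (rule t(1), rule refl)
  qed
  have Timg: "T ` {0..\<theta>\<^sub>0} = {0..1}"
  proof (intro subset_antisym image_subsetI subsetI)
    show "T x \<in> {0..1}" if "x \<in> {0..\<theta>\<^sub>0}" for x by (rule T01(1)[OF that])
    show "t \<in> T ` {0..\<theta>\<^sub>0}" if "t \<in> {0..1}" for t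
      unfolding img[symmetric] using T[OF that] that by (metis imageI)
  qed
  have "\<theta>\<^sub>0 > 0" using mono[of 0 1] t00 \<theta>0 by simp
  show ?thesis
  proof
    assume ?L
    then obtain v v' W where v: "\<And>x. x \<in> {0..\<theta>\<^sub>0} \<Longrightarrow> (v has_real_derivative v' x) (at x within {0..\<theta>\<^sub>0})"
      "\<And>x. x \<in> {0..\<theta>\<^sub>0} \<Longrightarrow> ((\<lambda>y. ?p y * v' y) has_real_derivative W x) (at x within {0..\<theta>\<^sub>0})"
      "\<And>x. x \<in> {0..\<theta>\<^sub>0} \<Longrightarrow> \<mu> * v x = - W x + ?q x * v x"
      and bc: "v 0 = 0" "v \<theta>\<^sub>0 = 0" "\<exists>x\<in>{0..\<theta>\<^sub>0}. v x \<noteq> 0"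
      unfolding dirichlet_eigenvalue_def sturm_liouville_def by blast
    define y where "y = v \<circ> \<theta>"
    define y' where "y' = (\<lambda>t. s / \<omega> * (?p (\<theta> t) * v' (\<theta> t)))"
    have \<theta>t: "\<theta> t \<in> {0..\<theta>\<^sub>0}" if "t \<in> {0..1}" for t using img that by blast
    have 1: "(y has_real_derivative y' t) (at t within {0..1})" if t: "t \<in> {0..1}" for t
    proof -
      have "(y has_real_derivative v' (\<theta> t) * g t) (at t within {0..1})"
        unfolding y_def by (rule DERIV_image_chain[OF _ d\<theta>[OF t]]) (use v(1)[OF \<theta>t[OF t]] img in simp)
      also have "v' (\<theta> t) * g t = y' t"
        using \<omega> by (simp add: y'_def g_def rbar[OF t] power2_eq_square)
      finally show ?thesis .
    qed
    have 2: "(y' has_real_derivative (- (lam * U (r t)) - \<mu> * (lam / (r t)\<^sup>2)) * y t) (at t within {0..1})" if t: "t \<in> {0..1}" for t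
    proof -
      have "((\<lambda>y. ?p y * v' y) \<circ> \<theta> has_real_derivative W (\<theta> t) * g t) (at t within {0..1})"
        by (rule DERIV_image_chain[OF _ d\<theta>[OF t]]) (use v(2)[OF \<theta>t[OF t]] img in simp)
      then have "(y' has_real_derivative s / \<omega> * (W (\<theta> t) * g t)) (at t within {0..1})"
        unfolding y'_def comp_def by (rule DERIV_cmult)
      also have "s / \<omega> * (W (\<theta> t) * g t) = lam / (r t)\<^sup>2 * W (\<theta> t)"
        using \<omega> by (simp add: g_def s(2))
      also have "W (\<theta> t) = (- ((r t)\<^sup>2 * U (r t)) - \<mu>) * y t"
        using v(3)[OF \<theta>t[OF t]] by (simp add: rbar[OF t] y_def algebra_simps)
      also have "lam / (r t)\<^sup>2 * ((- ((r t)\<^sup>2 * U (r t)) - \<mu>) * y t) = (- (lam * U (r t)) - \<mu> * (lam / (r t)\<^sup>2)) * y t"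
        using rpos[OF t] by (simp add: field_simps)
      finally show ?thesis .
    qed
    have "\<exists>t\<in>{0..1}. y t \<noteq> 0"
    proof -
      obtain x where x: "x \<in> {0..\<theta>\<^sub>0}" "v x \<noteq> 0" using bc(3) by blast
      then show ?thesis using T01[OF x(1)] by (intro bexI[of _ "T x"]) (auto simp: y_def)
    qed
    then show ?R
      using 1 2 bc(1,2) unfolding dirichlet_solution_def
      by (intro exI[of _ y] exI[of _ y']) (auto simp: y_def t00 \<theta>0)
  next
    assume ?R
    then obtain y y' where y: "\<And>t. t \<in> {0..1} \<Longrightarrow> (y has_real_derivative y' t) (at t within {0..1})"
      "\<And>t. t \<in> {0..1} \<Longrightarrow> (y' has_real_derivative (- (lam * U (r t)) - \<mu> * (lam / (r t)\<^sup>2)) * y t) (at t within {0..1})"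
      and bc: "y 0 = 0" "y 1 = 0" "\<exists>t\<in>{0..1}. y t \<noteq> 0"
      unfolding dirichlet_solution_def by blast
    define v where "v = y \<circ> T"
    define v' where "v' = (\<lambda>x. y' (T x) * inverse (g (T x)))"
    define W where "W = (\<lambda>x. \<omega> / s * ((- (lam * U (r (T x))) - \<mu> * (lam / (r (T x))\<^sup>2)) * y (T x) * inverse (g (T x))))"
    have dTx: "(T has_real_derivative inverse (g (T x))) (at x within {0..\<theta>\<^sub>0})" if "x \<in> {0..\<theta>\<^sub>0}" for x
      using dT[OF T01(1)[OF that]] T01(2)[OF that] by simp
    have rb: "rbar x = r (T x)" if "x \<in> {0..\<theta>\<^sub>0}" for x
      using rbar[OF T01(1)[OF that]] T01(2)[OF that] by simp
    have 1: "(v has_real_derivative v' x) (at x within {0..\<theta>\<^sub>0})" if x: "x \<in> {0..\<theta>\<^sub>0}" for x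
      unfolding v_def v'_def
      by (rule DERIV_image_chain[OF _ dTx[OF x]]) (use y(1)[OF T01(1)[OF x]] Timg in simp)
    have 2: "((\<lambda>y. ?p y * v' y) has_real_derivative W x) (at x within {0..\<theta>\<^sub>0})" if x: "x \<in> {0..\<theta>\<^sub>0}" for x
    proof (rule has_field_derivative_transform_within[OF _ zero_less_one x])
      have "(y' \<circ> T has_real_derivative (- (lam * U (r (T x))) - \<mu> * (lam / (r (T x))\<^sup>2)) * y (T x) * inverse (g (T x))) (at x within {0..\<theta>\<^sub>0})"
        by (rule DERIV_image_chain[OF _ dTx[OF x]]) (use y(2)[OF T01(1)[OF x]] Timg in simp)
      then show "((\<lambda>x. \<omega> / s * y' (T x)) has_real_derivative W x) (at x within {0..\<theta>\<^sub>0})"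
        unfolding W_def comp_def by (rule DERIV_cmult)
      show "\<omega> / s * y' (T z) = ?p z * v' z" if z: "z \<in> {0..\<theta>\<^sub>0}" for z
        using rpos[OF T01(1)[OF z]] \<omega> s(1) by (simp add: rb[OF z] v'_def g_def power2_eq_square field_simps)
    qed
    have 3: "\<mu> * v x = - W x + ?q x * v x" if x: "x \<in> {0..\<theta>\<^sub>0}" for x
    proof -
      have "W x = (- ((r (T x))\<^sup>2 * U (r (T x))) - \<mu>) * v x"
        using rpos[OF T01(1)[OF x]] \<omega> s(1) unfolding W_def g_def s(2) v_def by (simp add: power2_eq_square field_simps)
      then show ?thesis by (simp add: rb[OF x] algebra_simps)
    qed
    have "sturm_liouville ?p ?q \<theta>\<^sub>0 v (\<lambda>x. \<mu> * v x)"
      unfolding sturm_liouville_def using 1 2 3 by blast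
    moreover have "v 0 = 0" "v \<theta>\<^sub>0 = 0" using T[of 0] T[of 1] bc by (auto simp: v_def t00 \<theta>0)
    moreover have "\<exists>x\<in>{0..\<theta>\<^sub>0}. v x \<noteq> 0"
    proof -
      obtain t where t: "t \<in> {0..1}" "y t \<noteq> 0" using bc(3) by blast
      then show ?thesis using T[OF t(1)] img by (intro bexI[of _ "\<theta> t"]) (auto simp: v_def)
    qed
    ultimately show ?L unfolding dirichlet_eigenvalue_def by blast
  qed
qed

section \<open>The potential and its cutoff\<close>

lemma fderiv_eqI: "(f has_derivative blinfun_apply L) (at x) \<Longrightarrow> fderiv f x = L"
  unfolding fderiv_def by (simp add: frechet_derivative_at[symmetric] blinfun_apply_inverse)

lemma fderiv_works: "f differentiable at x \<Longrightarrow> (f has_derivative blinfun_apply (fderiv f x)) (at x)"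
  unfolding fderiv_def
  by (simp add: frechet_derivative_works bounded_linear_Blinfun_apply[OF has_derivative_bounded_linear])

lemma C1_on_imp_continuous_on: "C1_on S f \<Longrightarrow> continuous_on S f"
  unfolding C1_on_def by (blast intro: continuous_at_imp_continuous_on differentiable_imp_continuous_within)

lemma V_zz_fderiv:
  assumes "C2_on half_plane V" and r: "r > 0"
  shows "V_zz V r 0 = blinfun_apply (blinfun_apply (fderiv (fderiv V) (r, 0)) (0, 1)) (0, 1)"
proof -
  have hp: "(r, y) \<in> half_plane" for y using r by (simp add: half_plane_def)
  have d1: "(V has_derivative blinfun_apply (fderiv V (r, y))) (at (r, y))" for y
    by (rule fderiv_works) (use assms(1) hp in \<open>auto simp: C2_on_def C1_on_def\<close>)
  have d2: "(fderiv V has_derivative blinfun_apply (fderiv (fderiv V) (r, y))) (at (r, y))" for y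
    by (rule fderiv_works) (use assms(1) hp in \<open>auto simp: C2_on_def C1_on_def\<close>)
  have dp: "((\<lambda>y. (r, y)) has_derivative (\<lambda>h. (0, h))) (at y)" for y :: real
    by (intro has_derivative_Pair has_derivative_const has_derivative_ident)
  have sc: "(0::real, h) = h *\<^sub>R (0, 1)" for h :: real by simp
  have "((\<lambda>y. V (r, y)) has_real_derivative blinfun_apply (fderiv V (r, y)) (0, 1)) (at y)" for y
  proof -
    have "((\<lambda>y. V (r, y)) has_derivative (\<lambda>h. blinfun_apply (fderiv V (r, y)) (0, h))) (at y)"
      by (rule has_derivative_compose[OF dp d1])
    moreover have "(\<lambda>h. blinfun_apply (fderiv V (r, y)) (0, h)) = (*) (blinfun_apply (fderiv V (r, y)) (0, 1))"
    proof
      show "blinfun_apply (fderiv V (r, y)) (0, h) = blinfun_apply (fderiv V (r, y)) (0, 1) * h" for h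
        unfolding sc[of h] blinfun.scaleR_right by simp
    qed
    ultimately show ?thesis unfolding has_field_derivative_def by simp
  qed
  then have "deriv (\<lambda>y. V (r, y)) = (\<lambda>y. blinfun_apply (fderiv V (r, y)) (0, 1))"
    by (intro ext DERIV_imp_deriv)
  moreover have "((\<lambda>y. blinfun_apply (fderiv V (r, y)) (0, 1)) has_real_derivative
      blinfun_apply (blinfun_apply (fderiv (fderiv V) (r, 0)) (0, 1)) (0, 1)) (at 0)"
  proof -
    have "((\<lambda>y. fderiv V (r, y)) has_derivative (\<lambda>h. blinfun_apply (fderiv (fderiv V) (r, 0)) (0, h))) (at 0)"
      by (rule has_derivative_compose[OF dp d2])
    from bounded_linear.has_derivative[OF blinfun.bounded_linear_left this]
    have "((\<lambda>y. blinfun_apply (fderiv V (r, y)) (0, 1)) has_derivative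
        (\<lambda>h. blinfun_apply (blinfun_apply (fderiv (fderiv V) (r, 0)) (0, h)) (0, 1))) (at 0)" .
    moreover have "(\<lambda>h. blinfun_apply (blinfun_apply (fderiv (fderiv V) (r, 0)) (0, h)) (0, 1))
        = (*) (blinfun_apply (blinfun_apply (fderiv (fderiv V) (r, 0)) (0, 1)) (0, 1))"
    proof
      show "blinfun_apply (blinfun_apply (fderiv (fderiv V) (r, 0)) (0, h)) (0, 1)
        = blinfun_apply (blinfun_apply (fderiv (fderiv V) (r, 0)) (0, 1)) (0, 1) * h" for h
        unfolding sc[of h] blinfun.scaleR_right blinfun.scaleR_left by simp
    qed
    ultimately show ?thesis unfolding has_field_derivative_def by simp
  qed
  ultimately show ?thesis unfolding V_zz_def by (simp add: DERIV_imp_deriv)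
qed

lemma B_fun_potential_action:
  assumes "continuous_on {0..1} (\<lambda>t. \<phi> (V (path_at t \<gamma>)))"
  shows "B_fun V \<phi> h \<gamma> = h - potential_action (\<phi> \<circ> V) \<gamma>"
proof -
  obtain r z where [simp]: "\<gamma> = (r, z)" by force
  let ?f = "\<lambda>t. \<phi> (V (path_at t \<gamma>))"
  have si: "set_integrable lborel {0..1} (\<lambda>t. h - ?f t)"
    by (intro set_integrable_continuous continuous_intros assms)
  have "B_fun V \<phi> h \<gamma> = (LBINT t:{0..1}. h - ?f t)"
    by (simp add: B_fun_def point_eval_apply)
  also have "\<dots> = integral {0..1} (\<lambda>t. h - ?f t)" by (rule set_borel_integral_eq_integral(2)[OF si])
  also have "\<dots> = integral {0..1} (\<lambda>t::real. h) - integral {0..1} ?f"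
    by (intro integral_diff integrable_continuous_real continuous_intros assms)
  finally show ?thesis by (simp add: potential_action_def)
qed

lemma I_hat_maupertuis:
  assumes "continuous_on {0..1} (\<lambda>t. \<phi> (V (path_at t \<gamma>)))"
  shows "I_hat V \<phi> h \<gamma> = maupertuis (\<phi> \<circ> V) h \<gamma>"
  by (simp add: I_hat_def maupertuis_def A_fun_kinetic B_fun_potential_action[of \<phi> V, OF assms])

lemma cutoff_has_derivative:
  assumes phi: "cutoff \<phi> h \<epsilon>" and "\<tau> < h + 2 * \<epsilon>"
  shows "(\<phi> has_real_derivative deriv \<phi> \<tau>) (at \<tau>)"
proof -
  have "(deriv ^^ 0) \<phi> differentiable at \<tau>"
    using assms unfolding cutoff_def Cinf_on_def by blast
  then show ?thesis by (simp add: DERIV_deriv_iff_real_differentiable)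
qed

text \<open>\<open>\<phi>\<close> has slope at least \<open>1\<close> and fixes \<open>h\<close>, so it lies above the diagonal beyond \<open>h\<close>.\<close>
lemma cutoff_le_imp_le:
  assumes phi: "cutoff \<phi> h \<epsilon>" and \<epsilon>: "\<epsilon> > 0" and x: "x < h + 2 * \<epsilon>" "\<phi> x \<le> h"
  shows "x \<le> h"
proof (rule ccontr)
  assume "\<not> x \<le> h"
  then have hx: "h < x" by simp
  note d = cutoff_has_derivative[OF phi]
  obtain \<xi> where \<xi>: "h < \<xi>" "\<xi> < x" "\<phi> x - \<phi> h = (x - h) * deriv \<phi> \<xi>"
    using MVT2[OF hx, of \<phi> "deriv \<phi>"] d x(1) by force
  have "1 \<le> deriv \<phi> \<xi>" using phi \<xi>(2) x(1) by (simp add: cutoff_def)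
  then have "(x - h) * 1 \<le> \<phi> x - \<phi> h" unfolding \<xi>(3) using hx by (intro mult_left_mono) auto
  moreover have "\<phi> h = h" using phi \<epsilon> by (simp add: cutoff_def)
  ultimately show False using x(2) hx by simp
qed

lemma cutoff_potential_C1:
  assumes phi: "cutoff \<phi> h \<epsilon>" and V: "C1_on half_plane V"
  defines "S \<equiv> {p \<in> half_plane. V p < h + 2 * \<epsilon>}"
  shows "p \<in> S \<Longrightarrow> (\<phi> \<circ> V has_derivative blinfun_apply (deriv \<phi> (V p) *\<^sub>R fderiv V p)) (at p)"
    and "continuous_on S (\<lambda>p. deriv \<phi> (V p) *\<^sub>R fderiv V p)"
proof -
  note d = cutoff_has_derivative[OF phi]
  have dV: "(V has_derivative blinfun_apply (fderiv V p)) (at p)" if "p \<in> half_plane" for p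
    by (rule fderiv_works) (use V that in \<open>auto simp: C1_on_def\<close>)
  show "(\<phi> \<circ> V has_derivative blinfun_apply (deriv \<phi> (V p) *\<^sub>R fderiv V p)) (at p)" if "p \<in> S"
    using has_derivative_compose[OF dV[of p] d[of "V p", unfolded has_field_derivative_def]] that
    by (simp add: S_def comp_def scaleR_blinfun.rep_eq)
  have c\<phi>: "continuous_on {..<h + 2 * \<epsilon>} (deriv \<phi>)"
  proof (rule continuous_at_imp_continuous_on, rule ballI)
    fix \<tau> assume "\<tau> \<in> {..<h + 2 * \<epsilon>}"
    then have "(deriv ^^ 1) \<phi> differentiable at \<tau>"
      using phi unfolding cutoff_def Cinf_on_def by blast
    then show "isCont (deriv \<phi>) \<tau>" by (simp add: differentiable_imp_continuous_within)
  qed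
  have cV: "continuous_on S V"
    by (rule continuous_on_subset[OF C1_on_imp_continuous_on[OF V]]) (auto simp: S_def)
  have "continuous_on S (\<lambda>p. deriv \<phi> (V p))"
    by (rule continuous_on_compose2[OF c\<phi> cV]) (auto simp: S_def)
  moreover have "continuous_on S (fderiv V)"
    using V unfolding C1_on_def by (auto simp: S_def intro: continuous_on_subset)
  ultimately show "continuous_on S (\<lambda>p. deriv \<phi> (V p) *\<^sub>R fderiv V p)" by (intro continuous_intros)
qed

lemma open_sublevel:
  fixes V :: "real \<times> real \<Rightarrow> real"
  assumes V: "C1_on half_plane V"
  shows "open {p \<in> half_plane. V p < a}"
proof -
  have hp: "open half_plane" unfolding half_plane_def by (intro open_Collect_less continuous_intros)
  have cV: "continuous_on half_plane V"
    by (rule C1_on_imp_continuous_on[OF V])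
  have "open (half_plane \<inter> V -` {..<a})" by (rule continuous_open_preimage[OF cV hp open_lessThan])
  moreover have "half_plane \<inter> V -` {..<a} = {p \<in> half_plane. V p < a}" by auto
  ultimately show ?thesis by simp
qed

section \<open>The Morse index in the vertical direction\<close>

theorem lemma3p1:
  fixes \<omega> h\<^sub>m h\<^sub>p h \<epsilon> lam\<^sub>0 \<theta>\<^sub>0 :: real
    and V V\<^sub>0 :: "real \<times> real \<Rightarrow> real"
    and \<phi> \<theta> rbar :: "real \<Rightarrow> real"
    and r\<^sub>0 :: h1
  assumes "\<omega> > 0"
    and V: "\<And>r z. r > 0 \<Longrightarrow> V (r, z) = \<omega>\<^sup>2 / (2 * r\<^sup>2) + V\<^sub>0 (r, z)"
    and V1: "C2_on half_plane V"
    and V2: "\<And>r z. r > 0 \<Longrightarrow> V (r, z) = V (r, - z)"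
    and V3: "Hill_condition V h\<^sub>m h\<^sub>p"
    and h: "h\<^sub>m < h" "h < h\<^sub>p"
    and eps: "\<epsilon> > 0" "boundary_graph V h \<epsilon>" "h + 2 * \<epsilon> < h\<^sub>p"
      "\<And>p. p \<in> half_plane \<Longrightarrow> V p \<in> {h..h + 2 * \<epsilon>} \<Longrightarrow> fderiv V p \<noteq> 0"
      "4 / \<epsilon>\<^sup>2 > h + 3 * \<epsilon> / 2"
    and phi: "cutoff \<phi> h \<epsilon>"
    and path: "(r\<^sub>0, 0) \<in> Gamma_hat V h \<epsilon>"
    and nonconstant: "\<not> (\<exists>c. \<forall>t\<in>{0..1}. h1_fun r\<^sub>0 t = c)"
    and critical: "(I_hat V \<phi> h has_derivative (\<lambda>_. 0)) (at (r\<^sub>0, 0))"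
    and positive: "I_hat V \<phi> h (r\<^sub>0, 0) > 0"
    and lam: "lam\<^sub>0 = A_fun (r\<^sub>0, 0) / (2 * B_fun V \<phi> h (r\<^sub>0, 0))"
    and theta: "\<And>t. t \<in> {0..1} \<Longrightarrow> \<theta> t = (LBINT s:{0..t}. \<omega> * sqrt lam\<^sub>0 / (h1_fun r\<^sub>0 s)\<^sup>2)"
    and theta0: "\<theta>\<^sub>0 = \<theta> 1"
    and rbar: "\<And>t. t \<in> {0..1} \<Longrightarrow> rbar (\<theta> t) = h1_fun r\<^sub>0 t"
  defines "N \<equiv> {\<mu>. \<mu> < 0 \<and> dirichlet_eigenvalue (\<lambda>x. \<omega>\<^sup>2 / (rbar x)\<^sup>2)
                    (\<lambda>x. - ((rbar x)\<^sup>2 * V_zz V (rbar x) 0)) \<theta>\<^sub>0 \<mu>}"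
  shows "finite N \<and> z_morse_index (I_hat V \<phi> h) (r\<^sub>0, 0) = enat (card N)"
proof -
  interpret d: bounded_bilinear deriv_inner by (rule bounded_bilinear_deriv_inner)
  let ?\<gamma> = "(r\<^sub>0, 0) :: path_space"
  let ?r = "h1_fun r\<^sub>0"
  have z0: "h10_h1 0 = 0" by (simp add: zero_h10.rep_eq)
  have ev0: "path_at t ?\<gamma> = (?r t, 0)" for t
    by (simp add: point_eval_apply z0 zero_h1.rep_eq)
  have VC1: "C1_on half_plane V" "C1_on half_plane (fderiv V)" using V1 by (auto simp: C2_on_def)
  define S where "S = {p \<in> half_plane. V p < h + 2 * \<epsilon>}"
  have oS: "open S" unfolding S_def by (rule open_sublevel[OF VC1(1)])
  have rS: "(?r t, 0) \<in> S" if t: "t \<in> {0..1}" for t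
  proof -
    have "(?r t, 0) \<in> interior (Hill V (h + 2 * \<epsilon>))"
      using path t z0 by (auto simp: Gamma_hat_def zero_h1.rep_eq)
    moreover have "frontier (Hill V (h + 2 * \<epsilon>)) = {p \<in> half_plane. V p = h + 2 * \<epsilon>}"
      using V3 h(1) eps(1,3) unfolding Hill_condition_def by auto
    ultimately have "(?r t, 0) \<in> Hill V (h + 2 * \<epsilon>)" "\<not> ((?r t, 0) \<in> half_plane \<and> V (?r t, 0) = h + 2 * \<epsilon>)"
      using interior_subset by (blast, auto simp: frontier_def)
    then show ?thesis by (auto simp: S_def Hill_def)
  qed
  define G where "G = \<phi> \<circ> V"
  define G' where "G' = (\<lambda>p. deriv \<phi> (V p) *\<^sub>R fderiv V p)"
  have dG: "(G has_derivative blinfun_apply (G' p)) (at p)" if "p \<in> S" for p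
    unfolding G_def G'_def by (rule cutoff_potential_C1(1)[OF phi VC1(1)]) (use that in \<open>simp add: S_def\<close>)
  have cG': "continuous_on S G'"
    unfolding G'_def S_def by (rule cutoff_potential_C1(2)[OF phi VC1(1)])
  have cG: "continuous_on S G"
    by (rule continuous_at_imp_continuous_on) (use dG has_derivative_continuous in blast)
  have cGev: "continuous_on {0..1} (\<lambda>t. \<phi> (V (path_at t \<eta>)))"
    if "\<And>t. t \<in> {0..1} \<Longrightarrow> path_at t \<eta> \<in> S" for \<eta>
  proof -
    have "continuous_on {0..1} (\<lambda>t. G (path_at t \<eta>))"
      by (rule continuous_on_compose2[OF cG]) (auto intro!: continuous_intros continuous_on_point_eval that)
    then show ?thesis by (simp add: G_def)
  qed
  have IG: "I_hat V \<phi> h \<eta> = maupertuis G h \<eta>" if "\<And>t. t \<in> {0..1} \<Longrightarrow> path_at t \<eta> \<in> S" for \<eta>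
    unfolding G_def by (rule I_hat_maupertuis, rule cGev, rule that)
  have evS: "path_at t ?\<gamma> \<in> S" if "t \<in> {0..1}" for t unfolding ev0 by (rule rS[OF that])
  define K where "K = kinetic ?\<gamma> ?\<gamma>"
  define b where "b = h - potential_action G ?\<gamma>"
  have Bb: "B_fun V \<phi> h ?\<gamma> = b" unfolding b_def G_def by (rule B_fun_potential_action, rule cGev, rule evS)
  have "K \<ge> 0"
    unfolding K_def kinetic_def by (intro add_nonneg_nonneg deriv_inner_nonneg)
  moreover have Kb: "K * b > 0"
    using positive IG[OF evS] by (simp add: maupertuis_def K_def b_def)
  ultimately have Kpos: "K > 0" and bpos: "b > 0" by (auto simp: zero_less_mult_iff)
  have lamK: "lam\<^sub>0 = K / (2 * b)" using lam Bb by (simp add: A_fun_kinetic K_def)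
  have lampos: "lam\<^sub>0 > 0" using Kpos bpos by (simp add: lamK)
  have low: "V (?r t, 0) \<le> h" if t: "t \<in> {0..1}" for t
  proof -
    obtain \<delta> where \<delta>: "\<delta> > 0" "\<And>\<eta> t. \<eta> \<in> ball ?\<gamma> \<delta> \<Longrightarrow> t \<in> {0..1} \<Longrightarrow> path_at t \<eta> \<in> S"
      using path_tube[OF oS evS] by blast
    have "(potential_action G has_derivative blinfun_apply (potential_gradient G' ?\<gamma>)) (at ?\<gamma>)"
      by (rule potential_action_has_derivative[OF open_ball convex_ball _ \<delta>(2) dG cG']) (use \<delta>(1) in auto)
    from maupertuis_has_derivative[OF this, of h]
    have "(I_hat V \<phi> h has_derivative blinfun_apply (maupertuis_gradient G G' h ?\<gamma>)) (at ?\<gamma>)"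
      by (rule has_derivative_transform_within_open[OF _ open_ball[of ?\<gamma> \<delta>]]) (use \<delta> IG in auto)
    then have "blinfun_apply (maupertuis_gradient G G' h ?\<gamma>) = (\<lambda>_. 0)"
      by (rule has_derivative_unique[OF _ critical])
    then have "maupertuis_gradient G G' h ?\<gamma> = 0" by (intro blinfun_eqI) simp
    from planar_energy_bound[OF rS dG cG' this Kpos[unfolded K_def] bpos[unfolded b_def] t]
    have "\<phi> (V (?r t, 0)) \<le> h" by (simp add: G_def)
    then show ?thesis using cutoff_le_imp_le[OF phi eps(1)] rS[OF t] by (simp add: S_def)
  qed
  \<comment> \<open>On this smaller sublevel set \<open>\<phi> \<circ> V = V\<close>.\<close>
  define S' where "S' = {p \<in> half_plane. V p < h + \<epsilon>}"
  have S'S: "S' \<subseteq> S" using eps(1) by (auto simp: S_def S'_def)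
  have oS': "open S'" unfolding S'_def by (rule open_sublevel[OF VC1(1)])
  have evS': "path_at t ?\<gamma> \<in> S'" if t: "t \<in> {0..1}" for t
    unfolding ev0 using low[OF t] rS[OF t] eps(1) by (auto simp: S_def S'_def)
  obtain \<delta> where \<delta>: "\<delta> > 0" "\<And>\<eta> t. \<eta> \<in> ball ?\<gamma> \<delta> \<Longrightarrow> t \<in> {0..1} \<Longrightarrow> path_at t \<eta> \<in> S'"
    using path_tube[OF oS' evS'] by blast
  have pG: "potential_action G \<eta> = potential_action V \<eta>" if "\<eta> \<in> ball ?\<gamma> \<delta>" for \<eta>
    unfolding potential_action_def
    by (rule integral_cong) (use \<delta>(2)[OF that] phi in \<open>force simp: G_def S'_def cutoff_def\<close>)
  have IV: "I_hat V \<phi> h \<eta> = maupertuis V h \<eta>" if "\<eta> \<in> ball ?\<gamma> \<delta>" for \<eta>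
    using IG[of \<eta>] \<delta>(2)[OF that] S'S pG[OF that] by (auto simp: maupertuis_def)
  have dV: "(V has_derivative blinfun_apply (fderiv V p)) (at p)" if "p \<in> S'" for p
    by (rule fderiv_works) (use VC1 that in \<open>auto simp: C1_on_def S'_def\<close>)
  have ddV: "(fderiv V has_derivative blinfun_apply (fderiv (fderiv V) p)) (at p)" if "p \<in> S'" for p
    by (rule fderiv_works) (use VC1 that in \<open>auto simp: C1_on_def S'_def\<close>)
  have cV': "continuous_on S' (fderiv V)" and cV'': "continuous_on S' (fderiv (fderiv V))"
    using VC1 unfolding C1_on_def S'_def by (auto intro: continuous_on_subset)
  have pd: "(potential_action V has_derivative blinfun_apply (potential_gradient (fderiv V) \<eta>)) (at \<eta>)"
    if "\<eta> \<in> ball ?\<gamma> \<delta>" for \<eta>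
    by (rule potential_action_has_derivative[OF open_ball convex_ball that \<delta>(2) dV cV'])
  define D where "D = integral {0..1} (\<lambda>t. precompose (point_eval t) o\<^sub>L (fderiv (fderiv V) (path_at t ?\<gamma>) o\<^sub>L point_eval t))"
  have \<gamma>b: "?\<gamma> \<in> ball ?\<gamma> \<delta>" using \<delta>(1) by simp
  have gd: "(potential_gradient (fderiv V) has_derivative blinfun_apply D) (at ?\<gamma>)"
    unfolding D_def
    by (rule potential_gradient_has_derivative[OF open_ball convex_ball \<gamma>b \<delta>(2) ddV cV''])
  obtain L where L: "(maupertuis_gradient V (fderiv V) h has_derivative blinfun_apply L) (at ?\<gamma>)"
    "\<And>\<eta>. kinetic ?\<gamma> \<eta> = 0 \<Longrightarrow> blinfun_apply (blinfun_apply L \<eta>) \<eta> =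
      (h - potential_action V ?\<gamma>) * kinetic \<eta> \<eta> - 1 / 2 * kinetic ?\<gamma> ?\<gamma> * blinfun_apply (blinfun_apply D \<eta>) \<eta>"
    using maupertuis_gradient_has_derivative[OF pd[OF \<gamma>b] gd, of h] by blast
  have fI: "fderiv (I_hat V \<phi> h) \<eta> = maupertuis_gradient V (fderiv V) h \<eta>" if \<eta>: "\<eta> \<in> ball ?\<gamma> \<delta>" for \<eta>
  proof (rule fderiv_eqI)
    show "(I_hat V \<phi> h has_derivative blinfun_apply (maupertuis_gradient V (fderiv V) h \<eta>)) (at \<eta>)"
      by (rule has_derivative_transform_within_open[OF maupertuis_has_derivative[OF pd[OF \<eta>]] open_ball \<eta>])
        (simp add: IV)
  qed
  have ffI: "fderiv (fderiv (I_hat V \<phi> h)) ?\<gamma> = L"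
  proof (rule fderiv_eqI)
    show "(fderiv (I_hat V \<phi> h) has_derivative blinfun_apply L) (at ?\<gamma>)"
      by (rule has_derivative_transform_within_open[OF L(1) open_ball \<gamma>b]) (simp add: fI)
  qed
  have rpos: "?r t > 0" if "t \<in> {0..1}" for t using rS[OF that] by (simp add: S_def half_plane_def)
  have cr: "continuous_on {0..1} ?r" by (rule has_L2_deriv_continuous[OF h1_deriv])
  define q where "q = (\<lambda>t. - (lam\<^sub>0 * V_zz V (?r t) 0))"
  have cr0: "continuous_on {0..1} (\<lambda>t. (?r t, 0::real))" by (intro continuous_intros cr)
  have cV2: "continuous_on {0..1} (\<lambda>t. fderiv (fderiv V) (?r t, 0))"
    by (rule continuous_on_compose2[OF cV'' cr0]) (use evS' ev0 in auto)
  have cVzz: "continuous_on {0..1} (\<lambda>t. V_zz V (?r t) 0)"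
  proof -
    have "continuous_on {0..1} (\<lambda>t. blinfun_apply (blinfun_apply (fderiv (fderiv V) (?r t, 0)) (0, 1)) (0, 1))"
      by (intro continuous_intros cV2)
    then show ?thesis by (rule continuous_on_eq) (simp add: V_zz_fderiv[OF V1 rpos])
  qed
  have cq: "continuous_on {0..1} q" unfolding q_def by (intro continuous_intros cVzz)
  have Q: "second_fderiv_form (I_hat V \<phi> h) ?\<gamma> (0, v)
      = b * (LBINT t:{0..1}. (h10_deriv v t)\<^sup>2 + q t * (h10_fun v t)\<^sup>2)" for v
  proof -
    let ?v = "h10_fun v"
    have ev: "path_at t (0, v) = (0, ?v t)" for t
      by (simp add: point_eval_apply zero_h1.rep_eq)
    have cv: "continuous_on {0..1} ?v" by (rule has_L2_deriv_continuous[OF h1_deriv])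
    have "kinetic ?\<gamma> (0, v) = 0" by (simp add: kinetic_def z0 d.zero_left d.zero_right)
    from L(2)[OF this] have "second_fderiv_form (I_hat V \<phi> h) ?\<gamma> (0, v)
        = b * kinetic (0, v) (0, v) - 1 / 2 * K * blinfun_apply (blinfun_apply D (0, v)) (0, v)"
      by (simp add: second_fderiv_form_def ffI b_def K_def pG[OF \<gamma>b])
    also have "kinetic (0, v) (0, v) = (LBINT t:{0..1}. (h10_deriv v t)\<^sup>2)"
    proof -
      have "kinetic (0, v) (0, v) = deriv_inner (h10_h1 v) (h10_h1 v)"
        by (simp add: kinetic_def d.zero_left)
      then show ?thesis by (simp add: deriv_inner_def power2_eq_square)
    qed
    also have "blinfun_apply (blinfun_apply D (0, v)) (0, v) = integral {0..1} (\<lambda>t. V_zz V (?r t) 0 * (?v t)\<^sup>2)"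
    proof -
      let ?E = "\<lambda>t. precompose (point_eval t) o\<^sub>L (fderiv (fderiv V) (?r t, 0) o\<^sub>L point_eval t)"
      have "continuous_on {0..1} (\<lambda>t. precompose (point_eval t))"
        by (rule bounded_linear.continuous_on[OF bounded_linear_precompose continuous_on_point_eval])
      then have cE: "continuous_on {0..1} ?E"
        by (intro bounded_bilinear.continuous_on[OF bounded_bilinear_blinfun_compose] cV2 continuous_on_point_eval)
      have "blinfun_apply D (0, v) = integral {0..1} (\<lambda>t. blinfun_apply (?E t) (0, v))"
        unfolding D_def ev0 by (rule blinfun_apply_integral[OF integrable_continuous_real[OF cE]])
      also have "blinfun_apply \<dots> (0, v) = integral {0..1} (\<lambda>t. blinfun_apply (blinfun_apply (?E t) (0, v)) (0, v))"
        by (rule blinfun_apply_integral) (intro integrable_continuous_real continuous_intros cE)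
      also have "\<dots> = integral {0..1} (\<lambda>t. V_zz V (?r t) 0 * (?v t)\<^sup>2)"
      proof (rule integral_cong)
        fix t :: real assume t: "t \<in> {0..1}"
        have sc: "(0, ?v t) = ?v t *\<^sub>R (0::real, 1::real)" by (simp add: zero_prod_def)
        have "blinfun_apply (blinfun_apply (?E t) (0, v)) (0, v)
            = blinfun_apply (blinfun_apply (fderiv (fderiv V) (?r t, 0)) (0, ?v t)) (0, ?v t)"
          by (simp add: precompose_apply ev)
        also have "\<dots> = V_zz V (?r t) 0 * (?v t)\<^sup>2"
          unfolding sc blinfun.scaleR_right blinfun.scaleR_left V_zz_fderiv[OF V1 rpos[OF t]]
          by (simp add: power2_eq_square)
        finally show "blinfun_apply (blinfun_apply (?E t) (0, v)) (0, v) = V_zz V (?r t) 0 * (?v t)\<^sup>2" .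
      qed
      finally show ?thesis .
    qed
    also have "b * (LBINT t:{0..1}. (h10_deriv v t)\<^sup>2) - 1 / 2 * K * integral {0..1} (\<lambda>t. V_zz V (?r t) 0 * (?v t)\<^sup>2)
        = b * ((LBINT t:{0..1}. (h10_deriv v t)\<^sup>2) + integral {0..1} (\<lambda>t. q t * (?v t)\<^sup>2))"
    proof -
      have "integral {0..1} (\<lambda>t. q t * (?v t)\<^sup>2) = - lam\<^sub>0 * integral {0..1} (\<lambda>t. V_zz V (?r t) 0 * (?v t)\<^sup>2)"
        unfolding q_def by (simp add: mult.assoc)
      then show ?thesis using bpos by (simp add: lamK field_simps)
    qed
    also have "(LBINT t:{0..1}. (h10_deriv v t)\<^sup>2) + integral {0..1} (\<lambda>t. q t * (?v t)\<^sup>2)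
        = (LBINT t:{0..1}. (h10_deriv v t)\<^sup>2 + q t * (?v t)\<^sup>2)"
    proof -
      have s1: "set_integrable lborel {0..1} (\<lambda>t. (h10_deriv v t)\<^sup>2)"
        using h1_deriv[of "h10_h1 v"] by (simp add: has_L2_deriv_def)
      have s2: "set_integrable lborel {0..1} (\<lambda>t. q t * (?v t)\<^sup>2)"
        by (intro set_integrable_continuous continuous_intros cq cv)
      show ?thesis using set_integral_add(2)[OF s1 s2] set_borel_integral_eq_integral(2)[OF s2] by simp
    qed
    finally show ?thesis .
  qed
  define w where "w = (\<lambda>t. lam\<^sub>0 / (?r t)\<^sup>2)"
  have cw: "continuous_on {0..1} w"
    unfolding w_def using rpos by (intro continuous_intros cr) fastforce
  have wpos: "w t > 0" if "t \<in> {0..1}" for t using rpos[OF that] lampos by (simp add: w_def)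
  have "N = {\<mu>. \<mu> < 0 \<and> (\<exists>y y'. dirichlet_solution q w \<mu> y y')}"
    unfolding N_def q_def w_def
    using dirichlet_eigenvalue_reparametrised[OF \<open>\<omega> > 0\<close> lampos cr rpos theta theta0 rbar, of "\<lambda>s. V_zz V s 0"] by simp
  then show ?thesis
    using negative_index_eq_card_dirichlet_eigenvalues[OF cq cw wpos bpos Q] unfolding z_morse_index_def by simp
qed

end
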